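(* Let $\Lambda$ be a non-empty set and let $A_\lambda:X_\lambda\to Y_\lambda$, $\lambda\in\Lambda$, be a collection of linear operators between Banach spaces with $\sup_{\lambda\in\Lambda}\|A_\lambda\|<\infty$. Then for any $1\leqslant p\leqslant\infty$, the induced operator $A:(\oplus_{\lambda\in\Lambda}X_\lambda)_{\ell_p(\Lambda)}\to(\oplus_{\lambda\in\Lambda}Y_\lambda)_{\ell_p(\Lambda)}$ has summable Szlenk index if and only if $(\|A_\lambda\|)_{\lambda\in\Lambda}\in c_0(\Lambda)$ and $(\Sigma(A_\lambda))_{\lambda\in\Lambda}\in\ell_p(\Lambda)$.
   Context: The scalar field $\mathbb{K}$ is $\mathbb{R}$ or $\mathbb{C}$; $B_X$ is the closed unit ball of $X$. The induced operator $A$ is given by $A((x_\lambda)_\lambda)=(A_\lambda x_\lambda)_\lambda$. Summable Szlenk index: for a Banach space $X$, a weak$^*$-compact $K\subset X^*$ and $\varepsilon>0$, $s_\varepsilon(K)$ denotes the set of those $x^*\in K$ such that $\mathrm{diam}(V\cap K)>\varepsilon$ (norm diameter) for every weak$^*$-neighborhood $V$ of $x^*$; for $\varepsilon\leqslant 0$, $s_\varepsilon(K)=K$. $K$ has $M$-summable Szlenk index ($M\geqslant 0$) if whenever $n\in\mathbb{N}$ and $\varepsilon_1,\ldots,\varepsilon_n\in\mathbb{R}$ are such that $s_{\varepsilon_1}\cdots s_{\varepsilon_n}(K)\neq\varnothing$ (with $s_{\varepsilon_n}$ applied first), then $\sum_{i=1}^n\varepsilon_i\leqslant M$; $K$ has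 summable Szlenk index if this holds for some $M\geqslant 0$. An operator $A:X\to Y$ has summable Szlenk index if $A^*B_{Y^*}$ does. The quantity $\Sigma$: for a directed set $D$ and $n\in\mathbb{N}$, $D^{\leqslant n}=\bigcup_{i=1}^nD^i$; for $t=(u_i)_{i=1}^k\in D^{\leqslant n}$ and $0\leqslant j\leqslant k$, $t|_j=(u_i)_{i=1}^j$; $(t,u)$ is $t$ with $u$ appended. A collection $(x_t)_{t\in D^{\leqslant n}}\subset X$ is weakly null if for every $t\in\{\varnothing\}\cup D^{\leqslant n-1}$, $(x_{(t,u)})_{u\in D}$ is a weakly null net. For an operator $A:X\to Y$, $\Sigma_n(A)$ is the infimum of those $s>0$ such that for every directed set $D$ and every weakly null $(x_t)_{t\in D^{\leqslant n}}\subset B_X$, $\inf_{t\in D^n}\|A\sum_{i=1}^nx_{t|_i}\|\leqslant s$; and $\Sigma(A)=\sup_n\Sigma_n(A)\in[0,\infty]$. The condition $(\Sigma(A_\lambda))_\lambda\in\ell_p(\Lambda)$ includes that every $\Sigma(A_\lambda)$ is finite. *)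

theory Defs
  imports "HOL-Analysis.Analysis" "HOL-Algebra.Module"
begin

section \<open>Banach spaces over the reals or the complex numbers\<close>

text \<open>
  A family of Banach spaces is a function into a type of structures, so that every member has its
  own carrier set, operations and norm. The scalar field is a set \<open>K\<close> of complex
  numbers, which is either \<open>\<real>\<close> or \<open>UNIV\<close>. The fields \<open>mult\<close> and \<open>one\<close>, which
  the record of modules inherits from the record of rings, play no role for normed spaces.
\<close>

record 'a normed = "(complex, 'a) module" +
  nrm :: "'a \<Rightarrow> real"

definition scalars :: "complex set \<Rightarrow> complex normed" where
  "scalars K = \<lparr>carrier = K, mult = (*), one = 1, zero = 0, add = (+), smult = (*), nrm = cmod\<rparr>"

text \<open>The value outside the carrier only serves to meet the axioms of the locale
  \<open>Metric_space\<close>, which constrain the metric on the whole type.\<close>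

definition ndist :: "'a normed \<Rightarrow> 'a \<Rightarrow> 'a \<Rightarrow> real" where
  "ndist X x y = (if x \<in> carrier X \<and> y \<in> carrier X then nrm X (x \<ominus>\<^bsub>X\<^esub> y) else 0)"

locale normed_space = module "scalars K" X
  for K :: "complex set" and X :: "'a normed" (structure) +
  assumes scalar_field: "K = \<real> \<or> K = UNIV"
    and nrm_nonneg: "x \<in> carrier X \<Longrightarrow> 0 \<le> nrm X x"
    and nrm_eq_0_iff: "x \<in> carrier X \<Longrightarrow> nrm X x = 0 \<longleftrightarrow> x = \<zero>"
    and nrm_triangle: "x \<in> carrier X \<Longrightarrow> y \<in> carrier X \<Longrightarrow> nrm X (x \<oplus> y) \<le> nrm X x + nrm X y"
    and nrm_smult: "a \<in> K \<Longrightarrow> x \<in> carrier X \<Longrightarrow> nrm X (a \<odot> x) = cmod a * nrm X x"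
begin

lemma nrm_minus:
  assumes x: "x \<in> carrier X"
  shows "nrm X (\<ominus> x) = nrm X x"
proof -
  have K: "- 1 \<in> K" "1 \<in> K"
    using scalar_field by auto
  have cK: "carrier (scalars K) = K" "\<And>a b. a \<oplus>\<^bsub>scalars K\<^esub> b = a + b"
    "\<one>\<^bsub>scalars K\<^esub> = 1" "\<zero>\<^bsub>scalars K\<^esub> = 0"
    by (simp_all add: scalars_def)
  have "(- 1) \<odot> x \<oplus> x = (- 1) \<odot> x \<oplus> 1 \<odot> x"
    using smult_one[OF x] cK by simp
  also have "\<dots> = (- 1 + 1) \<odot> x"
    using smult_l_distr[of "- 1" 1 x] K x cK by simp
  also have "\<dots> = \<zero>"
    using smult_l_null[OF x] cK by simp
  finally have "\<ominus> x = (- 1) \<odot> x"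
    using K x cK smult_closed by (intro M.minus_equality) auto
  then show ?thesis
    using nrm_smult[OF K(1) x] by simp
qed

sublocale Metric_space "carrier X" "ndist X"
proof
  show "0 \<le> ndist X x y" for x y
    by (simp add: ndist_def nrm_nonneg)
  show "ndist X x y = ndist X y x" for x y
  proof (cases "x \<in> carrier X \<and> y \<in> carrier X")
    case True
    then have "x \<ominus> y = \<ominus> (y \<ominus> x)"
      by (simp add: a_minus_def M.minus_add M.a_comm[of "\<ominus> y" x])
    with True show ?thesis
      by (simp add: ndist_def nrm_minus)
  qed (auto simp: ndist_def)
  show "ndist X x y = 0 \<longleftrightarrow> x = y" if "x \<in> carrier X" "y \<in> carrier X" for x y
  proof -
    have "x = y" if "x \<oplus> \<ominus> y = \<zero>"
      using M.minus_equality[OF that] \<open>x \<in> carrier X\<close> \<open>y \<in> carrier X\<close> by simp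
    then show ?thesis
      using that by (auto simp: ndist_def nrm_eq_0_iff a_minus_def M.r_neg)
  qed
  show "ndist X x z \<le> ndist X x y + ndist X y z"
    if "x \<in> carrier X" "y \<in> carrier X" "z \<in> carrier X" for x y z
  proof -
    have "x \<ominus> z = (x \<ominus> y) \<oplus> (y \<ominus> z)"
      using that by (simp add: a_minus_def M.a_assoc M.r_neg1)
    then show ?thesis
      using that nrm_triangle[of "x \<ominus> y" "y \<ominus> z"] by (simp add: ndist_def)
  qed
qed

end

locale banach_space = normed_space +
  assumes complete: mcomplete

definition unit_ball :: "'a normed \<Rightarrow> 'a set" where
  "unit_ball X = {x \<in> carrier X. nrm X x \<le> 1}"

definition bounded_op :: "complex set \<Rightarrow> 'a normed \<Rightarrow> 'b normed \<Rightarrow> ('a \<Rightarrow> 'b) \<Rightarrow> bool" where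
  "bounded_op K X Y T \<longleftrightarrow>
     T \<in> carrier X \<rightarrow> carrier Y \<and>
     (\<forall>x\<in>carrier X. \<forall>y\<in>carrier X. T (x \<oplus>\<^bsub>X\<^esub> y) = T x \<oplus>\<^bsub>Y\<^esub> T y) \<and>
     (\<forall>a\<in>K. \<forall>x\<in>carrier X. T (a \<odot>\<^bsub>X\<^esub> x) = a \<odot>\<^bsub>Y\<^esub> T x) \<and>
     (\<exists>C. \<forall>x\<in>carrier X. nrm Y (T x) \<le> C * nrm X x)"

definition opnorm :: "'a normed \<Rightarrow> 'b normed \<Rightarrow> ('a \<Rightarrow> 'b) \<Rightarrow> real" where
  "opnorm X Y T = (SUP x\<in>unit_ball X. nrm Y (T x))"

section \<open>Dual spaces and the Szlenk derivation\<close>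

definition dual :: "complex set \<Rightarrow> 'a normed \<Rightarrow> ('a \<Rightarrow> complex) normed" where
  "dual K X =
     \<lparr>carrier = {f \<in> extensional (carrier X). bounded_op K X (scalars K) f},
      mult = undefined, one = undefined,
      zero = (\<lambda>x\<in>carrier X. 0),
      add = (\<lambda>f g. \<lambda>x\<in>carrier X. f x + g x),
      smult = (\<lambda>a f. \<lambda>x\<in>carrier X. a * f x),
      nrm = opnorm X (scalars K)\<rparr>"

definition weak_star :: "complex set \<Rightarrow> 'a normed \<Rightarrow> ('a \<Rightarrow> complex) topology" where
  "weak_star K X = subtopology (product_topology (\<lambda>_. euclidean) (carrier X)) (carrier (dual K X))"

definition adjoint :: "'a normed \<Rightarrow> ('a \<Rightarrow> 'b) \<Rightarrow> ('b \<Rightarrow> complex) \<Rightarrow> ('a \<Rightarrow> complex)" where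
  "adjoint X T g = (\<lambda>x\<in>carrier X. g (T x))"

definition ndiam :: "'a normed \<Rightarrow> 'a set \<Rightarrow> ereal" where
  "ndiam X S = (SUP x\<in>S. SUP y\<in>S. ereal (nrm X (x \<ominus>\<^bsub>X\<^esub> y)))"

definition szlenk_deriv ::
  "complex set \<Rightarrow> 'a normed \<Rightarrow> real \<Rightarrow> ('a \<Rightarrow> complex) set \<Rightarrow> ('a \<Rightarrow> complex) set" where
  "szlenk_deriv K X \<epsilon> L =
     (if \<epsilon> \<le> 0 then L
      else {f \<in> L. \<forall>V. openin (weak_star K X) V \<and> f \<in> V \<longrightarrow> ereal \<epsilon> < ndiam (dual K X) (V \<inter> L)})"

text \<open>For \<open>\<epsilon>s = [\<epsilon>\<^sub>1, \<dots>, \<epsilon>\<^sub>n]\<close> the right fold below is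
  \<open>s\<^bsub>\<epsilon>\<^sub>1\<^esub> (\<dots> (s\<^bsub>\<epsilon>\<^sub>n\<^esub> L))\<close>.\<close>

definition summable_szlenk_with ::
  "complex set \<Rightarrow> 'a normed \<Rightarrow> real \<Rightarrow> ('a \<Rightarrow> complex) set \<Rightarrow> bool" where
  "summable_szlenk_with K X M L \<longleftrightarrow>
     (\<forall>\<epsilon>s. \<epsilon>s \<noteq> [] \<and> foldr (szlenk_deriv K X) \<epsilon>s L \<noteq> {} \<longrightarrow> sum_list \<epsilon>s \<le> M)"

definition summable_szlenk :: "complex set \<Rightarrow> 'a normed \<Rightarrow> ('a \<Rightarrow> complex) set \<Rightarrow> bool" where
  "summable_szlenk K X L \<longleftrightarrow> (\<exists>M\<ge>0. summable_szlenk_with K X M L)"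

definition op_summable_szlenk ::
  "complex set \<Rightarrow> 'a normed \<Rightarrow> 'b normed \<Rightarrow> ('a \<Rightarrow> 'b) \<Rightarrow> bool" where
  "op_summable_szlenk K X Y T \<longleftrightarrow> summable_szlenk K X (adjoint X T ` unit_ball (dual K Y))"

section \<open>Weakly null trees and the quantity \<open>\<Sigma>\<close>\<close>

definition directed_set :: "'d set \<Rightarrow> ('d \<Rightarrow> 'd \<Rightarrow> bool) \<Rightarrow> bool" where
  "directed_set D leq \<longleftrightarrow>
     D \<noteq> {} \<and> reflp_on D leq \<and> transp_on D leq \<and> (\<forall>u\<in>D. \<forall>v\<in>D. \<exists>w\<in>D. leq u w \<and> leq v w)"

text \<open>Convergence of a net indexed by \<open>D\<close> is convergence along the filter of its tails.\<close>

definition tails :: "'d set \<Rightarrow> ('d \<Rightarrow> 'd \<Rightarrow> bool) \<Rightarrow> 'd filter" where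
  "tails D leq = (INF u\<in>D. principal {v \<in> D. leq u v})"

definition weakly_null_net ::
  "complex set \<Rightarrow> 'a normed \<Rightarrow> 'd set \<Rightarrow> ('d \<Rightarrow> 'd \<Rightarrow> bool) \<Rightarrow> ('d \<Rightarrow> 'a) \<Rightarrow> bool" where
  "weakly_null_net K X D leq y \<longleftrightarrow>
     (\<forall>f\<in>carrier (dual K X). ((\<lambda>u. f (y u)) \<longlongrightarrow> 0) (tails D leq))"

text \<open>\<open>D\<^bsup>\<le>n\<^esup>\<close> consists of the non-empty lists over \<open>D\<close> of length at most \<open>n\<close>, \<open>(t, u)\<close> is
  \<open>t @ [u]\<close>, and the restriction of \<open>t\<close> to its first \<open>j\<close> entries is \<open>take j t\<close>.\<close>

definition weakly_null_tree ::
  "complex set \<Rightarrow> 'a normed \<Rightarrow> 'd set \<Rightarrow> ('d \<Rightarrow> 'd \<Rightarrow> bool) \<Rightarrow> nat \<Rightarrow> ('d list \<Rightarrow> 'a) \<Rightarrow> bool" where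
  "weakly_null_tree K X D leq n x \<longleftrightarrow>
     (\<forall>t\<in>lists D. length t < n \<longrightarrow> weakly_null_net K X D leq (\<lambda>u. x (t @ [u])))"

definition tree_bound ::
  "'d itself \<Rightarrow> complex set \<Rightarrow> 'a normed \<Rightarrow> 'b normed \<Rightarrow> ('a \<Rightarrow> 'b) \<Rightarrow> nat \<Rightarrow> real \<Rightarrow> bool" where
  "tree_bound TYPE('d) K X Y T n s \<longleftrightarrow>
     (\<forall>(D :: 'd set) leq x.
        directed_set D leq \<and>
        (\<forall>t\<in>lists D. 1 \<le> length t \<and> length t \<le> n \<longrightarrow> x t \<in> unit_ball X) \<and>
        weakly_null_tree K X D leq n x \<longrightarrow>
        (INF t\<in>{t \<in> lists D. length t = n}.
           ereal (nrm Y (T (\<Oplus>\<^bsub>X\<^esub>i\<in>{1..n}. x (take i t))))) \<le> ereal s)"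

text \<open>A definition cannot quantify over directed sets of arbitrary type. The following two
  definitions let them range over the type \<open>'a set\<close>, where \<open>'a\<close> is the element type of the
  space. This entails no loss: by the lemma \<open>tree_bound_any_type\<close> below, a bound for these directed
  sets holds for the directed sets of every type.\<close>

definition Sigma_n ::
  "complex set \<Rightarrow> 'a normed \<Rightarrow> 'b normed \<Rightarrow> ('a \<Rightarrow> 'b) \<Rightarrow> nat \<Rightarrow> ereal" where
  "Sigma_n K X Y T n = Inf (ereal ` {s. 0 < s \<and> tree_bound TYPE('a set) K X Y T n s})"

definition Sigma_op :: "complex set \<Rightarrow> 'a normed \<Rightarrow> 'b normed \<Rightarrow> ('a \<Rightarrow> 'b) \<Rightarrow> ereal" where
  "Sigma_op K X Y T = (SUP n\<in>{1..}. Sigma_n K X Y T n)"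

lemma eventually_tails:
  assumes "directed_set D leq"
  shows "eventually P (tails D leq) \<longleftrightarrow> (\<exists>u\<in>D. \<forall>v\<in>D. leq u v \<longrightarrow> P v)"
proof -
  have ne: "D \<noteq> {}"
    and tr: "transp_on D leq"
    and ub: "\<forall>u\<in>D. \<forall>v\<in>D. \<exists>w\<in>D. leq u w \<and> leq v w"
    using assms unfolding directed_set_def by blast+
  have "\<exists>w\<in>D. principal {v \<in> D. leq w v} \<le> inf (principal {v \<in> D. leq a v}) (principal {v \<in> D. leq b v})"
    if ab: "a \<in> D" "b \<in> D" for a b
  proof -
    obtain w where w: "w \<in> D" "leq a w" "leq b w"
      using ub ab by blast
    have "leq a v" "leq b v" if "v \<in> D" "leq w v" for v
      using transp_onD[OF tr ab(1) w(1) that(1) w(2) that(2)]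
        transp_onD[OF tr ab(2) w(1) that(1) w(3) that(2)] .
    then have "{v \<in> D. leq w v} \<subseteq> {v \<in> D. leq a v} \<inter> {v \<in> D. leq b v}"
      by blast
    then show ?thesis
      using w(1) unfolding inf_principal principal_le_iff by blast
  qed
  then have "eventually P (tails D leq) \<longleftrightarrow> (\<exists>u\<in>D. eventually P (principal {v \<in> D. leq u v}))"
    unfolding tails_def by (intro eventually_INF_base ne)
  also have "\<dots> \<longleftrightarrow> (\<exists>u\<in>D. \<forall>v\<in>D. leq u v \<longrightarrow> P v)"
    unfolding eventually_principal Ball_def mem_Collect_eq imp_conjL by (rule refl)
  finally show ?thesis .
qed

lemma tree_bound_any_type:
  fixes X :: "'a normed"
  assumes bound: "tree_bound TYPE('a set) K X Y T n s"
  shows "tree_bound TYPE('d) K X Y T n s"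
  unfolding tree_bound_def
proof (intro allI impI, elim conjE)
  fix D :: "'d set" and leq x
  assume dir: "directed_set D leq"
    and ball: "\<forall>t\<in>lists D. 1 \<le> length t \<and> length t \<le> n \<longrightarrow> x t \<in> unit_ball X"
    and null: "weakly_null_tree K X D leq n x"
  define nb where "nb F e = {z. \<forall>f\<in>F. cmod (f z) < e}" for F :: "('a \<Rightarrow> complex) set" and e :: real
  define N where "N = {nb F e | F e. finite F \<and> F \<subseteq> carrier (dual K X) \<and> e > 0}"
  have dirN: "directed_set N (\<lambda>U V. V \<subseteq> U)"
    unfolding directed_set_def
  proof (intro conjI ballI)
    have "nb {} 1 \<in> N"
      unfolding N_def by (intro CollectI exI[of _ "{}"] exI[of _ 1]) simp
    then show "N \<noteq> {}"
      by auto
    fix U V assume "U \<in> N" "V \<in> N"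
    then obtain F e G d where U: "U = nb F e" "finite F" "F \<subseteq> carrier (dual K X)" "e > 0"
      and V: "V = nb G d" "finite G" "G \<subseteq> carrier (dual K X)" "d > 0"
      unfolding N_def by blast
    have "nb (F \<union> G) (min e d) \<in> N"
      unfolding N_def using U V by (intro CollectI exI[of _ "F \<union> G"] exI[of _ "min e d"]) auto
    then show "\<exists>W\<in>N. W \<subseteq> U \<and> W \<subseteq> V"
      by (rule bexI[rotated]) (auto simp: nb_def U V)
  qed (auto simp: reflp_on_def transp_on_def)
  define pick where "pick t U = (SOME u. u \<in> D \<and> x (t @ [u]) \<in> U)" for t U
  have pick: "pick t U \<in> D \<and> x (t @ [pick t U]) \<in> U"
    if t: "t \<in> lists D" "length t < n" and UN: "U \<in> N" for t U
  proof -
    obtain F e where U: "U = nb F e" "finite F" "F \<subseteq> carrier (dual K X)" "e > 0"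
      using UN unfolding N_def by blast
    have "\<forall>f\<in>F. \<forall>\<^sub>F u in tails D leq. cmod (f (x (t @ [u]))) < e"
    proof
      fix f assume "f \<in> F"
      then have "((\<lambda>u. f (x (t @ [u]))) \<longlongrightarrow> 0) (tails D leq)"
        using null t U(3) unfolding weakly_null_tree_def weakly_null_net_def by blast
      from tendstoD[OF this U(4)] show "\<forall>\<^sub>F u in tails D leq. cmod (f (x (t @ [u]))) < e"
        by simp
    qed
    then have "\<forall>\<^sub>F u in tails D leq. \<forall>f\<in>F. cmod (f (x (t @ [u]))) < e"
      using U(2) by (simp add: eventually_ball_finite)
    then obtain u where "u \<in> D" and *: "\<forall>v\<in>D. leq u v \<longrightarrow> (\<forall>f\<in>F. cmod (f (x (t @ [v]))) < e)"
      unfolding eventually_tails[OF dir] by blast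
    moreover have "leq u u"
      using dir \<open>u \<in> D\<close> by (auto simp: directed_set_def dest: reflp_onD)
    ultimately have "\<exists>u. u \<in> D \<and> x (t @ [u]) \<in> U"
      by (auto simp: U(1) nb_def)
    then show ?thesis
      unfolding pick_def by (rule someI_ex)
  qed
  define \<phi> where "\<phi> l = foldl (\<lambda>t U. t @ [pick t U]) [] l" for l
  have \<phi>_Nil: "\<phi> [] = []" and \<phi>_snoc: "\<phi> (l @ [U]) = \<phi> l @ [pick (\<phi> l) U]" for l U
    by (simp_all add: \<phi>_def)
  have \<phi>_length: "length (\<phi> l) = length l" for l
    by (induction l rule: rev_induct) (simp_all add: \<phi>_Nil \<phi>_snoc)
  have \<phi>_lists: "\<phi> l \<in> lists D" if "l \<in> lists N" "length l \<le> n" for l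
    using that
  proof (induction l rule: rev_induct)
    case (snoc U l)
    then show ?case
      using pick[of "\<phi> l" U] by (auto simp: \<phi>_snoc \<phi>_length)
  qed (simp add: \<phi>_Nil)
  have \<phi>_take: "take i (\<phi> l) = \<phi> (take i l)" for i l
  proof (induction l rule: rev_induct)
    case (snoc U l)
    then show ?case
      by (cases "i \<le> length l") (simp_all add: \<phi>_snoc \<phi>_length)
  qed (simp add: \<phi>_Nil)
  have ballN: "\<forall>l\<in>lists N. 1 \<le> length l \<and> length l \<le> n \<longrightarrow> x (\<phi> l) \<in> unit_ball X"
    using ball \<phi>_lists by (simp add: \<phi>_length)
  have nullN: "weakly_null_tree K X N (\<lambda>U V. V \<subseteq> U) n (\<lambda>l. x (\<phi> l))"
    unfolding weakly_null_tree_def weakly_null_net_def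
  proof (intro ballI impI tendstoI)
    fix l f and e :: real
    assume l: "l \<in> lists N" "length l < n" and f: "f \<in> carrier (dual K X)" and e: "e > 0"
    have "nb {f} e \<in> N"
      unfolding N_def using f e by (intro CollectI exI[of _ "{f}"] exI[of _ e]) simp
    moreover have "dist (f (x (\<phi> (l @ [U])))) 0 < e" if "U \<in> N" "U \<subseteq> nb {f} e" for U
      using pick[of "\<phi> l" U] \<phi>_lists[of l] l that by (auto simp: \<phi>_snoc \<phi>_length nb_def)
    ultimately show "\<forall>\<^sub>F U in tails N (\<lambda>U V. V \<subseteq> U). dist (f (x (\<phi> (l @ [U])))) 0 < e"
      unfolding eventually_tails[OF dirN] by blast
  qed
  let ?v = "\<lambda>t. ereal (nrm Y (T (\<Oplus>\<^bsub>X\<^esub>i\<in>{1..n}. x (take i t))))"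
  have "(INF t\<in>{t \<in> lists D. length t = n}. ?v t) \<le> (INF l\<in>{l \<in> lists N. length l = n}. ?v (\<phi> l))"
  proof (rule INF_mono)
    fix l assume "l \<in> {l \<in> lists N. length l = n}"
    then have "\<phi> l \<in> {t \<in> lists D. length t = n}"
      using \<phi>_lists[of l] \<phi>_length[of l] by simp
    then show "\<exists>t\<in>{t \<in> lists D. length t = n}. ?v t \<le> ?v (\<phi> l)"
      by (rule bexI[rotated]) simp
  qed
  also have "\<dots> = (INF l\<in>{l \<in> lists N. length l = n}.
      ereal (nrm Y (T (\<Oplus>\<^bsub>X\<^esub>i\<in>{1..n}. x (\<phi> (take i l))))))"
    by (simp add: \<phi>_take)
  also have "\<dots> \<le> ereal s"
    by (rule bound[unfolded tree_bound_def, rule_format, of N "\<lambda>U V. V \<subseteq> U" "\<lambda>l. x (\<phi> l)"])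
      (intro conjI dirN ballN nullN)
  finally show "(INF t\<in>{t \<in> lists D. length t = n}. ?v t) \<le> ereal s" .
qed

section \<open>Direct sums\<close>

definition ell :: "ereal \<Rightarrow> 'i set \<Rightarrow> ('i \<Rightarrow> real) set" where
  "ell p \<Lambda> =
     {a. if p = \<infinity> then bdd_above ((\<lambda>i. \<bar>a i\<bar>) ` \<Lambda>)
         else (\<lambda>i. \<bar>a i\<bar> powr real_of_ereal p) summable_on \<Lambda>}"

definition ell_norm :: "ereal \<Rightarrow> 'i set \<Rightarrow> ('i \<Rightarrow> real) \<Rightarrow> real" where
  "ell_norm p \<Lambda> a =
     (if p = \<infinity> then SUP i\<in>\<Lambda>. \<bar>a i\<bar>
      else (\<Sum>\<^sub>\<infinity>i\<in>\<Lambda>. \<bar>a i\<bar> powr real_of_ereal p) powr (1 / real_of_ereal p))"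

definition c_zero :: "'i set \<Rightarrow> ('i \<Rightarrow> real) set" where
  "c_zero \<Lambda> = {a. \<forall>\<epsilon>>0. finite {i \<in> \<Lambda>. \<epsilon> \<le> \<bar>a i\<bar>}}"

definition direct_sum :: "ereal \<Rightarrow> 'i set \<Rightarrow> ('i \<Rightarrow> 'a normed) \<Rightarrow> ('i \<Rightarrow> 'a) normed" where
  "direct_sum p \<Lambda> X =
     \<lparr>carrier = {x \<in> (\<Pi>\<^sub>E i\<in>\<Lambda>. carrier (X i)). (\<lambda>i. nrm (X i) (x i)) \<in> ell p \<Lambda>},
      mult = undefined, one = undefined,
      zero = (\<lambda>i\<in>\<Lambda>. \<zero>\<^bsub>X i\<^esub>),
      add = (\<lambda>x y. \<lambda>i\<in>\<Lambda>. x i \<oplus>\<^bsub>X i\<^esub> y i),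
      smult = (\<lambda>a x. \<lambda>i\<in>\<Lambda>. a \<odot>\<^bsub>X i\<^esub> x i),
      nrm = (\<lambda>x. ell_norm p \<Lambda> (\<lambda>i. nrm (X i) (x i)))\<rparr>"

definition induced_op :: "'i set \<Rightarrow> ('i \<Rightarrow> 'a \<Rightarrow> 'b) \<Rightarrow> ('i \<Rightarrow> 'a) \<Rightarrow> ('i \<Rightarrow> 'b)" where
  "induced_op \<Lambda> A x = (\<lambda>i\<in>\<Lambda>. A i (x i))"

end

theory Submission
  imports Defs
begin

text \<open>
  Let \<open>wk\<close> be the filter of weak neighbourhoods of zero in the unit ball. By a pruning argument,
  \<open>\<Sigma>\<^sub>n(A) \<le> s\<close> means, up to an arbitrarily small increase of \<open>s\<close>, that eventually in \<open>x\<^sub>1\<close>, eventually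
  in \<open>x\<^sub>2\<close>, and so on, eventually in \<open>x\<^sub>n\<close> (along \<open>wk\<close>) one has \<open>\<parallel>A(x\<^sub>1 + \<dots> + x\<^sub>n)\<parallel> \<le> s\<close>. Unlike an infimum over
  the branches of a tree, such iterated eventualities are closed under finite conjunctions.

  An operator has summable Szlenk index iff these conditions hold for all \<open>n\<close> with a common \<open>s\<close>. If
  \<open>f\<close> lies in \<open>s\<^sub>\<epsilon>(L)\<close> then, frequently in \<open>x\<close>, some \<open>g \<in> L\<close> has \<open>Re g(z + x) \<ge> Re f(z) + \<epsilon>/4 - \<delta>\<close>; conversely,
  if \<open>Re f(z) \<le> a - \<epsilon>\<close> on \<open>s\<^sub>\<epsilon>(L)\<close> for all \<open>\<epsilon>\<close> in a fine finite grid, then, eventually in \<open>x\<close>,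
  \<open>Re g(z + x) \<le> a + \<delta>\<close> for all \<open>g \<in> L\<close>, by weak* compactness. Both facts are iterated \<open>n\<close> times.

  For direct sums, the conditions of finitely many coordinates are pulled back along the projections
  and hold simultaneously, while the remaining coordinates have small norm; this bounds \<open>\<Sigma>\<close> of the
  sum. Playing on one coordinate after the other gives the lower bound. If infinitely many \<open>A\<^sub>\<lambda>\<close>
  have norm at least \<open>\<epsilon>\<close>, then differences of disjointly supported vectors (infinitely supported
  ones if \<open>p = \<infinity>\<close>) are frequently weakly small and their sums have unbounded images.
\<close>

section \<open>Functionals\<close>

text \<open>The two sides are compared only up to constants. From derivations to norms a factor 4 is
  lost: one half because a set of diameter above \<epsilon> around f only yields a functional at
  distance above \<epsilon>/2 from f, the other because a difference of two ball vectors must be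
  halved to return to the ball. In the converse direction \<delta> is lost per level, and \<delta> =
  1/n keeps the total at 1. The finite grid is forced: the order of derivation that matters depends
  on a cluster point f found only afterwards, whereas only finitely many eventual conditions can be
  imposed beforehand. For the norms, the unit vectors of an l1 sum are not weakly null, so a
  pigeonhole argument replaces them by differences; these meet each weak neighbourhood, which is
  enough to exploit an eventuality. For p = \<infinity> vectors on new coordinates would leave the
  supremum norm bounded, so the moves are stacked on the same coordinates instead, which requires
  blocks of infinite support.\<close>

lemma scalars_sel [simp]:
  "carrier (scalars K) = K" "a \<oplus>\<^bsub>scalars K\<^esub> b = a + b" "a \<odot>\<^bsub>scalars K\<^esub> b = a * b"
  "a \<otimes>\<^bsub>scalars K\<^esub> b = a * b" "\<zero>\<^bsub>scalars K\<^esub> = 0" "\<one>\<^bsub>scalars K\<^esub> = 1" "nrm (scalars K) = cmod"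
  by (simp_all add: scalars_def)

lemma cring_scalars:
  assumes "K = \<real> \<or> K = UNIV"
  shows "cring (scalars K)"
proof (rule cringI)
  show "abelian_group (scalars K)"
  proof (rule abelian_groupI)
    fix x assume "x \<in> carrier (scalars K)"
    then show "\<exists>y\<in>carrier (scalars K). y \<oplus>\<^bsub>scalars K\<^esub> x = \<zero>\<^bsub>scalars K\<^esub>"
      using assms by (intro bexI[of _ "- x"]) auto
  qed (use assms in \<open>auto\<close>)
  show "Group.comm_monoid (scalars K)"
    by (rule comm_monoidI) (use assms in \<open>auto\<close>)
qed (simp add: algebra_simps)

lemma bounded_opD:
  assumes "bounded_op K X Y T" "x \<in> carrier X"
  shows "T x \<in> carrier Y"
    and "y \<in> carrier X \<Longrightarrow> T (x \<oplus>\<^bsub>X\<^esub> y) = T x \<oplus>\<^bsub>Y\<^esub> T y"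
    and "a \<in> K \<Longrightarrow> T (a \<odot>\<^bsub>X\<^esub> x) = a \<odot>\<^bsub>Y\<^esub> T x"
  using assms unfolding bounded_op_def by blast+

lemma dual_carrier: "f \<in> carrier (dual K X) \<longleftrightarrow> f \<in> extensional (carrier X) \<and> bounded_op K X (scalars K) f"
  by (simp add: dual_def)

context normed_space
begin

lemma K_simps [simp]: "0 \<in> K" "1 \<in> K" "-1 \<in> K" "complex_of_real r \<in> K"
  using scalar_field by auto

lemma K_closed: "a \<in> K \<Longrightarrow> b \<in> K \<Longrightarrow> a + b \<in> K" "a \<in> K \<Longrightarrow> b \<in> K \<Longrightarrow> a * b \<in> K"
  "a \<in> K \<Longrightarrow> b \<in> K \<Longrightarrow> a - b \<in> K" "a \<in> K \<Longrightarrow> - a \<in> K" "a \<in> K \<Longrightarrow> cnj a \<in> K"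
  using scalar_field by (auto simp: Reals_cnj_iff)

lemma smult_cl [simp, intro]: "a \<in> K \<Longrightarrow> x \<in> carrier X \<Longrightarrow> a \<odot> x \<in> carrier X"
  using smult_closed by simp

lemma neg_eq_smult: "x \<in> carrier X \<Longrightarrow> \<ominus> x = (-1) \<odot> x"
proof -
  assume x: "x \<in> carrier X"
  have "(- 1) \<odot> x \<oplus> x = (- 1) \<odot> x \<oplus> 1 \<odot> x"
    using smult_one[OF x] by simp
  also have "\<dots> = (- 1 + 1) \<odot> x"
    using smult_l_distr[of "- 1" 1 x] x by simp
  also have "\<dots> = \<zero>"
    using smult_l_null[OF x] by simp
  finally show ?thesis
    using x by (intro M.minus_equality) auto
qed

lemma neg_zero: "\<ominus> \<zero> = \<zero>"
  by (rule M.minus_equality) auto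

lemma nrm_zero [simp]: "nrm X \<zero> = 0"
  by (simp add: nrm_eq_0_iff)

lemma unit_ball_carrier: "x \<in> unit_ball X \<Longrightarrow> x \<in> carrier X"
  and unit_ball_nrm: "x \<in> unit_ball X \<Longrightarrow> nrm X x \<le> 1"
  by (auto simp: unit_ball_def)

lemma zero_unit_ball [simp]: "\<zero> \<in> unit_ball X"
  by (simp add: unit_ball_def)

lemma half_difference_unit_ball:
  assumes "x \<in> unit_ball X" "y \<in> unit_ball X"
  shows "(1/2) \<odot> (x \<ominus> y) \<in> unit_ball X"
proof -
  have K: "1/2 \<in> K"
    using K_simps(4)[of "1/2"] by simp
  have c: "x \<in> carrier X" "y \<in> carrier X"
    using assms unit_ball_carrier by auto
  have "nrm X (x \<ominus> y) \<le> 2"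
    using nrm_triangle[of x "\<ominus> y"] nrm_minus[of y] assms c by (auto simp: unit_ball_def a_minus_def)
  then show ?thesis
    using c K by (auto simp: unit_ball_def nrm_smult)
qed

context
  fixes f assumes f: "f \<in> carrier (dual K X)"
begin

lemma dual_in_K: "x \<in> carrier X \<Longrightarrow> f x \<in> K"
  and dual_add: "x \<in> carrier X \<Longrightarrow> y \<in> carrier X \<Longrightarrow> f (x \<oplus> y) = f x + f y"
  and dual_smult: "a \<in> K \<Longrightarrow> x \<in> carrier X \<Longrightarrow> f (a \<odot> x) = a * f x"
  using f bounded_opD[of K X "scalars K" f] unfolding dual_carrier by force+

lemma dual_zero: "f \<zero> = 0"
  using dual_add[of \<zero> \<zero>] by simp

lemma dual_neg: "x \<in> carrier X \<Longrightarrow> f (\<ominus> x) = - f x"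
  by (simp add: neg_eq_smult dual_smult)

lemma dual_minus: "x \<in> carrier X \<Longrightarrow> y \<in> carrier X \<Longrightarrow> f (x \<ominus> y) = f x - f y"
  by (simp add: a_minus_def dual_add dual_neg)

lemma dual_bound: "\<exists>C>0. \<forall>x\<in>carrier X. cmod (f x) \<le> C * nrm X x"
proof -
  obtain C where C: "\<forall>x\<in>carrier X. cmod (f x) \<le> C * nrm X x"
    using f unfolding dual_carrier bounded_op_def by auto
  have "cmod (f x) \<le> max C 1 * nrm X x" if "x \<in> carrier X" for x
    using C[rule_format, OF that] mult_right_mono[of C "max C 1" "nrm X x"] nrm_nonneg[OF that]
    by linarith
  then show ?thesis by (intro exI[of _ "max C 1"]) auto
qed

end

lemma dualI:
  assumes "\<And>x. x \<in> carrier X \<Longrightarrow> f x \<in> K"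
    and "\<And>x y. x \<in> carrier X \<Longrightarrow> y \<in> carrier X \<Longrightarrow> f (x \<oplus> y) = f x + f y"
    and "\<And>a x. a \<in> K \<Longrightarrow> x \<in> carrier X \<Longrightarrow> f (a \<odot> x) = a * f x"
    and "\<And>x. x \<in> carrier X \<Longrightarrow> cmod (f x) \<le> C * nrm X x"
  shows "restrict f (carrier X) \<in> carrier (dual K X)"
  using assms unfolding dual_carrier bounded_op_def by (auto intro!: exI[of _ C])

end

lemma dual_compose:
  assumes "normed_space K X" "normed_space K Y" "bounded_op K X Y T" "g \<in> carrier (dual K Y)"
  shows "restrict (\<lambda>x. g (T x)) (carrier X) \<in> carrier (dual K X)"
proof -
  interpret X: normed_space K X by fact
  interpret Y: normed_space K Y by fact
  obtain C where C: "C > 0" "\<forall>y\<in>carrier Y. cmod (g y) \<le> C * nrm Y y"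
    using Y.dual_bound[OF assms(4)] by blast
  obtain C' where C': "\<forall>x\<in>carrier X. nrm Y (T x) \<le> C' * nrm X x"
    using assms(3) unfolding bounded_op_def by blast
  note T = bounded_opD[OF assms(3)]
  show ?thesis
  proof (rule X.dualI[where C = "C * C'"])
    show "cmod (g (T x)) \<le> C * C' * nrm X x" if "x \<in> carrier X" for x
      using C C' T(1)[OF that] that mult_left_mono[of "nrm Y (T x)" "C' * nrm X x" C]
      by (smt (verit) mult.assoc)
  qed (use T Y.dual_in_K[OF assms(4)] Y.dual_add[OF assms(4)] Y.dual_smult[OF assms(4)] in auto)
qed

section \<open>Iterated weak neighbourhoods of zero in the unit ball\<close>

definition wk :: "complex set \<Rightarrow> 'a normed \<Rightarrow> 'a filter" where
  "wk K X = (INF (F, e)\<in>{(F, e). finite F \<and> F \<subseteq> carrier (dual K X) \<and> (e::real) > 0}.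
     principal {x \<in> unit_ball X. \<forall>f\<in>F. cmod (f x) < e})"

lemma eventually_wk:
  "eventually P (wk K X) \<longleftrightarrow> (\<exists>F e. finite F \<and> F \<subseteq> carrier (dual K X) \<and> e > 0 \<and>
     (\<forall>x\<in>unit_ball X. (\<forall>f\<in>F. cmod (f x) < e) \<longrightarrow> P x))"
proof -
  let ?I = "{(F, e). finite F \<and> F \<subseteq> carrier (dual K X) \<and> (e::real) > 0}"
  let ?p = "\<lambda>(F, e). principal {x \<in> unit_ball X. \<forall>f\<in>F. cmod (f x) < e}"
  have "({}, 1) \<in> ?I" by simp
  then have "eventually P (wk K X) \<longleftrightarrow> (\<exists>b\<in>?I. eventually P (?p b))"
    unfolding wk_def
  proof (intro eventually_INF_base, blast)
    fix a b assume "a \<in> ?I" "b \<in> ?I"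
    then have "(fst a \<union> fst b, min (snd a) (snd b)) \<in> ?I"
      by auto
    moreover have "?p (fst a \<union> fst b, min (snd a) (snd b)) \<le> inf (?p a) (?p b)"
      by (auto simp: split_beta)
    ultimately show "\<exists>x\<in>?I. ?p x \<le> inf (?p a) (?p b)" by blast
  qed
  also have "\<dots> \<longleftrightarrow> (\<exists>F e. finite F \<and> F \<subseteq> carrier (dual K X) \<and> e > 0 \<and>
     (\<forall>x\<in>unit_ball X. (\<forall>f\<in>F. cmod (f x) < e) \<longrightarrow> P x))"
    by (simp add: eventually_principal Bex_def imp_conjL Ball_def)
  finally show ?thesis .
qed

lemma frequently_wk:
  "frequently P (wk K X) \<longleftrightarrow> (\<forall>F e. finite F \<and> F \<subseteq> carrier (dual K X) \<and> e > 0 \<longrightarrow>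
     (\<exists>x\<in>unit_ball X. (\<forall>f\<in>F. cmod (f x) < e) \<and> P x))"
  unfolding frequently_def eventually_wk by blast

lemma eventually_wk_unit_ball: "eventually (\<lambda>x. x \<in> unit_ball X) (wk K X)"
  unfolding eventually_wk by (intro exI[of _ "{}"] exI[of _ 1]) auto

lemma eventually_wk_small:
  "f \<in> carrier (dual K X) \<Longrightarrow> e > 0 \<Longrightarrow> eventually (\<lambda>x. cmod (f x) < e) (wk K X)"
  unfolding eventually_wk by (intro exI[of _ "{f}"] exI[of _ e]) auto

text \<open>A basic neighbourhood involves finitely many functionals, so convergence may be tested
  on one functional at a time.\<close>

lemma filterlim_wk:
  assumes "eventually (\<lambda>x. h x \<in> unit_ball X) F"
    and "\<And>f. f \<in> carrier (dual K X) \<Longrightarrow> ((\<lambda>x. f (h x)) \<longlongrightarrow> 0) F"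
  shows "filterlim h (wk K X) F"
  unfolding filterlim_iff eventually_wk
proof (intro allI impI, elim exE conjE)
  fix P G and e :: real
  assume G: "finite G" "G \<subseteq> carrier (dual K X)" "e > 0"
    "\<forall>x\<in>unit_ball X. (\<forall>f\<in>G. cmod (f x) < e) \<longrightarrow> P x"
  have "\<forall>\<^sub>F x in F. \<forall>f\<in>G. cmod (f (h x)) < e"
    using G assms(2)[THEN tendstoD, OF _ G(3)] by (intro eventually_ball_finite) auto
  with assms(1) show "\<forall>\<^sub>F x in F. P (h x)"
    by eventually_elim (use G(4) in blast)
qed

text \<open>Each neighbourhood may depend on the vectors already played, but only through their sum
  \<open>z\<close>: the final condition \<open>Q\<close> sees nothing else, so no record of the
  branch is carried.\<close>

primrec ev_sum :: "complex set \<Rightarrow> 'a normed \<Rightarrow> nat \<Rightarrow> ('a \<Rightarrow> bool) \<Rightarrow> 'a \<Rightarrow> bool" where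
  "ev_sum K X 0 Q z = Q z"
| "ev_sum K X (Suc n) Q z = (\<forall>\<^sub>F x in wk K X. ev_sum K X n Q (z \<oplus>\<^bsub>X\<^esub> x))"

lemma ev_sum_add: "ev_sum K X (m + n) Q z = ev_sum K X m (ev_sum K X n Q) z"
  by (induction m arbitrary: z) auto

text \<open>The defining equation peels off the first level. Peeling off the last one keeps the base
  point and changes \<open>Q\<close>, which suits inductions that prolong a play by one
  move.\<close>

lemma ev_sum_Suc: "ev_sum K X (Suc n) Q z = ev_sum K X n (\<lambda>z. \<forall>\<^sub>F x in wk K X. Q (z \<oplus>\<^bsub>X\<^esub> x)) z"
  by (induction n arbitrary: z) auto

context normed_space
begin

lemma ev_sum_mono:
  assumes "ev_sum K X n P z" "z \<in> carrier X" "\<And>x. x \<in> carrier X \<Longrightarrow> P x \<Longrightarrow> Q x"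
  shows "ev_sum K X n Q z"
  using assms(1,2)
proof (induction n arbitrary: z)
  case (Suc n)
  from Suc.prems(1) have "\<forall>\<^sub>F x in wk K X. ev_sum K X n P (z \<oplus> x)"
    by simp
  with eventually_wk_unit_ball[of X K] have "\<forall>\<^sub>F x in wk K X. ev_sum K X n Q (z \<oplus> x)"
    by eventually_elim (use Suc unit_ball_carrier in auto)
  then show ?case by simp
qed (use assms(3) in auto)

lemma ev_sum_conj:
  assumes "ev_sum K X n P z" "ev_sum K X n Q z"
  shows "ev_sum K X n (\<lambda>x. P x \<and> Q x) z"
  using assms by (induction n arbitrary: z) (auto elim: eventually_elim2)

lemma ev_sum_ball_finite:
  assumes "finite I" "\<And>i. i \<in> I \<Longrightarrow> ev_sum K X n (P i) z" "z \<in> carrier X"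
  shows "ev_sum K X n (\<lambda>x. \<forall>i\<in>I. P i x) z"
  using assms
proof (induction I)
  case empty
  have "ev_sum K X n (\<lambda>x. True) z" for z
    by (induction n arbitrary: z) auto
  then show ?case by simp
next
  case (insert i I)
  then show ?case
    using ev_sum_conj[of n "P i" z "\<lambda>x. \<forall>i\<in>I. P i x"] by simp
qed

text \<open>Each of the \<open>n\<close> vectors lies in the unit ball. The linear growth is
  harmless, since the threshold below which an operator counts as small may depend on
  \<open>n\<close>.\<close>

lemma ev_sum_nrm:
  assumes "z \<in> carrier X"
  shows "ev_sum K X n (\<lambda>x. nrm X x \<le> nrm X z + n) z"
  using assms
proof (induction n arbitrary: z)
  case (Suc n)
  have "\<forall>\<^sub>F x in wk K X. ev_sum K X n (\<lambda>x. nrm X x \<le> nrm X z + Suc n) (z \<oplus> x)"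
    using eventually_wk_unit_ball[of X K]
  proof eventually_elim
    case (elim x)
    then have x: "x \<in> carrier X" "nrm X x \<le> 1"
      using unit_ball_carrier unit_ball_nrm by auto
    then have "ev_sum K X n (\<lambda>y. nrm X y \<le> nrm X (z \<oplus> x) + n) (z \<oplus> x)"
      using Suc by auto
    then show ?case
      by (rule ev_sum_mono) (use nrm_triangle[of z x] x Suc.prems in auto)
  qed
  then show ?case by simp
qed simp

text \<open>This is monotonicity read backwards. It finds one vector at which an iterated
  eventuality is realised while a refuted condition fails.\<close>

lemma ev_sum_witness:
  assumes "ev_sum K X n P z" "\<not> ev_sum K X n Q z" "z \<in> carrier X"
  obtains x where "x \<in> carrier X" "P x" "\<not> Q x"
  using assms ev_sum_mono by blast

end

text \<open>Additivity of \<open>h\<close> turns a sum of moves into the sum of their images, and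
  the limit pulls back each level. The base point \<open>z\<close> lets a coordinate embedding start
  from a vector already reached; for projections it is zero.\<close>

lemma ev_sum_push:
  assumes "normed_space K X" "normed_space K Z"
    and h: "filterlim h (wk K Z) (wk K X)" "h \<in> carrier X \<rightarrow> carrier Z"
    "\<And>x y. x \<in> carrier X \<Longrightarrow> y \<in> carrier X \<Longrightarrow> h (x \<oplus>\<^bsub>X\<^esub> y) = h x \<oplus>\<^bsub>Z\<^esub> h y"
    and z: "z \<in> carrier Z" and x: "x \<in> carrier X"
    and ev: "ev_sum K Z n Q (z \<oplus>\<^bsub>Z\<^esub> h x)"
  shows "ev_sum K X n (\<lambda>x. Q (z \<oplus>\<^bsub>Z\<^esub> h x)) x"
  using x ev
proof (induction n arbitrary: x)
  case (Suc n)
  interpret X: normed_space K X by fact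
  interpret Z: normed_space K Z by fact
  have "\<forall>\<^sub>F y in wk K X. ev_sum K Z n Q (z \<oplus>\<^bsub>Z\<^esub> h x \<oplus>\<^bsub>Z\<^esub> h y)"
    using Suc.prems(2) eventually_compose_filterlim[OF _ h(1)] by simp
  with eventually_wk_unit_ball[of X K]
  have "\<forall>\<^sub>F y in wk K X. ev_sum K X n (\<lambda>x. Q (z \<oplus>\<^bsub>Z\<^esub> h x)) (x \<oplus>\<^bsub>X\<^esub> y)"
  proof eventually_elim
    case (elim y)
    then have y: "y \<in> carrier X" using X.unit_ball_carrier by simp
    have "z \<oplus>\<^bsub>Z\<^esub> h x \<oplus>\<^bsub>Z\<^esub> h y = z \<oplus>\<^bsub>Z\<^esub> h (x \<oplus>\<^bsub>X\<^esub> y)"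
      using h(2,3) y Suc.prems(1) z by (auto simp: Z.M.a_assoc Pi_iff)
    then show ?case using Suc.IH elim y Suc.prems(1) by simp
  qed
  then show ?case by simp
qed simp

section \<open>Weakly null trees\<close>

text \<open>At each node the eventuality passes to a tail of the weakly null net of its children, so
  some child keeps the remaining levels alive. The branch obtained in this way bounds the
  infimum.\<close>

lemma tree_bound_if_ev_sum:
  assumes "normed_space K X" "ev_sum K X n (\<lambda>z. nrm Y (T z) \<le> s) \<zero>\<^bsub>X\<^esub>"
  shows "tree_bound TYPE('d) K X Y T n s"
  unfolding tree_bound_def
proof (intro allI impI, elim conjE)
  interpret normed_space K X by fact
  fix D :: "'d set" and leq x
  assume dir: "directed_set D leq"
    and ball: "\<forall>t\<in>lists D. 1 \<le> length t \<and> length t \<le> n \<longrightarrow> x t \<in> unit_ball X"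
    and null: "weakly_null_tree K X D leq n x"
  let ?Q = "\<lambda>z. nrm Y (T z) \<le> s"
  let ?s = "\<lambda>t k. \<Oplus>\<^bsub>X\<^esub>i\<in>{1..k}. x (take i t)"
  \<comment> \<open>Invariant: the partial sum along \<open>t\<close> satisfies the condition with
    \<open>m\<close> levels to go, and \<open>t'\<close> completes \<open>t\<close> to a full
    branch.\<close>
  have "\<exists>t'. length t' = m \<and> t' \<in> lists D \<and> ?Q (?s (t @ t') n)"
    if "length t + m = n" "t \<in> lists D" "ev_sum K X m ?Q (?s t (length t))" for m t
    using that
  proof (induction m arbitrary: t)
    case 0
    then show ?case by (intro exI[of _ "[]"]) auto
  next
    case (Suc m)
    have lim: "filterlim (\<lambda>u. x (t @ [u])) (wk K X) (tails D leq)"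
    proof (rule filterlim_wk)
      obtain u where "u \<in> D" using dir by (auto simp: directed_set_def)
      then show "\<forall>\<^sub>F u in tails D leq. x (t @ [u]) \<in> unit_ball X"
        unfolding eventually_tails[OF dir] using ball Suc.prems by auto
      show "((\<lambda>u. f (x (t @ [u]))) \<longlongrightarrow> 0) (tails D leq)" if "f \<in> carrier (dual K X)" for f
        using null that Suc.prems unfolding weakly_null_tree_def weakly_null_net_def by auto
    qed
    have "\<forall>\<^sub>F y in wk K X. ev_sum K X m ?Q (?s t (length t) \<oplus>\<^bsub>X\<^esub> y)"
      using Suc.prems by simp
    from eventually_compose_filterlim[OF this lim]
    have "\<forall>\<^sub>F u in tails D leq. ev_sum K X m ?Q (?s t (length t) \<oplus>\<^bsub>X\<^esub> x (t @ [u]))" .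
    then obtain u where u: "u \<in> D" "ev_sum K X m ?Q (?s t (length t) \<oplus>\<^bsub>X\<^esub> x (t @ [u]))"
      unfolding eventually_tails[OF dir] using dir by (auto simp: directed_set_def dest: reflp_onD)
    let ?t = "t @ [u]"
    have xin: "x (take i ?t) \<in> carrier X" if "1 \<le> i" "i \<le> length ?t" for i
    proof -
      have "take i ?t \<in> lists D" using Suc.prems u set_take_subset[of i ?t] by auto
      then have "x (take i ?t) \<in> unit_ball X" using that ball Suc.prems(1) by (intro ball[rule_format]) auto
      then show ?thesis by (rule unit_ball_carrier)
    qed
    have xin': "x (take i t) \<in> carrier X" if "i \<in> {Suc 0..length t}" for i
      using xin[of i] that by simp
    have "?s ?t (length ?t) = x (take (Suc (length t)) ?t) \<oplus>\<^bsub>X\<^esub> ?s ?t (length t)"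
      unfolding length_append list.size atLeastAtMostSuc_conv[of 1 "length t", simplified]
      by (simp add: atLeastAtMostSuc_conv, subst M.finsum_insert)
        (use xin' xin[of "Suc (length t)"] in auto)
    also have "?s ?t (length t) = ?s t (length t)"
      by (rule M.finsum_cong') (use xin' in auto)
    also have "x (take (Suc (length t)) ?t) \<oplus>\<^bsub>X\<^esub> ?s t (length t) = ?s t (length t) \<oplus>\<^bsub>X\<^esub> x ?t"
    proof -
      have "?s t (length t) \<in> carrier X"
        by (rule M.finsum_closed) (use xin' in auto)
      then show ?thesis
        using xin[of "Suc (length t)"] by (simp add: M.a_comm)
    qed
    finally have "ev_sum K X m ?Q (?s ?t (length ?t))" using u by simp
    then obtain t' where "length t' = m" "t' \<in> lists D" "?Q (?s (?t @ t') n)"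
      using Suc.IH[of ?t] Suc.prems u by auto
    then show ?case using u by (intro exI[of _ "u # t'"]) auto
  qed
  from this[of "[]" n] assms(2) obtain t where
    "length t = n" "t \<in> lists D" "?Q (?s t n)" by auto
  then show "(INF t\<in>{t \<in> lists D. length t = n}.
           ereal (nrm Y (T (\<Oplus>\<^bsub>X\<^esub>i\<in>{1..n}. x (take i t))))) \<le> ereal s"
    by (intro INF_lower2[of t]) auto
qed

text \<open>Where the iterated eventuality fails, every weak neighbourhood contains a vector after
  which it fails with one level less. Indexed by the neighbourhoods themselves, these choices form a
  weakly null tree all of whose branches exceed \<open>s'\<close>. Their infimum may equal
  \<open>s'\<close>, whence the gap between \<open>s\<close> and \<open>s'\<close>.\<close>

lemma ev_sum_if_tree_bound:
  fixes X :: "'a normed"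
  assumes "normed_space K X" and bound: "tree_bound TYPE('a set) K X Y T n s" and "s < s'"
  shows "ev_sum K X n (\<lambda>z. nrm Y (T z) \<le> s') \<zero>\<^bsub>X\<^esub>"
proof (rule ccontr)
  interpret normed_space K X by fact
  let ?Q = "\<lambda>z. nrm Y (T z) \<le> s'"
  assume neg: "\<not> ev_sum K X n ?Q \<zero>\<^bsub>X\<^esub>"
  define nb where "nb F e = {z. \<forall>f\<in>F. cmod (f z) < e}" for F :: "('a \<Rightarrow> complex) set" and e :: real
  define N where "N = {nb F e | F e. finite F \<and> F \<subseteq> carrier (dual K X) \<and> e > 0}"
  have dirN: "directed_set N (\<lambda>U V. V \<subseteq> U)"
    unfolding directed_set_def
  proof (intro conjI ballI)
    have "nb {} 1 \<in> N"
      unfolding N_def by (intro CollectI exI[of _ "{}"] exI[of _ 1]) simp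
    then show "N \<noteq> {}"
      by auto
    fix U V assume "U \<in> N" "V \<in> N"
    then obtain F e G d where U: "U = nb F e" "finite F" "F \<subseteq> carrier (dual K X)" "e > 0"
      and V: "V = nb G d" "finite G" "G \<subseteq> carrier (dual K X)" "d > 0"
      unfolding N_def by blast
    have "nb (F \<union> G) (min e d) \<in> N"
      unfolding N_def using U V by (intro CollectI exI[of _ "F \<union> G"] exI[of _ "min e d"]) auto
    then show "\<exists>W\<in>N. W \<subseteq> U \<and> W \<subseteq> V"
      by (rule bexI[rotated]) (auto simp: nb_def U V)
  qed (auto simp: reflp_on_def transp_on_def)
  \<comment> \<open>Here \<open>k\<close> vectors have been chosen, with sum \<open>z\<close>; after
    the new one \<open>n - Suc k\<close> levels remain.\<close>
  define pick where
    "pick k z U = (SOME x. x \<in> unit_ball X \<and> x \<in> U \<and> \<not> ev_sum K X (n - Suc k) ?Q (z \<oplus>\<^bsub>X\<^esub> x))" for k z U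
  have pick: "pick k z U \<in> unit_ball X \<and> pick k z U \<in> U \<and> \<not> ev_sum K X (n - Suc k) ?Q (z \<oplus>\<^bsub>X\<^esub> pick k z U)"
    if k: "k < n" and z: "\<not> ev_sum K X (n - k) ?Q z" and UN: "U \<in> N" for k z U
  proof -
    have "n - k = Suc (n - Suc k)" using k by simp
    with z have "\<exists>\<^sub>F x in wk K X. \<not> ev_sum K X (n - Suc k) ?Q (z \<oplus>\<^bsub>X\<^esub> x)"
      by (simp add: not_eventually)
    moreover obtain F e where U: "U = nb F e" "finite F" "F \<subseteq> carrier (dual K X)" "e > 0"
      using UN unfolding N_def by blast
    ultimately obtain x where "x \<in> unit_ball X" "x \<in> U" "\<not> ev_sum K X (n - Suc k) ?Q (z \<oplus>\<^bsub>X\<^esub> x)"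
      unfolding frequently_wk nb_def by blast
    then show ?thesis unfolding pick_def by (intro someI[of "\<lambda>x. _ x \<and> _ x \<and> _ x"]) simp
  qed
  \<comment> \<open>Every choice depends on depth and running sum, so both are folded along the
    list. The vector of a node is then read off from its parent list and its last entry.\<close>
  define st where "st = foldl (\<lambda>(k, z) U. (Suc k, z \<oplus>\<^bsub>X\<^esub> pick k z U)) (0, \<zero>\<^bsub>X\<^esub>)"
  define \<psi> where "\<psi> l = snd (st l)" for l
  define x where "x l = pick (length l - 1) (\<psi> (butlast l)) (last l)" for l
  have "fst (st l) = length l" for l
    by (induction l rule: rev_induct) (simp_all add: st_def split_beta)
  then have \<psi>_snoc: "\<psi> (l @ [U]) = \<psi> l \<oplus>\<^bsub>X\<^esub> x (l @ [U])" for l U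
    by (simp add: \<psi>_def x_def split_beta) (simp add: st_def split_beta)
  have \<psi>: "\<psi> l \<in> carrier X \<and> \<not> ev_sum K X (n - length l) ?Q (\<psi> l)"
    and x: "l \<noteq> [] \<Longrightarrow> x l \<in> unit_ball X \<and> x l \<in> last l"
    if "l \<in> lists N" "length l \<le> n" for l
    using that
  proof (induction l rule: rev_induct)
    case Nil
    { case 1 then show ?case using neg by (simp add: \<psi>_def st_def)
    next case 2 then show ?case by simp }
  next
    case (snoc U l)
    { case 1 then show ?case
        using snoc pick[of "length l" "\<psi> l" U] unit_ball_carrier by (simp add: \<psi>_snoc) (simp add: x_def)
    next case 2 then show ?case
        using snoc pick[of "length l" "\<psi> l" U] by (simp add: x_def) }
  qed
  have sum: "(\<Oplus>\<^bsub>X\<^esub>i\<in>{1..m}. x (take i l)) = \<psi> (take m l)"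
    if "l \<in> lists N" "length l \<le> n" "m \<le> length l" for l m
    using that(3)
  proof (induction m)
    case 0
    then show ?case by (simp add: \<psi>_def st_def)
  next
    case (Suc m)
    have xc: "x (take i l) \<in> carrier X" if "1 \<le> i" "i \<le> Suc m" for i
    proof -
      have "take i l \<in> lists N" using \<open>l \<in> lists N\<close> set_take_subset[of i l] by auto
      moreover have "take i l \<noteq> []" using that Suc.prems by auto
      ultimately show ?thesis
        using x[of "take i l"] \<open>length l \<le> n\<close> unit_ball_carrier by simp
    qed
    have "(\<Oplus>\<^bsub>X\<^esub>i\<in>{1..Suc m}. x (take i l)) = x (take (Suc m) l) \<oplus>\<^bsub>X\<^esub> (\<Oplus>\<^bsub>X\<^esub>i\<in>{1..m}. x (take i l))"
      by (simp add: atLeastAtMostSuc_conv, subst M.finsum_insert) (use xc in auto)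
    also have "(\<Oplus>\<^bsub>X\<^esub>i\<in>{1..m}. x (take i l)) = \<psi> (take m l)"
      using Suc by simp
    also have "x (take (Suc m) l) \<oplus>\<^bsub>X\<^esub> \<psi> (take m l) = \<psi> (take m l) \<oplus>\<^bsub>X\<^esub> x (take (Suc m) l)"
    proof -
      have "take m l \<in> lists N" using \<open>l \<in> lists N\<close> set_take_subset[of m l] by auto
      then show ?thesis using xc[of "Suc m"] \<psi>[of "take m l"] that by (simp add: M.a_comm)
    qed
    also have "\<dots> = \<psi> (take (Suc m) l)"
      using \<psi>_snoc[of "take m l" "l ! m"] Suc.prems by (simp add: take_Suc_conv_app_nth)
    finally show ?case .
  qed
  have null: "weakly_null_tree K X N (\<lambda>U V. V \<subseteq> U) n x"
    unfolding weakly_null_tree_def weakly_null_net_def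
  proof (intro ballI impI tendstoI)
    fix l f and e :: real
    assume l: "l \<in> lists N" "length l < n" and f: "f \<in> carrier (dual K X)" and e: "e > 0"
    have "nb {f} e \<in> N"
      unfolding N_def using f e by (intro CollectI exI[of _ "{f}"] exI[of _ e]) simp
    moreover have "dist (f (x (l @ [U]))) 0 < e" if "U \<in> N" "U \<subseteq> nb {f} e" for U
      using x[of "l @ [U]"] l that by (auto simp: nb_def)
    ultimately show "\<forall>\<^sub>F U in tails N (\<lambda>U V. V \<subseteq> U). dist (f (x (l @ [U]))) 0 < e"
      unfolding eventually_tails[OF dirN] by blast
  qed
  have ball: "\<forall>t\<in>lists N. 1 \<le> length t \<and> length t \<le> n \<longrightarrow> x t \<in> unit_ball X"
  proof (intro ballI impI)
    fix t assume "t \<in> lists N" "1 \<le> length t \<and> length t \<le> n"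
    then show "x t \<in> unit_ball X" using x[of t] by (cases t) auto
  qed
  let ?I = "INF t\<in>{t \<in> lists N. length t = n}. ereal (nrm Y (T (\<Oplus>\<^bsub>X\<^esub>i\<in>{1..n}. x (take i t))))"
  have "?I \<le> ereal s"
    by (rule bound[unfolded tree_bound_def, rule_format, of N "\<lambda>U V. V \<subseteq> U" x])
      (intro conjI dirN null ball)
  \<comment> \<open>At full length no level remains, so the failure carried along the branch is that
    of \<open>?Q\<close> at the branch sum.\<close>
  moreover have "ereal s' \<le> ?I"
    using sum \<psi> by (intro INF_greatest) fastforce
  ultimately have "ereal s' \<le> ereal s" by (rule order_trans[rotated])
  with \<open>s < s'\<close> show False by simp
qed

lemma Sigma_op_leI:
  assumes "normed_space K X" "0 < s" "\<And>n. ev_sum K X n (\<lambda>z. nrm Y (T z) \<le> s) \<zero>\<^bsub>X\<^esub>"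
  shows "Sigma_op K X Y T \<le> ereal s"
  unfolding Sigma_op_def Sigma_n_def
  using assms by (intro SUP_least INF_lower CollectI conjI tree_bound_if_ev_sum) auto

text \<open>The strict inequality leaves room for a tree bound below \<open>s\<close>. The supremum
  starts at one level; for \<open>n = 0\<close> the claim rests on \<open>0 \<le> s\<close> and on
  \<open>T\<close> sending zero to a vector of norm zero.\<close>

lemma ev_sum_if_Sigma_op:
  fixes X :: "'a normed"
  assumes X: "normed_space K X" and "0 \<le> s" "Sigma_op K X Y T < ereal s" "nrm Y (T \<zero>\<^bsub>X\<^esub>) = 0"
  shows "ev_sum K X n (\<lambda>z. nrm Y (T z) \<le> s) \<zero>\<^bsub>X\<^esub>"
proof (cases "n = 0")
  case False
  then have "Sigma_n K X Y T n \<le> Sigma_op K X Y T"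
    unfolding Sigma_op_def by (intro SUP_upper) auto
  with assms(3) have "Sigma_n K X Y T n < ereal s" by simp
  then obtain r where "r < s" "tree_bound TYPE('a set) K X Y T n r"
    unfolding Sigma_n_def by (auto simp: INF_less_iff)
  then show ?thesis using ev_sum_if_tree_bound[OF X] by blast
qed (use assms in simp)

lemma Sigma_op_nonneg: "0 \<le> Sigma_op K X Y T"
proof -
  have "0 \<le> Sigma_n K X Y T 1"
    unfolding Sigma_n_def by (intro INF_greatest) simp
  also have "\<dots> \<le> Sigma_op K X Y T"
    unfolding Sigma_op_def by (intro SUP_upper) auto
  finally show ?thesis .
qed

section \<open>Hahn--Banach\<close>

text \<open>Only positive real multiples occur, over both scalar fields. The inequality for
  \<open>r\<close> combined with that for \<open>1/r\<close> yields equality, as in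
  \<open>sub_pos\<close>.\<close>

definition sublinear_on :: "'a normed \<Rightarrow> ('a \<Rightarrow> real) \<Rightarrow> bool" where
  "sublinear_on X q \<longleftrightarrow>
     (\<forall>x\<in>carrier X. \<forall>y\<in>carrier X. q (x \<oplus>\<^bsub>X\<^esub> y) \<le> q x + q y) \<and>
     (\<forall>r>0. \<forall>x\<in>carrier X. q (complex_of_real r \<odot>\<^bsub>X\<^esub> x) \<le> r * q x)"

context normed_space
begin

lemma sublinear_nrm: "sublinear_on X (nrm X)"
  unfolding sublinear_on_def using nrm_triangle nrm_smult by auto

context
  fixes q assumes q: "sublinear_on X q"
begin

lemma sub_add: "x \<in> carrier X \<Longrightarrow> y \<in> carrier X \<Longrightarrow> q (x \<oplus> y) \<le> q x + q y"
  using q unfolding sublinear_on_def by blast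

lemma sub_pos: "r > 0 \<Longrightarrow> x \<in> carrier X \<Longrightarrow> q (complex_of_real r \<odot> x) = r * q x"
proof -
  assume r: "r > 0" and x: "x \<in> carrier X"
  have "q (complex_of_real (1/r) \<odot> (complex_of_real r \<odot> x)) \<le> (1/r) * q (complex_of_real r \<odot> x)"
    using q r x unfolding sublinear_on_def by (meson K_simps(4) smult_cl divide_pos_pos zero_less_one)
  moreover have "complex_of_real (1/r) \<odot> (complex_of_real r \<odot> x) = (complex_of_real (1/r) * complex_of_real r) \<odot> x"
    using smult_assoc1[of "complex_of_real (1/r)" "complex_of_real r" x] x by (simp del: of_real_divide)
  moreover have "complex_of_real (1/r) * complex_of_real r = 1"
    using r by (simp flip: of_real_mult)
  ultimately have "r * q x \<le> q (complex_of_real r \<odot> x)"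
    using r x smult_one by (simp add: field_simps)
  moreover have "q (complex_of_real r \<odot> x) \<le> r * q x"
    using q r x unfolding sublinear_on_def by blast
  ultimately show ?thesis by simp
qed

lemma sub_zero: "q \<zero> = 0"
  using sub_pos[of 2 \<zero>] smult_r_null[of 2] K_simps(4)[of 2] by simp

lemma sub_nonneg: "r \<ge> 0 \<Longrightarrow> x \<in> carrier X \<Longrightarrow> q (complex_of_real r \<odot> x) = r * q x"
  using sub_pos[of r x] sub_zero smult_l_null[of x] by (cases "r = 0") auto

lemma sub_lower: "x \<in> carrier X \<Longrightarrow> - q (\<ominus> x) \<le> q x"
  using sub_add[of x "\<ominus> x"] sub_zero by (simp add: M.r_neg)

text \<open>This is the largest sublinear functional below \<open>q\<close> whose value at
  \<open>\<ominus> y\<close> is at most \<open>- q y\<close>: any such \<open>r\<close> satisfies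
  \<open>r x \<le> r (x + t y) + t r (- y)\<close>.\<close>

definition nudge :: "'a \<Rightarrow> 'a \<Rightarrow> real" where
  "nudge y x = (INF t\<in>{0..}. q (x \<oplus> complex_of_real t \<odot> y) - t * q y)"

text \<open>The infimum is over a set bounded below by \<open>- q (\<ominus> x)\<close>, since
  \<open>t q y = q (t y) \<le> q (\<ominus> x) + q (x + t y)\<close>.\<close>

lemma nudge_le:
  assumes "x \<in> carrier X" "y \<in> carrier X" "0 \<le> t"
  shows "nudge y x \<le> q (x \<oplus> complex_of_real t \<odot> y) - t * q y"
  unfolding nudge_def
proof (rule cINF_lower)
  have "- q (\<ominus> x) \<le> q (x \<oplus> complex_of_real t \<odot> y) - t * q y" if "t \<ge> 0" for t
  proof -
    have "complex_of_real t \<odot> y = \<ominus> x \<oplus> (x \<oplus> complex_of_real t \<odot> y)"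
      using assms by (simp add: M.r_neg1)
    then have "q (complex_of_real t \<odot> y) \<le> q (\<ominus> x) + q (x \<oplus> complex_of_real t \<odot> y)"
      using sub_add[of "\<ominus> x" "x \<oplus> complex_of_real t \<odot> y"] assms by simp
    then show ?thesis using sub_nonneg[OF that assms(2)] by simp
  qed
  then show "bdd_below ((\<lambda>t. q (x \<oplus> complex_of_real t \<odot> y) - t * q y) ` {0..})"
    by (intro bdd_belowI2[where m = "- q (\<ominus> x)"]) auto
qed (use assms in simp)

lemma nudge_ge:
  assumes "\<And>t. 0 \<le> t \<Longrightarrow> c \<le> q (x \<oplus> complex_of_real t \<odot> y) - t * q y"
  shows "c \<le> nudge y x"
  unfolding nudge_def by (rule cINF_greatest) (use assms in auto)

lemma nudge_le_self: "x \<in> carrier X \<Longrightarrow> y \<in> carrier X \<Longrightarrow> nudge y x \<le> q x"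
  using nudge_le[of x y 0] smult_l_null[of y] by simp

text \<open>Parameters \<open>s\<close> and \<open>t\<close> for two summands combine to the
  parameter \<open>s + t\<close> for their sum, so the two infima add up; scaling by
  \<open>r\<close> turns \<open>t\<close> into \<open>r * t\<close>.\<close>

lemma sublinear_nudge:
  assumes y: "y \<in> carrier X"
  shows "sublinear_on X (nudge y)"
  unfolding sublinear_on_def
proof (intro conjI ballI allI impI)
  fix x1 x2 assume x: "x1 \<in> carrier X" "x2 \<in> carrier X"
  have "nudge y (x1 \<oplus> x2) - (q (x2 \<oplus> complex_of_real t \<odot> y) - t * q y) \<le> nudge y x1" if t: "0 \<le> t" for t
  proof (rule nudge_ge)
    fix s :: real assume s: "0 \<le> s"
    have "complex_of_real (s + t) \<odot> y = complex_of_real s \<odot> y \<oplus> complex_of_real t \<odot> y"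
      using smult_l_distr[of "complex_of_real s" "complex_of_real t" y] y by simp
    then have "x1 \<oplus> x2 \<oplus> complex_of_real (s + t) \<odot> y =
        (x1 \<oplus> complex_of_real s \<odot> y) \<oplus> (x2 \<oplus> complex_of_real t \<odot> y)"
      using x y by (simp add: M.a_ac)
    then have "q (x1 \<oplus> x2 \<oplus> complex_of_real (s + t) \<odot> y) \<le>
        q (x1 \<oplus> complex_of_real s \<odot> y) + q (x2 \<oplus> complex_of_real t \<odot> y)"
      using sub_add x y by simp
    with nudge_le[of "x1 \<oplus> x2" y "s + t"] s t x y
    show "nudge y (x1 \<oplus> x2) - (q (x2 \<oplus> complex_of_real t \<odot> y) - t * q y)
        \<le> q (x1 \<oplus> complex_of_real s \<odot> y) - s * q y"
      by (simp add: algebra_simps)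
  qed
  then have "nudge y (x1 \<oplus> x2) - nudge y x1 \<le> nudge y x2"
    by (intro nudge_ge) (simp add: algebra_simps)
  then show "nudge y (x1 \<oplus> x2) \<le> nudge y x1 + nudge y x2" by simp
next
  fix r :: real and x assume r: "0 < r" and x: "x \<in> carrier X"
  have "nudge y (complex_of_real r \<odot> x) / r \<le> nudge y x"
  proof (rule nudge_ge)
    fix t :: real assume t: "0 \<le> t"
    have "complex_of_real (r * t) \<odot> y = complex_of_real r \<odot> (complex_of_real t \<odot> y)"
      using smult_assoc1[of "complex_of_real r" "complex_of_real t" y] y by simp
    then have "complex_of_real r \<odot> x \<oplus> complex_of_real (r * t) \<odot> y = complex_of_real r \<odot> (x \<oplus> complex_of_real t \<odot> y)"
      using smult_r_distr[of "complex_of_real r" x "complex_of_real t \<odot> y"] x y by simp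
    then have "q (complex_of_real r \<odot> x \<oplus> complex_of_real (r * t) \<odot> y) = r * q (x \<oplus> complex_of_real t \<odot> y)"
      using sub_pos[OF r] x y by simp
    with nudge_le[of "complex_of_real r \<odot> x" y "r * t"] r t x y
    show "nudge y (complex_of_real r \<odot> x) / r \<le> q (x \<oplus> complex_of_real t \<odot> y) - t * q y"
      by (simp add: field_simps)
  qed
  then show "nudge y (complex_of_real r \<odot> x) \<le> r * nudge y x"
    using r by (simp add: field_simps)
qed

end

text \<open>A minimal sublinear functional is linear, since it cannot be lowered by any nudge.\<close>

lemma additive_below_sublinear:
  assumes p: "sublinear_on X p"
  obtains q where "sublinear_on X q" "\<And>x. x \<in> carrier X \<Longrightarrow> q x \<le> p x"
    "\<And>x y. x \<in> carrier X \<Longrightarrow> y \<in> carrier X \<Longrightarrow> q (x \<oplus> y) = q x + q y"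
proof -
  define S where "S = {q \<in> extensional (carrier X). sublinear_on X q \<and> (\<forall>x\<in>carrier X. q x \<le> p x)}"
  define P where "P q q' \<longleftrightarrow> (\<forall>x\<in>carrier X. q' x \<le> q x)" for q q' :: "'a \<Rightarrow> real"
  have restr: "sublinear_on X (restrict q (carrier X))" if "sublinear_on X q" for q
    using that unfolding sublinear_on_def by auto
  have "partial_order_on S (relation_of P S)"
  proof (rule partial_order_on_relation_ofI)
    show "a = b" if "a \<in> S" "b \<in> S" "P a b" "P b a" for a b
      using that unfolding S_def P_def by (intro extensionalityI[of a "carrier X" b]) (auto intro: order_antisym)
  qed (auto simp: P_def intro: order_trans)
  then have "\<exists>m\<in>S. \<forall>a\<in>S. P m a \<longrightarrow> a = m"
  proof (rule predicate_Zorn)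
    fix C assume "C \<in> Chains (relation_of P S)"
    then have C: "C \<subseteq> S" "\<And>a b. a \<in> C \<Longrightarrow> b \<in> C \<Longrightarrow> P a b \<or> P b a"
      unfolding Chains_def relation_of_def by auto
    show "\<exists>u\<in>S. \<forall>a\<in>C. P a u"
    proof (cases "C = {}")
      case True
      have "restrict p (carrier X) \<in> S" using p restr unfolding S_def by auto
      then show ?thesis using True by blast
    next
      case False
      define u where "u = (\<lambda>x\<in>carrier X. INF q\<in>C. q x)"
      have sl: "sublinear_on X q" if "q \<in> C" for q using C that unfolding S_def by auto
      have u_le: "u x \<le> q x" if "q \<in> C" "x \<in> carrier X" for q x
      proof -
        have "bdd_below ((\<lambda>q. q x) ` C)"
        proof (rule bdd_belowI2)
          fix a assume "a \<in> C"
          then have "a (\<ominus> x) \<le> p (\<ominus> x)" using C that unfolding S_def by auto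
          with sub_lower[OF sl[OF \<open>a \<in> C\<close>] that(2)] show "- p (\<ominus> x) \<le> a x" by simp
        qed
        then show ?thesis using that by (auto simp: u_def intro: cINF_lower)
      qed
      have u_ge: "c \<le> u x" if "\<And>q. q \<in> C \<Longrightarrow> c \<le> q x" "x \<in> carrier X" for c x
        using that False by (simp add: u_def cINF_greatest)
      have "sublinear_on X u"
        unfolding sublinear_on_def
      proof (intro conjI ballI allI impI)
        fix x y assume x: "x \<in> carrier X" and y: "y \<in> carrier X"
        have *: "u (x \<oplus> y) \<le> q1 x + q2 y" if q12: "q1 \<in> C" "q2 \<in> C" for q1 q2
        proof -
          \<comment> \<open>In a chain the smaller of the two functionals serves both arguments, so
            the infima at \<open>x\<close> and \<open>y\<close> may be taken separately.\<close>
          have "\<exists>q\<in>C. q x \<le> q1 x \<and> q y \<le> q2 y"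
            using C(2)[OF q12] q12 x y unfolding P_def by blast
          then obtain q where q: "q \<in> C" "q x \<le> q1 x" "q y \<le> q2 y" by blast
          show ?thesis
            using u_le[OF q(1), of "x \<oplus> y"] sub_add[OF sl[OF q(1)] x y] q x y by simp
        qed
        have "u (x \<oplus> y) - q1 x \<le> u y" if "q1 \<in> C" for q1
          using *[OF that] y by (intro u_ge) (simp_all add: algebra_simps)
        then have "u (x \<oplus> y) - u y \<le> u x"
          using x by (intro u_ge) (simp_all add: algebra_simps)
        then show "u (x \<oplus> y) \<le> u x + u y" by simp
      next
        fix r :: real and x assume r: "0 < r" and x: "x \<in> carrier X"
        have "u (complex_of_real r \<odot> x) / r \<le> u x"
        proof (rule u_ge[OF _ x])
          fix q assume q: "q \<in> C"
          show "u (complex_of_real r \<odot> x) / r \<le> q x"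
            using u_le[OF q, of "complex_of_real r \<odot> x"] sub_pos[OF sl[OF q] r x] x r
            by (simp add: field_simps)
        qed
        then show "u (complex_of_real r \<odot> x) \<le> r * u x"
          using r by (simp add: field_simps)
      qed
      moreover have "u x \<le> p x" if "x \<in> carrier X" for x
      proof -
        obtain q where q: "q \<in> C" using False by blast
        then have "q x \<le> p x" using C that unfolding S_def by auto
        with u_le[OF q that] show ?thesis by simp
      qed
      ultimately have "u \<in> S" unfolding S_def u_def by auto
      then show ?thesis using u_le unfolding P_def by blast
    qed
  qed
  then obtain q where q: "q \<in> S" and min: "\<And>a. a \<in> S \<Longrightarrow> P q a \<Longrightarrow> a = q" by blast
  have sq: "sublinear_on X q" and qp: "\<And>x. x \<in> carrier X \<Longrightarrow> q x \<le> p x"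
    using q unfolding S_def by auto
  show ?thesis
  proof (rule that[OF sq qp])
    fix x y assume x: "x \<in> carrier X" and y: "y \<in> carrier X"
    have le: "nudge q y x \<le> q x" if "x \<in> carrier X" for x
      using nudge_le_self[OF sq that y] .
    have "restrict (nudge q y) (carrier X) \<in> S"
      using restr[OF sublinear_nudge[OF sq y]] le qp unfolding S_def by (auto intro: order_trans)
    then have "restrict (nudge q y) (carrier X) = q"
      using le by (intro min) (auto simp: P_def)
    then have "nudge q y x = q x" using x by (metis restrict_apply')
    \<comment> \<open>By minimality the nudge is \<open>q\<close> itself, and its defining infimum
      is tested at \<open>t = 1\<close>.\<close>
    then have "q x \<le> q (x \<oplus> y) - q y"
      using nudge_le[OF sq x y, of 1] y smult_one by simp
    with sub_add[OF sq x y] show "q (x \<oplus> y) = q x + q y" by simp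
  qed
qed

lemma nrm_dual: "nrm (dual K X) f = (SUP x\<in>unit_ball X. cmod (f x))"
  by (simp add: dual_def opnorm_def)

lemma dual_unit_ballI:
  assumes "\<And>x. x \<in> carrier X \<Longrightarrow> f x \<in> K"
    and "\<And>x y. x \<in> carrier X \<Longrightarrow> y \<in> carrier X \<Longrightarrow> f (x \<oplus> y) = f x + f y"
    and "\<And>a x. a \<in> K \<Longrightarrow> x \<in> carrier X \<Longrightarrow> f (a \<odot> x) = a * f x"
    and "\<And>x. x \<in> carrier X \<Longrightarrow> cmod (f x) \<le> nrm X x"
  shows "restrict f (carrier X) \<in> unit_ball (dual K X)"
proof -
  have "restrict f (carrier X) \<in> carrier (dual K X)"
    by (rule dualI[where C = 1]) (use assms in auto)
  moreover have "nrm (dual K X) (restrict f (carrier X)) \<le> 1"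
    unfolding nrm_dual
  proof (rule cSUP_least)
    show "cmod (restrict f (carrier X) x) \<le> 1" if "x \<in> unit_ball X" for x
      using that assms(4)[of x] by (simp add: unit_ball_def)
  qed (use zero_unit_ball in blast)
  ultimately show ?thesis by (simp add: unit_ball_def)
qed

text \<open>Both scalar fields are closed under conjugation, so \<open>cnj w / cmod w\<close> serves
  in either case.\<close>

lemma exists_rotation:
  assumes "w \<in> K"
  shows "\<exists>c\<in>K. cmod c = 1 \<and> c * w = complex_of_real (cmod w)"
proof (cases "w = 0")
  case False
  have "cnj w * w = complex_of_real (cmod w) * complex_of_real (cmod w)"
    by (metis complex_norm_square mult.commute of_real_power power2_eq_square)
  moreover have "cnj w * complex_of_real (1 / cmod w) \<in> K"
    using K_closed(2,5) K_simps(4) assms by blast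
  ultimately show ?thesis
    using False by (intro bexI[of _ "cnj w * complex_of_real (1 / cmod w)"])
      (auto simp: norm_mult norm_divide)
qed (auto intro: bexI[of _ 1])

text \<open>Instead of extending a functional from the line through \<open>y\<close>, the norm is
  nudged at \<open>y\<close> beforehand. Its value at \<open>\<ominus> y\<close> drops to at most
  \<open>- nrm X y\<close>, so every additive minorant is at least \<open>nrm X y\<close> at
  \<open>y\<close>.\<close>

theorem exists_norming_functional:
  assumes y: "y \<in> carrier X"
  shows "\<exists>g\<in>unit_ball (dual K X). nrm X y \<le> Re (g y)"
proof -
  obtain q where q: "sublinear_on X q" "\<And>x. x \<in> carrier X \<Longrightarrow> q x \<le> nudge (nrm X) y x"
    and add: "\<And>x y. x \<in> carrier X \<Longrightarrow> y \<in> carrier X \<Longrightarrow> q (x \<oplus> y) = q x + q y"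
    using additive_below_sublinear[OF sublinear_nudge[OF sublinear_nrm y]] by metis
  have le: "q x \<le> nrm X x" if "x \<in> carrier X" for x
    using q(2)[OF that] nudge_le_self[OF sublinear_nrm that y] by simp
  have neg: "q (\<ominus> x) = - q x" if "x \<in> carrier X" for x
    using add[of x "\<ominus> x"] sub_zero[OF q(1)] that by (simp add: M.r_neg)
  have real: "q (complex_of_real r \<odot> x) = r * q x" if x: "x \<in> carrier X" for r x
  proof (cases "r \<ge> 0")
    case True
    then show ?thesis using sub_nonneg[OF q(1)] x by simp
  next
    case False
    have "complex_of_real r \<odot> x = \<ominus> (complex_of_real (- r) \<odot> x)"
      using x smult_assoc1[of "-1" "complex_of_real (- r)" x] K_simps(4)[of "- r"] by (simp add: neg_eq_smult)
    then show ?thesis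
      using neg[of "complex_of_real (- r) \<odot> x"] sub_nonneg[OF q(1), of "- r" x] False x K_simps(4)[of "- r"]
      by simp
  qed
  have "q (\<ominus> y) \<le> nrm X (\<ominus> y \<oplus> complex_of_real 1 \<odot> y) - 1 * nrm X y"
    using q(2)[of "\<ominus> y"] nudge_le[OF sublinear_nrm, of "\<ominus> y" y 1] y by simp
  then have qy: "nrm X y \<le> q y"
    using neg y smult_one by (simp add: M.l_neg)
  show ?thesis
    using scalar_field
  proof
    assume K: "K = \<real>"
    have "restrict (\<lambda>x. complex_of_real (q x)) (carrier X) \<in> unit_ball (dual K X)"
    proof (rule dual_unit_ballI)
      show "complex_of_real (q (a \<odot> x)) = a * complex_of_real (q x)" if "a \<in> K" "x \<in> carrier X" for a x
        using that real by (auto simp: K Reals_def)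
      show "cmod (complex_of_real (q x)) \<le> nrm X x" if "x \<in> carrier X" for x
        using le[OF that] le[of "\<ominus> x"] neg that nrm_minus by auto
    qed (use add in auto)
    then show ?thesis by (rule bexI[rotated]) (use y qy in simp)
  next
    assume K: "K = UNIV"
    \<comment> \<open>The Bohnenblust-Sobczyk formula: a complex linear functional is determined by
      its real part.\<close>
    define g where "g x = Complex (q x) (- q (\<i> \<odot> x))" for x
    have ii: "q (\<i> \<odot> (\<i> \<odot> x)) = - q x" if "x \<in> carrier X" for x
      using smult_assoc1[of "\<i>" "\<i>" x] K that by (simp flip: neg neg_eq_smult)
    have gadd: "g (x \<oplus> z) = g x + g z" if "x \<in> carrier X" "z \<in> carrier X" for x z
      using that add smult_r_distr[of "\<i>" x z] K by (simp add: g_def complex_eq_iff)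
    have gr: "g (complex_of_real r \<odot> x) = complex_of_real r * g x" if "x \<in> carrier X" for r x
    proof -
      have "\<i> \<odot> (complex_of_real r \<odot> x) = complex_of_real r \<odot> (\<i> \<odot> x)"
        using smult_assoc1[of "\<i>" "complex_of_real r" x] smult_assoc1[of "complex_of_real r" "\<i>" x] K that
        by (simp add: mult.commute)
      then show ?thesis using real that K by (simp add: g_def complex_eq_iff)
    qed
    have gi: "g (\<i> \<odot> x) = \<i> * g x" if "x \<in> carrier X" for x
      using ii[OF that] by (simp add: g_def complex_eq_iff)
    have smult: "g (a \<odot> x) = a * g x" if x: "x \<in> carrier X" for a x
    proof -
      have "a \<odot> x = (complex_of_real (Re a) + complex_of_real (Im a) * \<i>) \<odot> x"
        by (metis complex_eq mult.commute)
      also have "\<dots> = complex_of_real (Re a) \<odot> x \<oplus> complex_of_real (Im a) \<odot> (\<i> \<odot> x)"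
        using K x smult_l_distr[of "complex_of_real (Re a)" "complex_of_real (Im a) * \<i>" x]
          smult_assoc1[of "complex_of_real (Im a)" "\<i>" x] by simp
      finally have "g (a \<odot> x) = complex_of_real (Re a) * g x + complex_of_real (Im a) * (\<i> * g x)"
        using K x by (simp add: gadd gr gi)
      also have "\<dots> = (complex_of_real (Re a) + \<i> * complex_of_real (Im a)) * g x"
        by (simp add: algebra_simps)
      finally show ?thesis by (metis complex_eq)
    qed
    have "restrict g (carrier X) \<in> unit_ball (dual K X)"
    proof (rule dual_unit_ballI)
      fix x assume x: "x \<in> carrier X"
      \<comment> \<open>After rotating \<open>x\<close> the value of \<open>g\<close> is real, so
        only its real part \<open>q\<close> matters, and \<open>q\<close> lies below the
        norm.\<close>
      obtain c where c: "cmod c = 1" "c * g x = complex_of_real (cmod (g x))"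
        using exists_rotation[of "g x"] K by auto
      have "cmod (g x) = Re (g (c \<odot> x))" using c smult x by simp
      also have "\<dots> \<le> nrm X (c \<odot> x)" using le[of "c \<odot> x"] K x by (simp add: g_def)
      finally show "cmod (g x) \<le> nrm X x" using c K x nrm_smult[of c x] by simp
    qed (use K gadd smult in auto)
    then show ?thesis by (rule bexI[rotated]) (use y qy in \<open>simp add: g_def\<close>)
  qed
qed

end

section \<open>The Szlenk derivation\<close>

text \<open>Otherwise each point of \<open>L\<close> has a neighbourhood in which \<open>R\<close>
  eventually fails on \<open>L\<close>; finitely many of these cover \<open>L\<close>, and their
  eventualities hold together.\<close>

lemma frequently_cluster:
  assumes "compactin W L" "\<exists>\<^sub>F x in F. \<exists>g\<in>L. R x g"
  shows "\<exists>f\<in>L. \<forall>V. openin W V \<and> f \<in> V \<longrightarrow> (\<exists>\<^sub>F x in F. \<exists>g\<in>L \<inter> V. R x g)"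
proof (rule ccontr)
  assume "\<not> ?thesis"
  then have "\<forall>f\<in>L. \<exists>V. openin W V \<and> f \<in> V \<and> (\<forall>\<^sub>F x in F. \<forall>g\<in>L \<inter> V. \<not> R x g)"
    by (simp add: frequently_def)
  then obtain V where V: "\<And>f. f \<in> L \<Longrightarrow> openin W (V f) \<and> f \<in> V f \<and> (\<forall>\<^sub>F x in F. \<forall>g\<in>L \<inter> V f. \<not> R x g)"
    by metis
  have "L \<subseteq> \<Union> (V ` L)" using V by blast
  then have "\<exists>\<F>. finite \<F> \<and> \<F> \<subseteq> V ` L \<and> L \<subseteq> \<Union> \<F>"
    using V by (intro assms(1)[unfolded compactin_def, THEN conjunct2, rule_format]) auto
  then obtain \<F> where "finite \<F>" "\<F> \<subseteq> V ` L" "L \<subseteq> \<Union> \<F>"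
    by blast
  then obtain J where J: "finite J" "J \<subseteq> L" "L \<subseteq> \<Union> (V ` J)"
    by (metis finite_subset_image)
  have "\<forall>\<^sub>F x in F. \<forall>f\<in>J. \<forall>g\<in>L \<inter> V f. \<not> R x g"
    using J V by (intro eventually_ball_finite) auto
  then have "\<forall>\<^sub>F x in F. \<not> (\<exists>g\<in>L. R x g)"
    by eventually_elim (use J(3) in blast)
  with assms(2) show False by (simp add: frequently_def)
qed

context normed_space
begin

section \<open>The dual norm, differences of functionals and diameters\<close>

lemma nrm_dual_bdd:
  assumes "f \<in> carrier (dual K X)"
  shows "bdd_above ((\<lambda>x. cmod (f x)) ` unit_ball X)"
proof -
  obtain C where C: "C > 0" "\<forall>x\<in>carrier X. cmod (f x) \<le> C * nrm X x"
    using dual_bound[OF assms] by blast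
  have "cmod (f x) \<le> C" if "x \<in> unit_ball X" for x
    using C(1) C(2)[rule_format, OF unit_ball_carrier[OF that]] unit_ball_nrm[OF that]
    by (smt (verit) mult_left_le)
  then show ?thesis by (intro bdd_aboveI2)
qed

lemma dual_unit_ball_le:
  assumes "f \<in> unit_ball (dual K X)" "x \<in> carrier X"
  shows "cmod (f x) \<le> nrm X x"
proof (cases "x = \<zero>")
  case True
  then show ?thesis using assms dual_zero[of f] by (simp add: unit_ball_def)
next
  case False
  have f: "f \<in> carrier (dual K X)" "nrm (dual K X) f \<le> 1"
    using assms(1) by (auto simp: unit_ball_def)
  define r where "r = nrm X x"
  have r: "r > 0"
    using False assms(2) nrm_nonneg nrm_eq_0_iff unfolding r_def by fastforce
  have u: "complex_of_real (1/r) \<odot> x \<in> unit_ball X"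
    using r assms(2) nrm_smult[of "complex_of_real (1/r)" x] K_simps(4)[of "1/r"]
    by (auto simp: unit_ball_def r_def norm_divide)
  have "cmod (f (complex_of_real (1/r) \<odot> x)) \<le> nrm (dual K X) f"
    unfolding nrm_dual by (rule cSUP_upper[OF u nrm_dual_bdd[OF f(1)]])
  with f(2) have "cmod (f (complex_of_real (1/r) \<odot> x)) \<le> 1" by simp
  moreover have "f (complex_of_real (1/r) \<odot> x) = complex_of_real (1/r) * f x"
    by (rule dual_smult[OF f(1)]) (use assms in \<open>simp_all only: K_simps\<close>)
  ultimately show ?thesis
    using r by (simp add: norm_mult norm_divide field_simps r_def)
qed

text \<open>\<open>ndiam\<close> subtracts by means of the inverse that the additive structure
  defines implicitly. In a group this inverse is unique, so differences can be evaluated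
  pointwise.\<close>

lemma abelian_group_dual: "abelian_group (dual K X)"
proof (rule abelian_groupI)
  fix f g assume f: "f \<in> carrier (dual K X)" and g: "g \<in> carrier (dual K X)"
  obtain C D where C: "\<forall>x\<in>carrier X. cmod (f x) \<le> C * nrm X x" and D: "\<forall>x\<in>carrier X. cmod (g x) \<le> D * nrm X x"
    using dual_bound[OF f] dual_bound[OF g] by blast
  have "(\<lambda>x\<in>carrier X. f x + g x) \<in> carrier (dual K X)"
  proof (rule dualI[where C = "C + D"])
    show "cmod (f x + g x) \<le> (C + D) * nrm X x" if "x \<in> carrier X" for x
      using C[rule_format, OF that] D[rule_format, OF that] norm_triangle_ineq[of "f x" "g x"]
      by (simp add: algebra_simps)
  qed (use f g in \<open>auto simp: dual_in_K dual_add dual_smult K_closed algebra_simps\<close>)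
  then show "f \<oplus>\<^bsub>dual K X\<^esub> g \<in> carrier (dual K X)"
    by (simp add: dual_def)
next
  have "(\<lambda>x\<in>carrier X. 0) \<in> carrier (dual K X)"
    by (rule dualI[where C = 0]) auto
  then show "\<zero>\<^bsub>dual K X\<^esub> \<in> carrier (dual K X)"
    by (simp add: dual_def)
next
  fix f assume f: "f \<in> carrier (dual K X)"
  then have ext: "f \<in> extensional (carrier X)" by (simp add: dual_carrier)
  show "\<zero>\<^bsub>dual K X\<^esub> \<oplus>\<^bsub>dual K X\<^esub> f = f"
    using ext by (auto simp: dual_def extensional_def fun_eq_iff)
  obtain C where C: "\<forall>x\<in>carrier X. cmod (f x) \<le> C * nrm X x"
    using dual_bound[OF f] by blast
  have "(\<lambda>x\<in>carrier X. - f x) \<in> carrier (dual K X)"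
    by (rule dualI[where C = C]) (use f C in \<open>auto simp: dual_in_K dual_add dual_smult K_closed\<close>)
  moreover have "(\<lambda>x\<in>carrier X. - f x) \<oplus>\<^bsub>dual K X\<^esub> f = \<zero>\<^bsub>dual K X\<^esub>"
    by (auto simp: dual_def)
  ultimately show "\<exists>g\<in>carrier (dual K X). g \<oplus>\<^bsub>dual K X\<^esub> f = \<zero>\<^bsub>dual K X\<^esub>"
    by blast
qed (auto simp: dual_def fun_eq_iff add.assoc add.commute)

lemma dual_difference:
  assumes f: "f \<in> carrier (dual K X)" and g: "g \<in> carrier (dual K X)"
  shows "f \<ominus>\<^bsub>dual K X\<^esub> g \<in> carrier (dual K X)"
    and "x \<in> carrier X \<Longrightarrow> (f \<ominus>\<^bsub>dual K X\<^esub> g) x = f x - g x"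
proof -
  interpret D: abelian_group "dual K X" by (rule abelian_group_dual)
  show cl: "f \<ominus>\<^bsub>dual K X\<^esub> g \<in> carrier (dual K X)" using f g by simp
  assume x: "x \<in> carrier X"
  have "f = (f \<ominus>\<^bsub>dual K X\<^esub> g) \<oplus>\<^bsub>dual K X\<^esub> g"
    using f g by (simp add: a_minus_def D.a_assoc D.l_neg)
  then have "f x = ((f \<ominus>\<^bsub>dual K X\<^esub> g) \<oplus>\<^bsub>dual K X\<^esub> g) x" by simp
  also have "\<dots> = (f \<ominus>\<^bsub>dual K X\<^esub> g) x + g x"
    using x by (simp add: dual_def)
  finally show "(f \<ominus>\<^bsub>dual K X\<^esub> g) x = f x - g x" by simp
qed

text \<open>A strict bound below nested suprema is witnessed, which trades the diameter for two
  functionals and a vector of the ball.\<close>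

lemma less_ndiam_dual:
  assumes "S \<subseteq> carrier (dual K X)"
  shows "ereal \<epsilon> < ndiam (dual K X) S \<longleftrightarrow> (\<exists>f\<in>S. \<exists>g\<in>S. \<exists>x\<in>unit_ball X. \<epsilon> < cmod (f x - g x))"
proof -
  have ne: "unit_ball X \<noteq> {}" using zero_unit_ball by blast
  have "\<epsilon> < nrm (dual K X) (f \<ominus>\<^bsub>dual K X\<^esub> g) \<longleftrightarrow> (\<exists>x\<in>unit_ball X. \<epsilon> < cmod (f x - g x))"
    if "f \<in> S" "g \<in> S" for f g
  proof -
    have fg: "f \<in> carrier (dual K X)" "g \<in> carrier (dual K X)" using that assms by auto
    show ?thesis
      unfolding nrm_dual using dual_difference[OF fg] ne unit_ball_carrier
      by (subst less_cSUP_iff[OF _ nrm_dual_bdd]) (auto cong: bex_cong)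
  qed
  then show ?thesis by (simp add: ndiam_def less_SUP_iff cong: bex_cong)
qed

section \<open>The weak* topology and derived sets\<close>

lemma topspace_weak_star [simp]: "topspace (weak_star K X) = carrier (dual K X)"
  by (auto simp: weak_star_def dual_carrier PiE_def)

lemma openin_weak_star:
  assumes "x \<in> carrier X" "open U"
  shows "openin (weak_star K X) {f \<in> carrier (dual K X). f x \<in> U}"
proof -
  have "continuous_map (weak_star K X) euclidean (\<lambda>f. f x)"
    unfolding weak_star_def
    by (intro continuous_map_from_subtopology continuous_map_product_projection assms)
  from openin_continuous_map_preimage[OF this, of U] show ?thesis
    using assms(2) by simp
qed

lemma openin_weak_star_near:
  "x \<in> carrier X \<Longrightarrow> openin (weak_star K X) {g \<in> carrier (dual K X). cmod (g x - c) < \<delta>}"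
  using openin_weak_star[of x "ball c \<delta>"] by (simp add: dist_norm norm_minus_commute)

lemma szlenk_deriv_subset: "szlenk_deriv K X \<epsilon> L \<subseteq> L"
  by (auto simp: szlenk_deriv_def)

lemma foldr_szlenk_deriv_subset: "foldr (szlenk_deriv K X) \<epsilon>s L \<subseteq> L"
  using szlenk_deriv_subset by (induction \<epsilon>s) fastforce+

lemma szlenk_derivD:
  assumes "f \<in> szlenk_deriv K X \<epsilon> L" "\<epsilon> > 0" "L \<subseteq> carrier (dual K X)"
    and "openin (weak_star K X) V" "f \<in> V"
  obtains g h x where "g \<in> V \<inter> L" "h \<in> V \<inter> L" "x \<in> unit_ball X" "\<epsilon> < cmod (g x - h x)"
proof -
  have "ereal \<epsilon> < ndiam (dual K X) (V \<inter> L)"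
    using assms by (auto simp: szlenk_deriv_def)
  moreover have "V \<inter> L \<subseteq> carrier (dual K X)" using assms(3) by auto
  ultimately show ?thesis using that by (auto simp: less_ndiam_dual)
qed

lemma szlenk_derivI:
  assumes "f \<in> L" "L \<subseteq> carrier (dual K X)"
    and "\<And>V. openin (weak_star K X) V \<Longrightarrow> f \<in> V \<Longrightarrow> \<epsilon> > 0 \<Longrightarrow>
      \<exists>g\<in>V \<inter> L. \<exists>x\<in>unit_ball X. \<epsilon> < cmod (g x - f x)"
  shows "f \<in> szlenk_deriv K X \<epsilon> L"
proof -
  have "ereal \<epsilon> < ndiam (dual K X) (V \<inter> L)" if "openin (weak_star K X) V" "f \<in> V" "\<epsilon> > 0" for V
    using assms(1,2) assms(3)[OF that] that(2) by (subst less_ndiam_dual) auto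
  then show ?thesis using assms(1) by (auto simp: szlenk_deriv_def)
qed

text \<open>The derivation removes from \<open>L\<close> the union of all weak* open sets whose
  trace on \<open>L\<close> has diameter at most \<open>\<epsilon>\<close>, so what is left is
  relatively closed.\<close>

lemma compactin_szlenk_deriv:
  assumes "compactin (weak_star K X) L"
  shows "compactin (weak_star K X) (szlenk_deriv K X \<epsilon> L)"
proof (cases "\<epsilon> \<le> 0")
  case False
  define O' where "O' = \<Union>{V. openin (weak_star K X) V \<and> \<not> ereal \<epsilon> < ndiam (dual K X) (V \<inter> L)}"
  have "openin (weak_star K X) O'" unfolding O'_def by (intro openin_Union) auto
  then have "compactin (weak_star K X) (L \<inter> (topspace (weak_star K X) - O'))"
    using assms by (intro compact_Int_closedin closedin_diff closedin_topspace)
  moreover have "szlenk_deriv K X \<epsilon> L = L \<inter> (topspace (weak_star K X) - O')"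
    using False compactin_subset_topspace[OF assms] by (auto simp: szlenk_deriv_def O'_def)
  ultimately show ?thesis by simp
qed (use assms in \<open>simp add: szlenk_deriv_def\<close>)

lemma compactin_foldr_szlenk_deriv:
  "compactin (weak_star K X) L \<Longrightarrow> compactin (weak_star K X) (foldr (szlenk_deriv K X) \<epsilon>s L)"
  by (induction \<epsilon>s) (simp_all add: compactin_szlenk_deriv)

text \<open>Finitely many functionals map the ball to a bounded, hence totally bounded, set of
  scalar tuples. One vector is kept for each occupied cell of a finite cover.\<close>

lemma functionals_totally_bounded:
  assumes "finite F" "F \<subseteq> carrier (dual K X)" "e > 0"
  obtains V where "finite V" "V \<subseteq> unit_ball X" "\<forall>x\<in>unit_ball X. \<exists>v\<in>V. \<forall>f\<in>F. cmod (f x - f v) < e"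
proof -
  have "\<exists>C. finite C \<and> f ` unit_ball X \<subseteq> (\<Union>c\<in>C. ball c (e/2))" if "f \<in> F" for f
  proof -
    have "bounded (f ` unit_ball X)"
      using nrm_dual_bdd[of f] assms(2) that unfolding bounded_iff bdd_above_def by auto
    then have "compact (closure (f ` unit_ball X))" by simp
    then have "\<forall>\<epsilon>>0. \<exists>C. finite C \<and> closure (f ` unit_ball X) \<subseteq> (\<Union>c\<in>C. ball c \<epsilon>)"
      unfolding compact_eq_totally_bounded by (rule conjunct2)
    note this[rule_format, OF half_gt_zero[OF assms(3)]]
    then obtain C where C: "finite C" "closure (f ` unit_ball X) \<subseteq> (\<Union>c\<in>C. ball c (e/2))"
      by (elim exE conjE)
    show ?thesis by (intro exI[of _ C] conjI C(1) order_trans[OF closure_subset C(2)])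
  qed
  then obtain C where C: "\<And>f. f \<in> F \<Longrightarrow> finite (C f)"
    "\<And>f. f \<in> F \<Longrightarrow> f ` unit_ball X \<subseteq> (\<Union>c\<in>C f. ball c (e/2))" by metis
  \<comment> \<open>\<open>q x\<close> records for each functional a disc containing its value at
    \<open>x\<close>. Two vectors with the same record differ by less than \<open>e\<close> under
    every functional of \<open>F\<close>.\<close>
  define q where "q x = (\<lambda>f\<in>F. SOME c. c \<in> C f \<and> f x \<in> ball c (e/2))" for x
  have q: "q x f \<in> C f \<and> f x \<in> ball (q x f) (e/2)" if "f \<in> F" "x \<in> unit_ball X" for x f
  proof -
    have "\<exists>c. c \<in> C f \<and> f x \<in> ball c (e/2)" using C(2)[OF that(1)] that(2) by blast
    from someI_ex[OF this] show ?thesis using that(1) unfolding q_def by simp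
  qed
  have "q ` unit_ball X \<subseteq> PiE F C" using q by (auto simp: q_def)
  then have fin: "finite (q ` unit_ball X)"
    using C(1) assms(1) by (meson finite_PiE finite_subset)
  let ?V = "inv_into (unit_ball X) q ` q ` unit_ball X"
  show ?thesis
  proof (rule that[of ?V])
    show "finite ?V" using fin by simp
    show "?V \<subseteq> unit_ball X" by (auto intro: inv_into_into)
    show "\<forall>x\<in>unit_ball X. \<exists>v\<in>?V. \<forall>f\<in>F. cmod (f x - f v) < e"
    proof
      fix x assume x: "x \<in> unit_ball X"
      let ?v = "inv_into (unit_ball X) q (q x)"
      have v: "?v \<in> unit_ball X" "q ?v = q x" using x by (auto intro: inv_into_into f_inv_into_f)
      have "cmod (f x - f ?v) < e" if "f \<in> F" for f
        using q[OF that x] q[OF that v(1)] v(2) dist_triangle_half_r[of "q x f" "f x" e "f ?v"]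
        by (simp add: dist_norm)
      then show "\<exists>v\<in>?V. \<forall>f\<in>F. cmod (f x - f v) < e" using x by blast
    qed
  qed
qed

text \<open>A point where two functionals of the weak* neighbourhood differ is made weakly small by
  subtracting a member of a finite net of the ball on which both functionals are still close.\<close>

lemma frequently_szlenk_deriv:
  assumes f: "f \<in> szlenk_deriv K X \<epsilon> L" and L: "L \<subseteq> carrier (dual K X)"
    and z: "z \<in> carrier X" and \<delta>: "\<delta> > 0"
  shows "\<exists>\<^sub>F x in wk K X. \<exists>g\<in>L. Re (f z) + \<epsilon> / 4 - \<delta> \<le> Re (g (z \<oplus> x))"
  unfolding frequently_wk
proof (intro allI impI, elim conjE)
  fix F and e :: real assume F: "finite F" "F \<subseteq> carrier (dual K X)" and e: "e > 0"
  have fL: "f \<in> L" using f szlenk_deriv_subset by auto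
  then have fd: "f \<in> carrier (dual K X)" using L by auto
  show "\<exists>x\<in>unit_ball X. (\<forall>f\<in>F. cmod (f x) < e) \<and> (\<exists>g\<in>L. Re (f z) + \<epsilon> / 4 - \<delta> \<le> Re (g (z \<oplus> x)))"
  proof (cases "\<epsilon> > 0")
    case False
    then show ?thesis using fL F(2) e z \<delta>
      by (intro bexI[of _ \<zero>]) (auto simp: dual_zero subset_eq intro!: bexI[of _ f])
  next
    case True
    \<comment> \<open>Three errors of at most \<open>\<eta>\<close> are collected below, from
      \<open>k v\<close>, \<open>f x\<close> and \<open>k z\<close>.\<close>
    define \<eta> where "\<eta> = min e (\<delta>/4)"
    have \<eta>: "\<eta> > 0" "\<eta> \<le> e" "\<eta> \<le> \<delta>/4" using e \<delta> by (auto simp: \<eta>_def)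
    obtain V where V: "finite V" "V \<subseteq> unit_ball X"
      "\<forall>x\<in>unit_ball X. \<exists>v\<in>V. \<forall>f\<in>insert f F. cmod (f x - f v) < \<eta>"
      using functionals_totally_bounded[of "insert f F" \<eta>] F fd \<eta> by auto
    have Vc: "V \<subseteq> carrier X" using V(2) unit_ball_carrier by auto
    \<comment> \<open>The net \<open>V\<close> is fixed before the neighbourhood, so one weak* open
      set controls all its vectors together with \<open>z\<close>.\<close>
    define W where "W = (\<Inter>v\<in>insert z V. {g \<in> carrier (dual K X). cmod (g v - f v) < \<eta>})"
    have "openin (weak_star K X) W"
      unfolding W_def using openin_weak_star_near V(1) Vc z by (intro openin_INT2) auto
    moreover have "f \<in> W" using fd \<eta> by (auto simp: W_def)
    ultimately obtain g h y where gh: "g \<in> W \<inter> L" "h \<in> W \<inter> L" "y \<in> unit_ball X" "\<epsilon> < cmod (g y - h y)"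
      using szlenk_derivD[OF f True L] by blast
    have "cmod (g y - h y) \<le> cmod (g y - f y) + cmod (h y - f y)"
      using norm_triangle_ineq4[of "g y - f y" "h y - f y"] by simp
    \<comment> \<open>Of two functionals more than \<open>\<epsilon>\<close> apart at
      \<open>y\<close>, one is more than \<open>\<epsilon> / 2\<close> away from \<open>f\<close>.
      With the halving in \<open>x0\<close> this gives \<open>\<epsilon> / 4\<close>.\<close>
    then have "\<exists>k\<in>W \<inter> L. \<epsilon> / 2 < cmod (k y - f y)"
      using gh(1,2,4) by (cases "\<epsilon> / 2 < cmod (g y - f y)") (force, rule bexI[of _ h], auto)
    then obtain k where k: "k \<in> W" "k \<in> L" "\<epsilon> / 2 < cmod (k y - f y)" by blast
    then have kd: "k \<in> carrier (dual K X)" using L by auto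
    obtain v where v: "v \<in> V" "\<forall>f\<in>insert f F. cmod (f y - f v) < \<eta>"
      using V(3) gh(3) by blast
    have vB: "v \<in> unit_ball X" using v V by auto
    have yv: "y \<in> carrier X" "v \<in> carrier X" using gh(3) vB unit_ball_carrier by auto
    define x0 where "x0 = (1/2) \<odot> (y \<ominus> v)"
    have x0: "x0 \<in> unit_ball X" unfolding x0_def by (rule half_difference_unit_ball[OF gh(3) vB])
    have x0c: "x0 \<in> carrier X" using x0 unit_ball_carrier by auto
    have half: "1/2 \<in> K" using K_simps(4)[of "1/2"] by simp
    have val: "\<phi> x0 = (\<phi> y - \<phi> v) / 2" if "\<phi> \<in> carrier (dual K X)" for \<phi>
      using dual_smult[OF that half, of "y \<ominus> v"] dual_minus[OF that, of y v] yv by (simp add: x0_def)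
    have "k x0 - f x0 \<in> K" using dual_in_K[OF kd x0c] dual_in_K[OF fd x0c] K_closed by blast
    \<comment> \<open>A unimodular factor makes the gain of \<open>k\<close> over \<open>f\<close> a
      gain of real parts, and it changes neither the norm of \<open>x0\<close> nor the modulus of
      any functional there.\<close>
    from exists_rotation[OF this] obtain c where c: "c \<in> K" "cmod c = 1"
      "c * (k x0 - f x0) = complex_of_real (cmod (k x0 - f x0))" by blast
    define x where "x = c \<odot> x0"
    have xB: "x \<in> unit_ball X" using x0 x0c c nrm_smult[of c x0] by (auto simp: x_def unit_ball_def)
    have valx: "\<phi> x = c * ((\<phi> y - \<phi> v) / 2)" if "\<phi> \<in> carrier (dual K X)" for \<phi>
      using dual_smult[OF that c(1) x0c] val[OF that] by (simp add: x_def)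
    have small: "cmod (\<phi> x) < \<eta>" if "\<phi> \<in> insert f F" for \<phi>
    proof -
      have "\<phi> \<in> carrier (dual K X)" using that F fd by auto
      then have "cmod (\<phi> x) = cmod (\<phi> y - \<phi> v) / 2" 
        by (subst valx) (simp_all add: c(2) norm_mult norm_divide)
      moreover have "cmod (\<phi> y - \<phi> v) < \<eta>" using v(2) that by blast
      ultimately show ?thesis using \<eta>(1) by simp
    qed
    have kv: "cmod (k v - f v) < \<eta>" and kz: "cmod (k z - f z) < \<eta>"
      using k(1) v(1) by (auto simp: W_def)
    have "k x0 - f x0 = ((k y - f y) - (k v - f v)) / 2"
      using val[OF kd] val[OF fd] by (simp add: field_simps)
    then have "cmod (k x0 - f x0) = cmod ((k y - f y) - (k v - f v)) / 2"
      by (simp only: norm_divide) simp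
    then have "cmod (k x0 - f x0) \<ge> (cmod (k y - f y) - cmod (k v - f v)) / 2"
      using norm_triangle_ineq2[of "k y - f y" "k v - f v"] by simp
    then have big: "cmod (k x0 - f x0) > \<epsilon> / 4 - \<eta>"
      using k(3) kv \<eta> by (simp add: field_simps)
    have "k x - f x = c * (k x0 - f x0)"
      using dual_smult[OF kd c(1) x0c] dual_smult[OF fd c(1) x0c] by (simp add: x_def right_diff_distrib)
    then have "Re (k x) - Re (f x) = cmod (k x0 - f x0)"
      using c(3) by (metis Re_complex_of_real minus_complex.simps(1))
    moreover have "\<bar>Re (f x)\<bar> < \<eta>" using small[of f] abs_Re_le_cmod[of "f x"] by simp
    moreover have "\<bar>Re (k z) - Re (f z)\<bar> < \<eta>" using kz abs_Re_le_cmod[of "k z - f z"] by simp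
    moreover have "Re (k (z \<oplus> x)) = Re (k z) + Re (k x)"
      using dual_add[OF kd z] xB unit_ball_carrier by simp
    ultimately have "Re (f z) + \<epsilon> / 4 - \<delta> \<le> Re (k (z \<oplus> x))"
      using big \<eta> by linarith
    moreover have "\<forall>\<phi>\<in>F. cmod (\<phi> x) < e" using small \<eta>(2) by fastforce
    ultimately show ?thesis using xB k(2) by blast
  qed
qed

text \<open>The head of the list is the outermost derivation and is spent at the first level:
  \<open>f\<close> is exchanged for a functional of the next inner derived set whose real part at
  the enlarged sum is larger by at least \<open>\<epsilon> / 4 - \<delta>\<close>. Once the list is
  exhausted, the functional lies in \<open>L\<close> and the bound \<open>s\<close> applies.\<close>

lemma szlenk_le_ev_sum:
  fixes \<delta> :: real
  assumes ev: "ev_sum K X (length \<epsilon>s) (\<lambda>z. \<forall>g\<in>L. Re (g z) \<le> s) z"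
    and f: "f \<in> foldr (szlenk_deriv K X) \<epsilon>s L" and L: "L \<subseteq> carrier (dual K X)"
    and z: "z \<in> carrier X" and \<delta>: "\<delta> > 0"
  shows "Re (f z) + sum_list \<epsilon>s / 4 - length \<epsilon>s * \<delta> \<le> s"
  using ev f z
proof (induction \<epsilon>s arbitrary: f z)
  case (Cons \<epsilon> \<epsilon>s)
  let ?L = "foldr (szlenk_deriv K X) \<epsilon>s L"
  have "?L \<subseteq> carrier (dual K X)" using foldr_szlenk_deriv_subset L by blast
  then have "\<exists>\<^sub>F x in wk K X. \<exists>g\<in>?L. Re (f z) + \<epsilon> / 4 - \<delta> \<le> Re (g (z \<oplus> x))"
    using Cons.prems \<delta> by (intro frequently_szlenk_deriv) auto
  moreover have "\<forall>\<^sub>F x in wk K X. ev_sum K X (length \<epsilon>s) (\<lambda>z. \<forall>g\<in>L. Re (g z) \<le> s) (z \<oplus> x) \<and> x \<in> unit_ball X"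
    using Cons.prems by (auto intro!: eventually_conj eventually_wk_unit_ball)
  ultimately have "\<exists>\<^sub>F x in wk K X. (\<exists>g\<in>?L. Re (f z) + \<epsilon> / 4 - \<delta> \<le> Re (g (z \<oplus> x))) \<and>
      ev_sum K X (length \<epsilon>s) (\<lambda>z. \<forall>g\<in>L. Re (g z) \<le> s) (z \<oplus> x) \<and> x \<in> unit_ball X"
    by (rule frequently_eventually_frequently)
  then obtain x g where "x \<in> unit_ball X" "g \<in> ?L" "Re (f z) + \<epsilon> / 4 - \<delta> \<le> Re (g (z \<oplus> x))"
    "ev_sum K X (length \<epsilon>s) (\<lambda>z. \<forall>g\<in>L. Re (g z) \<le> s) (z \<oplus> x)"
    by (auto dest: frequently_ex)
  moreover from this have "Re (g (z \<oplus> x)) + sum_list \<epsilon>s / 4 - length \<epsilon>s * \<delta> \<le> s"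
    using Cons.IH[of "z \<oplus> x" g] Cons.prems(3) unit_ball_carrier by blast
  ultimately show ?case
    by (simp add: add_divide_distrib distrib_right)
qed simp

text \<open>If the bound fails frequently, the offending functionals cluster at some
  \<open>f \<in> L\<close>. Close to \<open>f\<close> they nearly agree with it at \<open>z\<close>,
  so their excess comes from \<open>x\<close>, where \<open>f\<close> itself is small. This places
  \<open>f\<close> in a derived set of too high an order for the hypothesis.\<close>

lemma eventually_szlenk_deriv:
  assumes L: "compactin (weak_star K X) L"
    and C: "\<And>f x. f \<in> L \<Longrightarrow> x \<in> unit_ball X \<Longrightarrow> cmod (f x) \<le> C"
    and z: "z \<in> carrier X" and \<delta>: "\<delta> > 0" and N: "2 * C \<le> N * (\<delta> / 4)"
    and hyp: "\<And>k f. k \<le> N \<Longrightarrow> f \<in> szlenk_deriv K X (real k * (\<delta> / 4)) L \<Longrightarrow> Re (f z) \<le> a - real k * (\<delta> / 4)"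
  shows "\<forall>\<^sub>F x in wk K X. \<forall>f\<in>L. Re (f (z \<oplus> x)) \<le> a + \<delta>"
proof (rule ccontr)
  assume "\<not> ?thesis"
  then have "\<exists>\<^sub>F x in wk K X. \<exists>g\<in>L. a + \<delta> < Re (g (z \<oplus> x))"
    by (simp add: not_eventually not_le)
  from frequently_cluster[OF L this] obtain f where f: "f \<in> L"
    and cl: "\<And>V. openin (weak_star K X) V \<Longrightarrow> f \<in> V \<Longrightarrow> \<exists>\<^sub>F x in wk K X. \<exists>g\<in>L \<inter> V. a + \<delta> < Re (g (z \<oplus> x))"
    by blast
  have Ld: "L \<subseteq> carrier (dual K X)" using compactin_subset_topspace[OF L] by simp
  then have fd: "f \<in> carrier (dual K X)" using f by auto
  \<comment> \<open>The half of \<open>\<delta>\<close> given up here pays for the errors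
    \<open>\<delta> / 4\<close> at \<open>z\<close> and \<open>\<delta> / 8\<close> at
    \<open>x\<close>; the half that is kept exceeds the grid step
    \<open>\<delta> / 4\<close>.\<close>
  define \<epsilon> where "\<epsilon> = a + \<delta> / 2 - Re (f z)"
  have near: "\<exists>g\<in>V \<inter> L. \<exists>x\<in>unit_ball X. \<epsilon> < cmod (g x - f x)"
    if "openin (weak_star K X) V" "f \<in> V" for V
  proof -
    let ?V = "V \<inter> {g \<in> carrier (dual K X). cmod (g z - f z) < \<delta> / 4}"
    have "\<exists>\<^sub>F x in wk K X. \<exists>g\<in>L \<inter> ?V. a + \<delta> < Re (g (z \<oplus> x))"
    proof (rule cl)
      show "openin (weak_star K X) ?V"
        by (intro openin_Int that openin_weak_star_near z)
      show "f \<in> ?V" using that fd \<delta> by simp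
    qed
    moreover have "\<forall>\<^sub>F x in wk K X. x \<in> unit_ball X \<and> cmod (f x) < \<delta> / 8"
      using \<delta> by (intro eventually_conj eventually_wk_unit_ball eventually_wk_small[OF fd]) simp
    ultimately have "\<exists>\<^sub>F x in wk K X. (\<exists>g\<in>L \<inter> ?V. a + \<delta> < Re (g (z \<oplus> x))) \<and> x \<in> unit_ball X \<and> cmod (f x) < \<delta> / 8"
      by (rule frequently_eventually_frequently)
    then obtain x g where x: "x \<in> unit_ball X" "cmod (f x) < \<delta> / 8"
      and g: "g \<in> L" "g \<in> V" "cmod (g z - f z) < \<delta> / 4" "a + \<delta> < Re (g (z \<oplus> x))"
      by (auto dest: frequently_ex)
    have "Re (g (z \<oplus> x)) = Re (g z) + Re (g x)"
      using dual_add[of g z x] g(1) Ld z x unit_ball_carrier by auto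
    moreover have "\<bar>Re (f x)\<bar> < \<delta> / 8" using x abs_Re_le_cmod[of "f x"] by simp
    moreover have "\<bar>Re (g z) - Re (f z)\<bar> < \<delta> / 4" using g(3) abs_Re_le_cmod[of "g z - f z"] by simp
    moreover have "Re (g x) - Re (f x) \<le> cmod (g x - f x)"
      using complex_Re_le_cmod[of "g x - f x"] by simp
    ultimately have "\<epsilon> < cmod (g x - f x)"
      using g(4) \<delta> unfolding \<epsilon>_def by linarith
    then show ?thesis using g x by blast
  qed
  show False
  proof (cases "\<epsilon> \<le> 0")
    case True
    \<comment> \<open>At order zero the derivation is the identity, so the hypothesis covers every
      functional of \<open>L\<close>.\<close>
    then show False using hyp[of 0 f] f \<delta> by (simp add: szlenk_deriv_def \<epsilon>_def)
  next
    case False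
    \<comment> \<open>Rounding down to the grid loses less than \<open>\<delta> / 4\<close>.
      Functionals of \<open>L\<close> differ by at most \<open>2 * C\<close> on the ball, so the
      grid reaches far enough.\<close>
    define k where "k = nat \<lfloor>\<epsilon> / (\<delta> / 4)\<rfloor>"
    have "real k \<le> \<epsilon> / (\<delta> / 4)" "\<epsilon> / (\<delta> / 4) < real k + 1"
      using False \<delta> by (auto simp: k_def)
    then have k: "real k * (\<delta> / 4) \<le> \<epsilon>" "\<epsilon> < real k * (\<delta> / 4) + \<delta> / 4"
      using \<delta> by (simp_all add: field_simps)
    obtain g x where "g \<in> L" "x \<in> unit_ball X" "\<epsilon> < cmod (g x - f x)"
      using near[of "carrier (dual K X)"] openin_topspace[of "weak_star K X"] fd by auto
    then have "\<epsilon> < 2 * C"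
      using C[of g x] C[OF f, of x] norm_triangle_ineq4[of "g x" "f x"] by auto
    with k N have "real k * (\<delta> / 4) \<le> real N * (\<delta> / 4)" by linarith
    then have "k \<le> N" using \<delta> by simp
    moreover have "f \<in> szlenk_deriv K X (real k * (\<delta> / 4)) L"
      by (rule szlenk_derivI[OF f Ld]) (use near k in \<open>meson order_le_less_trans\<close>)
    ultimately have "Re (f z) \<le> a - real k * (\<delta> / 4)" by (rule hyp)
    with k(2) show False unfolding \<epsilon>_def using \<delta> by linarith
  qed
qed

text \<open>Each level is traded for one derivation. After \<open>k\<close> levels the claim
  concerns all lists of \<open>n - k\<close> orders from the grid: at \<open>k = 0\<close> it is
  summability, as functionals vanish at zero, and at \<open>k = n\<close> the list is empty and the
  derived set is \<open>L\<close>.\<close>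

lemma ev_sum_if_szlenk:
  fixes \<delta> :: real
  assumes L: "compactin (weak_star K X) L"
    and C: "\<And>f x. f \<in> L \<Longrightarrow> x \<in> unit_ball X \<Longrightarrow> cmod (f x) \<le> C"
    and M: "summable_szlenk_with K X M L" and n: "n > 0" and \<delta>: "\<delta> > 0"
  shows "ev_sum K X n (\<lambda>z. \<forall>f\<in>L. Re (f z) \<le> M + n * \<delta>) \<zero>"
proof -
  obtain N :: nat where N: "2 * C \<le> N * (\<delta> / 4)"
    using \<delta> real_arch_simple[of "2 * C / (\<delta> / 4)"] by (auto simp: field_simps)
  \<comment> \<open>A finite grid gives finitely many lists of a given length, so their
    eventualities can be intersected at every level.\<close>
  define G where "G = (\<lambda>k. real k * (\<delta> / 4)) ` {..N}"
  have Ld: "L \<subseteq> carrier (dual K X)" using compactin_subset_topspace[OF L] by simp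
  let ?D = "\<lambda>\<epsilon>s. foldr (szlenk_deriv K X) \<epsilon>s L"
  have sub: "f \<in> L" if "f \<in> ?D \<epsilon>s" for f \<epsilon>s using that foldr_szlenk_deriv_subset by blast
  have "ev_sum K X k (\<lambda>z. \<forall>\<epsilon>s\<in>{\<epsilon>s. set \<epsilon>s \<subseteq> G \<and> length \<epsilon>s = n - k}. \<forall>f\<in>?D \<epsilon>s.
      Re (f z) \<le> M - sum_list \<epsilon>s + k * \<delta>) \<zero>" if "k \<le> n" for k
    using that
  proof (induction k)
    case 0
    have "Re (f \<zero>) \<le> M - sum_list \<epsilon>s" if "length \<epsilon>s = n" "f \<in> ?D \<epsilon>s" for \<epsilon>s f
    proof -
      have "f \<zero> = 0" using sub[OF that(2)] Ld dual_zero by auto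
      \<comment> \<open>Summability speaks of non-empty lists only; this is where
        \<open>n > 0\<close> enters.\<close>
      moreover have "sum_list \<epsilon>s \<le> M"
        using M that n unfolding summable_szlenk_with_def by (metis empty_iff length_greater_0_conv)
      ultimately show ?thesis by simp
    qed
    then show ?case by auto
  next
    case (Suc k)
    let ?P = "\<lambda>z. \<forall>\<epsilon>s\<in>{\<epsilon>s. set \<epsilon>s \<subseteq> G \<and> length \<epsilon>s = n - k}. \<forall>f\<in>?D \<epsilon>s.
      Re (f z) \<le> M - sum_list \<epsilon>s + k * \<delta>"
    let ?E = "{\<epsilon>s. set \<epsilon>s \<subseteq> G \<and> length \<epsilon>s = n - Suc k}"
    show ?case
      unfolding ev_sum_Suc
    proof (rule ev_sum_mono[where P = ?P])
      show "ev_sum K X k ?P \<zero>" using Suc by simp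
      fix z assume z: "z \<in> carrier X" and P: "?P z"
      have "\<forall>\<^sub>F x in wk K X. \<forall>f\<in>?D \<epsilon>s. Re (f (z \<oplus> x)) \<le> (M - sum_list \<epsilon>s + k * \<delta>) + \<delta>"
        if \<epsilon>s: "\<epsilon>s \<in> ?E" for \<epsilon>s
      proof (rule eventually_szlenk_deriv[OF _ _ z \<delta> N])
        show "compactin (weak_star K X) (?D \<epsilon>s)" using L by (rule compactin_foldr_szlenk_deriv)
        show "cmod (f x) \<le> C" if "f \<in> ?D \<epsilon>s" "x \<in> unit_ball X" for f x
          using C that sub by blast
        fix j f assume j: "j \<le> N" and f: "f \<in> szlenk_deriv K X (real j * (\<delta> / 4)) (?D \<epsilon>s)"
        have "set (real j * (\<delta> / 4) # \<epsilon>s) \<subseteq> G" using \<epsilon>s j by (auto simp: G_def)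
        moreover have "length (real j * (\<delta> / 4) # \<epsilon>s) = n - k" using \<epsilon>s Suc.prems by auto
        moreover have "f \<in> ?D (real j * (\<delta> / 4) # \<epsilon>s)" using f by simp
        ultimately have "Re (f z) \<le> M - sum_list (real j * (\<delta> / 4) # \<epsilon>s) + k * \<delta>"
          using P by blast
        then show "Re (f z) \<le> M - sum_list \<epsilon>s + real k * \<delta> - real j * (\<delta> / 4)" by simp
      qed
      moreover have "finite ?E" using finite_lists_length_eq[of G] by (simp add: G_def)
      ultimately have "\<forall>\<^sub>F x in wk K X. \<forall>\<epsilon>s\<in>?E. \<forall>f\<in>?D \<epsilon>s. Re (f (z \<oplus> x)) \<le> (M - sum_list \<epsilon>s + k * \<delta>) + \<delta>"
        by (intro eventually_ball_finite) auto
      then show "\<forall>\<^sub>F x in wk K X. \<forall>\<epsilon>s\<in>?E. \<forall>f\<in>?D \<epsilon>s. Re (f (z \<oplus> x)) \<le> M - sum_list \<epsilon>s + real (Suc k) * \<delta>"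
        by (simp add: algebra_simps)
    qed simp
  qed
  from this[of n] show ?thesis
    by (rule ev_sum_mono) auto
qed

end

section \<open>Operators with summable Szlenk index\<close>

text \<open>Banach-Alaoglu: the ball consists of the linear functions in a product of discs, and
  each condition for linearity is closed because it involves finitely many coordinates. The ambient
  product is kept, since the adjoint is continuous for it.\<close>

lemma compactin_dual_ball:
  assumes "normed_space K Y"
  shows "compactin (product_topology (\<lambda>_. euclidean) (carrier Y)) (unit_ball (dual K Y))"
proof -
  interpret normed_space K Y by fact
  let ?T = "product_topology (\<lambda>_. euclidean :: complex topology) (carrier Y)"
  let ?P = "PiE (carrier Y) (\<lambda>y. cball 0 (nrm Y y) :: complex set)"
  have proj: "continuous_map ?T euclidean (\<lambda>f. f y)" if "y \<in> carrier Y" for y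
    by (rule continuous_map_product_projection[OF that])
  have cl: "closedin ?T {f \<in> topspace ?T. h f \<in> S}" if "continuous_map ?T euclidean h" "closed S"
    for h and S :: "complex set"
    using closedin_continuous_map_preimage[OF that(1), of S] that(2) by simp
  have mult: "continuous_map ?T euclidean (\<lambda>f. a * f y)" if "y \<in> carrier Y" for a y
  proof -
    have "continuous_map euclidean euclidean ((*) a)"
      by (simp add: continuous_on_mult_left)
    from continuous_map_compose[OF proj[OF that] this] show ?thesis by (simp add: o_def)
  qed
  define A where "A x y = {f \<in> topspace ?T. f (x \<oplus>\<^bsub>Y\<^esub> y) - (f x + f y) \<in> {0}}" for x y
  define S where "S a x = {f \<in> topspace ?T. f (a \<odot>\<^bsub>Y\<^esub> x) - a * f x \<in> {0}}" for a x
  define R where "R x = {f \<in> topspace ?T. f x \<in> K}" for x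
  have "closed K" using scalar_field closed_complex_Reals by auto
  have "closedin ?T (\<Inter>x\<in>carrier Y. R x)"
    unfolding R_def using \<open>closed K\<close> proj by (intro closedin_INT cl) auto
  moreover have "closedin ?T (\<Inter>x\<in>carrier Y. \<Inter>y\<in>carrier Y. A x y)"
    unfolding A_def using proj by (intro closedin_INT cl continuous_map_diff continuous_map_add) auto
  moreover have "closedin ?T (\<Inter>a\<in>K. \<Inter>x\<in>carrier Y. S a x)"
    unfolding S_def using proj K_simps(1)
    by (intro closedin_INT cl continuous_map_diff mult) (use K_simps(1) in blast, auto)
  ultimately have "closedin ?T ((\<Inter>x\<in>carrier Y. R x) \<inter> (\<Inter>x\<in>carrier Y. \<Inter>y\<in>carrier Y. A x y) \<inter> (\<Inter>a\<in>K. \<Inter>x\<in>carrier Y. S a x))"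
    by (intro closedin_Int)
  moreover have "compactin ?T ?P"
    by (simp add: compactin_PiE)
  ultimately have "compactin ?T (?P \<inter> ((\<Inter>x\<in>carrier Y. R x) \<inter> (\<Inter>x\<in>carrier Y. \<Inter>y\<in>carrier Y. A x y) \<inter> (\<Inter>a\<in>K. \<Inter>x\<in>carrier Y. S a x)))"
    by (intro compact_Int_closedin)
  moreover have "unit_ball (dual K Y) = ?P \<inter> ((\<Inter>x\<in>carrier Y. R x) \<inter> (\<Inter>x\<in>carrier Y. \<Inter>y\<in>carrier Y. A x y) \<inter> (\<Inter>a\<in>K. \<Inter>x\<in>carrier Y. S a x))"
    (is "_ = ?R")
  proof (intro equalityI subsetI)
    fix f assume f: "f \<in> unit_ball (dual K Y)"
    then have "f \<in> carrier (dual K Y)" by (simp add: unit_ball_def)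
    then have "f \<in> extensional (carrier Y)" and fd: "f \<in> carrier (dual K Y)" by (simp_all add: dual_carrier)
    then show "f \<in> ?R"
      using dual_in_K[OF fd] dual_add[OF fd] dual_smult[OF fd] dual_unit_ball_le[OF f]
      by (auto simp: PiE_def A_def R_def S_def)
  next
    fix f assume f: "f \<in> ?R"
    then have "restrict f (carrier Y) \<in> unit_ball (dual K Y)"
      by (intro dual_unit_ballI) (auto simp: PiE_def A_def R_def S_def Pi_iff)
    moreover have "restrict f (carrier Y) = f"
      using f by (intro extensional_restrict) (auto simp: PiE_def)
    ultimately show "f \<in> unit_ball (dual K Y)" by simp
  qed
  ultimately show ?thesis by simp
qed

text \<open>Each coordinate of the adjoint is evaluation at some \<open>T x\<close>, hence
  continuous for pointwise convergence.\<close>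

lemma compactin_adjoint_ball:
  assumes "normed_space K X" "normed_space K Y" "bounded_op K X Y T"
  shows "compactin (weak_star K X) (adjoint X T ` unit_ball (dual K Y))"
proof -
  interpret X: normed_space K X by fact
  have "continuous_map (product_topology (\<lambda>_. euclidean) (carrier Y)) (product_topology (\<lambda>_. euclidean) (carrier X)) (adjoint X T)"
    unfolding continuous_map_componentwise adjoint_def
    using bounded_opD(1)[OF assms(3)] by (auto intro!: continuous_map_product_projection)
  from image_compactin[OF compactin_dual_ball[OF assms(2)] this]
  have "compactin (product_topology (\<lambda>_. euclidean) (carrier X)) (adjoint X T ` unit_ball (dual K Y))" .
  moreover have "adjoint X T ` unit_ball (dual K Y) \<subseteq> carrier (dual K X)"
    using dual_compose[OF assms] by (auto simp: adjoint_def unit_ball_def)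
  ultimately show ?thesis
    unfolding weak_star_def compactin_subtopology by simp
qed

text \<open>The norm of \<open>T z\<close> is the largest \<open>Re (f z)\<close> over the image of
  the dual ball. So bounds that are uniform over this compact set are bounds for the
  operator.\<close>

theorem op_summable_szlenk_iff_ev_sum:
  assumes "normed_space K X" "normed_space K Y" "bounded_op K X Y T"
  shows "op_summable_szlenk K X Y T \<longleftrightarrow> (\<exists>s. \<forall>n. ev_sum K X n (\<lambda>z. nrm Y (T z) \<le> s) \<zero>\<^bsub>X\<^esub>)"
proof
  interpret X: normed_space K X by fact
  interpret Y: normed_space K Y by fact
  let ?L = "adjoint X T ` unit_ball (dual K Y)"
  note T = bounded_opD[OF assms(3)]
  have cL: "compactin (weak_star K X) ?L" by (rule compactin_adjoint_ball[OF assms])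
  then have Ld: "?L \<subseteq> carrier (dual K X)" using compactin_subset_topspace by force
  have T0: "nrm Y (T \<zero>\<^bsub>X\<^esub>) = 0"
    using T(3)[of "\<zero>\<^bsub>X\<^esub>" 0] X.smult_l_null[of "\<zero>\<^bsub>X\<^esub>"] Y.nrm_smult[of 0 "T \<zero>\<^bsub>X\<^esub>"] T(1)[of "\<zero>\<^bsub>X\<^esub>"] by simp
  {
    assume "op_summable_szlenk K X Y T"
    then obtain M where M: "M \<ge> 0" "summable_szlenk_with K X M ?L"
      unfolding op_summable_szlenk_def summable_szlenk_def by blast
    obtain C where C: "\<forall>x\<in>carrier X. nrm Y (T x) \<le> C * nrm X x"
      using assms(3) unfolding bounded_op_def by blast
    have "cmod (f x) \<le> \<bar>C\<bar>" if fL: "f \<in> ?L" and xB: "x \<in> unit_ball X" for f x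
    proof -
      have x: "x \<in> carrier X" "nrm X x \<le> 1" using xB by (auto simp: unit_ball_def)
      obtain g where g: "g \<in> unit_ball (dual K Y)" "f = adjoint X T g" using fL by blast
      then have "cmod (f x) \<le> nrm Y (T x)"
        using Y.dual_unit_ball_le[OF g(1) T(1)[OF x(1)]] x by (simp add: adjoint_def)
      also have "\<dots> \<le> C * nrm X x" using C x by blast
      also have "\<dots> \<le> \<bar>C\<bar> * nrm X x" using X.nrm_nonneg[OF x(1)] by (intro mult_right_mono) auto
      also have "\<dots> \<le> \<bar>C\<bar>" using x(2) by (simp add: mult_left_le)
      finally show ?thesis .
    qed
    note bound = this
    have "ev_sum K X n (\<lambda>z. nrm Y (T z) \<le> M + 1) \<zero>\<^bsub>X\<^esub>" for n
    proof (cases "n = 0")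
      case True
      then show ?thesis using T0 M by simp
    next
      case False
      \<comment> \<open>With \<open>\<delta> = 1 / n\<close> the error accumulated over
        \<open>n\<close> levels is 1, whatever \<open>n\<close> is.\<close>
      then have "ev_sum K X n (\<lambda>z. \<forall>f\<in>?L. Re (f z) \<le> M + n * (1 / n)) \<zero>\<^bsub>X\<^esub>"
        by (intro X.ev_sum_if_szlenk[where C = "\<bar>C\<bar>"] cL M(2) bound) auto
      then show ?thesis
      proof (rule X.ev_sum_mono)
        fix z assume z: "z \<in> carrier X" and le: "\<forall>f\<in>?L. Re (f z) \<le> M + real n * (1 / real n)"
        obtain g where g: "g \<in> unit_ball (dual K Y)" "nrm Y (T z) \<le> Re (g (T z))"
          using Y.exists_norming_functional[OF T(1)[OF z]] by blast
        have "Re (adjoint X T g z) \<le> M + real n * (1 / real n)" using le g by blast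
        then show "nrm Y (T z) \<le> M + 1" using g(2) z False by (simp add: adjoint_def)
      qed simp
    qed
    then show "\<exists>s. \<forall>n. ev_sum K X n (\<lambda>z. nrm Y (T z) \<le> s) \<zero>\<^bsub>X\<^esub>" by blast
  next
    assume "\<exists>s. \<forall>n. ev_sum K X n (\<lambda>z. nrm Y (T z) \<le> s) \<zero>\<^bsub>X\<^esub>"
    then obtain s where s: "\<And>n. ev_sum K X n (\<lambda>z. nrm Y (T z) \<le> s) \<zero>\<^bsub>X\<^esub>" by blast
    have "s \<ge> 0" using s[of 0] T0 by simp
    have ev: "ev_sum K X n (\<lambda>z. \<forall>f\<in>?L. Re (f z) \<le> s) \<zero>\<^bsub>X\<^esub>" for n
      using s
    proof (rule X.ev_sum_mono, safe)
      fix z g assume z: "z \<in> carrier X" "nrm Y (T z) \<le> s" and g: "g \<in> unit_ball (dual K Y)"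
      then show "Re (adjoint X T g z) \<le> s"
        using Y.dual_unit_ball_le[OF g T(1)[OF z(1)]] complex_Re_le_cmod[of "g (T z)"]
        by (simp add: adjoint_def)
    qed simp
    \<comment> \<open>The factor 4 undoes the gain of only \<open>\<epsilon> / 4\<close> per
      derivation; the remaining error \<open>e\<close> is spread evenly over the list.\<close>
    have "sum_list \<epsilon>s \<le> 4 * s" if "\<epsilon>s \<noteq> []" and ne: "foldr (szlenk_deriv K X) \<epsilon>s ?L \<noteq> {}" for \<epsilon>s
    proof -
      obtain f where f: "f \<in> foldr (szlenk_deriv K X) \<epsilon>s ?L" using ne by blast
      then have "f \<in> carrier (dual K X)" using X.foldr_szlenk_deriv_subset Ld by blast
      then have f0: "f \<zero>\<^bsub>X\<^esub> = 0" by (rule X.dual_zero)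
      have "sum_list \<epsilon>s / 4 \<le> s + e" if "e > 0" for e
        using X.szlenk_le_ev_sum[OF ev f Ld, of "e / length \<epsilon>s"] that \<open>\<epsilon>s \<noteq> []\<close> f0 by simp
      then have "sum_list \<epsilon>s / 4 \<le> s" by (rule field_le_epsilon)
      then show ?thesis by simp
    qed
    then show "op_summable_szlenk K X Y T"
      unfolding op_summable_szlenk_def summable_szlenk_def summable_szlenk_with_def
      using \<open>s \<ge> 0\<close> by (intro exI[of _ "4 * s"]) auto
  }
qed

section \<open>Direct sums\<close>

text \<open>Membership in \<open>ell\<close> and a bound on the norm in one predicate, tested on
  finite sums. It agrees with the pair for non-empty index sets and \<open>0 \<le> c\<close>
  (\<open>ell_le_iff\<close>), and it can be restricted to any subset.\<close>

definition ell_le :: "ereal \<Rightarrow> 'i set \<Rightarrow> ('i \<Rightarrow> real) \<Rightarrow> real \<Rightarrow> bool" where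
  "ell_le p \<Lambda> a c \<longleftrightarrow>
     (if p = \<infinity> then \<forall>i\<in>\<Lambda>. \<bar>a i\<bar> \<le> c
      else \<forall>F. finite F \<and> F \<subseteq> \<Lambda> \<longrightarrow> (\<Sum>i\<in>F. \<bar>a i\<bar> powr real_of_ereal p) \<le> c powr real_of_ereal p)"

lemma real_exponent: "1 \<le> p \<Longrightarrow> p \<noteq> \<infinity> \<Longrightarrow> 1 \<le> real_of_ereal p"
  by (cases p) (auto simp: one_ereal_def)

text \<open>Convexity of the power with weights \<open>c / (c + d)\<close> and
  \<open>d / (c + d)\<close>. It is applied to positive arguments; vanishing ones are handled by
  \<open>t powr q \<le> t\<close> for \<open>0 < t < 1\<close>.\<close>

lemma convex_powr_add:
  fixes x y c d q :: real
  assumes "1 \<le> q" "0 \<le> x" "0 \<le> y" "0 < c" "0 < d"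
  shows "((x + y) / (c + d)) powr q \<le> c / (c + d) * (x / c) powr q + d / (c + d) * (y / d) powr q"
proof -
  define t where "t = c / (c + d)"
  have t: "0 < t" "t < 1" "d / (c + d) = 1 - t" using assms by (auto simp: t_def field_simps)
  have "(t * (x / c) + (1 - t) * (y / d)) powr q \<le> t * (x / c) powr q + (1 - t) * (y / d) powr q"
  proof (cases "x = 0 \<or> y = 0")
    case True
    have le: "r powr q \<le> r" if "0 < r" "r < 1" for r :: real
      using powr_mono'[of 1 q r] that assms(1) by simp
    show ?thesis using True le[of t] le[of "1 - t"] t assms
      by (auto simp: powr_mult intro!: mult_right_mono simp del: times_divide_eq_right)
  next
    case False
    then have pos: "0 < x / c" "0 < y / d" using assms by auto
    then show ?thesis
      using convex_onD[OF powr_convex[OF assms(1)], of "1 - t" "x / c" "y / d"] t by simp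
  qed
  moreover have "(x + y) / (c + d) = t * (x / c) + (1 - t) * (y / d)"
    unfolding t(3)[symmetric] unfolding t_def using assms by (simp add: add_divide_distrib)
  ultimately show ?thesis using t(3) by (simp add: t_def)
qed

context
  fixes p :: ereal assumes p: "1 \<le> p"
begin

lemma ell_le_coord:
  assumes "ell_le p \<Lambda> a c" "0 \<le> c" "i \<in> \<Lambda>"
  shows "\<bar>a i\<bar> \<le> c"
proof (cases "p = \<infinity>")
  case True
  then show ?thesis using assms by (simp add: ell_le_def)
next
  case False
  have "(\<Sum>i\<in>{i}. \<bar>a i\<bar> powr real_of_ereal p) \<le> c powr real_of_ereal p"
    using assms(1)[unfolded ell_le_def] assms(3) False by (auto simp del: sum.insert dest: spec[of _ "{i}"])
  then have *: "\<bar>a i\<bar> powr real_of_ereal p \<le> c powr real_of_ereal p" by simp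
  show ?thesis
  proof (rule ccontr)
    assume "\<not> \<bar>a i\<bar> \<le> c"
    then have "c powr real_of_ereal p < \<bar>a i\<bar> powr real_of_ereal p"
      using real_exponent[OF p False] assms(2) by (intro powr_less_mono2) auto
    with * show False by simp
  qed
qed

lemma ell_le_mono:
  assumes "ell_le p \<Lambda> a c" "0 \<le> c" "c \<le> d" "\<And>i. i \<in> \<Lambda>' \<Longrightarrow> i \<in> \<Lambda> \<and> \<bar>b i\<bar> \<le> \<bar>a i\<bar>"
  shows "ell_le p \<Lambda>' b d"
proof (cases "p = \<infinity>")
  case True
  have "\<bar>b i\<bar> \<le> d" if "i \<in> \<Lambda>'" for i
    using assms(1,3) assms(4)[OF that] True by (force simp: ell_le_def)
  then show ?thesis using True by (simp add: ell_le_def)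
next
  case False
  note q = real_exponent[OF p False]
  have "(\<Sum>i\<in>F. \<bar>b i\<bar> powr real_of_ereal p) \<le> d powr real_of_ereal p" if F: "finite F" "F \<subseteq> \<Lambda>'" for F
  proof -
    have "(\<Sum>i\<in>F. \<bar>b i\<bar> powr real_of_ereal p) \<le> (\<Sum>i\<in>F. \<bar>a i\<bar> powr real_of_ereal p)"
      using F assms(4) q by (intro sum_mono powr_mono2) auto
    also have "\<dots> \<le> c powr real_of_ereal p"
      using assms(1,4) F False unfolding ell_le_def by (simp add: subset_eq)
    also have "\<dots> \<le> d powr real_of_ereal p"
      using assms(2,3) q by (intro powr_mono2) auto
    finally show ?thesis .
  qed
  then show ?thesis using False by (simp add: ell_le_def)
qed

lemma ell_le_scale:
  assumes "ell_le p \<Lambda> a c"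
  shows "ell_le p \<Lambda> (\<lambda>i. r * a i) (\<bar>r\<bar> * c)"
proof (cases "p = \<infinity>")
  case True
  then show ?thesis using assms by (simp add: ell_le_def abs_mult mult_left_mono)
next
  case False
  have c: "(\<bar>r\<bar> * c) powr real_of_ereal p = \<bar>r\<bar> powr real_of_ereal p * c powr real_of_ereal p"
    by (simp add: powr_mult)
  show ?thesis
    using assms False
    by (simp add: ell_le_def c abs_mult powr_mult mult_left_mono flip: sum_distrib_left)
qed

text \<open>Minkowski's inequality: after division by \<open>c\<close> and \<open>d\<close>,
  convexity averages two sums that are at most one. A zero bound forces a zero family and is treated
  apart.\<close>

lemma ell_le_add:
  assumes a: "ell_le p \<Lambda> a c" and b: "ell_le p \<Lambda> b d" and "0 \<le> c" "0 \<le> d"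
  shows "ell_le p \<Lambda> (\<lambda>i. a i + b i) (c + d)"
proof -
  consider "c = 0" | "d = 0" | "p = \<infinity>" | "c > 0" "d > 0" "p \<noteq> \<infinity>" using assms by fastforce
  then show ?thesis
  proof cases
    case 1
    then have "a i = 0" if "i \<in> \<Lambda>" for i using ell_le_coord[OF a _ that] by simp
    then show ?thesis using 1 b assms by (auto intro!: ell_le_mono[OF b])
  next
    case 2
    then have "b i = 0" if "i \<in> \<Lambda>" for i using ell_le_coord[OF b _ that] by simp
    then show ?thesis using 2 a assms by (auto intro!: ell_le_mono[OF a])
  next
    case 3
    then show ?thesis using a b unfolding ell_le_def by (auto intro: order_trans[OF abs_triangle_ineq add_mono])
  next
    case 4
    let ?q = "real_of_ereal p"
    note q = real_exponent[OF p 4(3)]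
    have "(\<Sum>i\<in>F. \<bar>a i + b i\<bar> powr ?q) \<le> (c + d) powr ?q" if F: "finite F" "F \<subseteq> \<Lambda>" for F
    proof -
      have "(\<Sum>i\<in>F. \<bar>a i + b i\<bar> powr ?q) \<le> (\<Sum>i\<in>F. (c + d) powr ?q *
          (c / (c + d) * (\<bar>a i\<bar> / c) powr ?q + d / (c + d) * (\<bar>b i\<bar> / d) powr ?q))"
      proof (rule sum_mono)
        fix i assume "i \<in> F"
        have "\<bar>a i + b i\<bar> powr ?q \<le> (\<bar>a i\<bar> + \<bar>b i\<bar>) powr ?q"
          using q by (intro powr_mono2) auto
        also have "\<dots> = (c + d) powr ?q * ((\<bar>a i\<bar> + \<bar>b i\<bar>) / (c + d)) powr ?q"
          using 4 by (subst powr_mult[symmetric]) auto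
        also have "\<dots> \<le> (c + d) powr ?q *
          (c / (c + d) * (\<bar>a i\<bar> / c) powr ?q + d / (c + d) * (\<bar>b i\<bar> / d) powr ?q)"
          using q 4 by (intro mult_left_mono convex_powr_add) auto
        finally show "\<bar>a i + b i\<bar> powr ?q \<le> \<dots>" .
      qed
      also have "\<dots> = (c + d) powr ?q *
          (c / (c + d) * ((\<Sum>i\<in>F. \<bar>a i\<bar> powr ?q) / c powr ?q) + d / (c + d) * ((\<Sum>i\<in>F. \<bar>b i\<bar> powr ?q) / d powr ?q))"
        using 4 by (simp add: powr_divide sum.distrib sum_divide_distrib sum_distrib_left distrib_left)
      also have "\<dots> \<le> (c + d) powr ?q * (c / (c + d) * 1 + d / (c + d) * 1)"
      proof (intro mult_left_mono add_mono)
        show "(\<Sum>i\<in>F. \<bar>a i\<bar> powr ?q) / c powr ?q \<le> 1" "(\<Sum>i\<in>F. \<bar>b i\<bar> powr ?q) / d powr ?q \<le> 1"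
          using a b F 4 unfolding ell_le_def by auto
      qed (use 4 in auto)
      also have "\<dots> = (c + d) powr ?q" using 4 by (simp flip: add_divide_distrib)
      finally show ?thesis .
    qed
    then show ?thesis using 4 by (simp add: ell_le_def)
  qed
qed

lemma ell_le_single:
  assumes "\<And>j. j \<in> \<Lambda> \<Longrightarrow> j \<noteq> i \<Longrightarrow> a j = 0" "\<bar>a i\<bar> \<le> c"
  shows "ell_le p \<Lambda> a c"
proof (cases "p = \<infinity>")
  case True
  have "\<bar>a j\<bar> \<le> c" if "j \<in> \<Lambda>" for j
    using assms(1)[OF that] assms(2) by (cases "j = i") auto
  then show ?thesis using True by (simp add: ell_le_def)
next
  case False
  note q = real_exponent[OF p False]
  have "(\<Sum>j\<in>F. \<bar>a j\<bar> powr real_of_ereal p) \<le> c powr real_of_ereal p" if F: "finite F" "F \<subseteq> \<Lambda>" for F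
  proof -
    have "(\<Sum>j\<in>F. \<bar>a j\<bar> powr real_of_ereal p) = (\<Sum>j\<in>F \<inter> {i}. \<bar>a j\<bar> powr real_of_ereal p)"
      using F assms(1) q by (intro sum.mono_neutral_right) auto
    also have "\<dots> \<le> \<bar>a i\<bar> powr real_of_ereal p" by (cases "i \<in> F") auto
    also have "\<dots> \<le> c powr real_of_ereal p" using assms(2) q by (intro powr_mono2) auto
    finally show ?thesis .
  qed
  then show ?thesis using False by (simp add: ell_le_def)
qed

lemma ell_le_finite_subsets:
  assumes "\<And>F. finite F \<Longrightarrow> F \<subseteq> \<Lambda> \<Longrightarrow> ell_le p F a c"
  shows "ell_le p \<Lambda> a c"
proof (cases "p = \<infinity>")
  case True
  then show ?thesis using assms[of "{i}" for i] by (simp add: ell_le_def)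
next
  case False
  have "(\<Sum>i\<in>F. \<bar>a i\<bar> powr real_of_ereal p) \<le> c powr real_of_ereal p" if "finite F" "F \<subseteq> \<Lambda>" for F
  proof -
    have "\<forall>G. finite G \<and> G \<subseteq> F \<longrightarrow> (\<Sum>i\<in>G. \<bar>a i\<bar> powr real_of_ereal p) \<le> c powr real_of_ereal p"
      using assms[OF that] unfolding ell_le_def if_not_P[OF False] .
    from spec[OF this, of F] that(1) show ?thesis by blast
  qed
  then show ?thesis using False by (simp add: ell_le_def)
qed

lemma ell_le_iff:
  assumes "\<Lambda> \<noteq> {}" "0 \<le> c"
  shows "ell_le p \<Lambda> a c \<longleftrightarrow> a \<in> ell p \<Lambda> \<and> ell_norm p \<Lambda> a \<le> c"
proof (cases "p = \<infinity>")
  case True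
  then show ?thesis
    using cSUP_le_iff[OF assms(1), of "\<lambda>i. \<bar>a i\<bar>" c] bdd_aboveI2[of \<Lambda> "\<lambda>i. \<bar>a i\<bar>" c]
    unfolding ell_le_def ell_def ell_norm_def by auto
next
  case False
  let ?q = "real_of_ereal p" and ?f = "\<lambda>i. \<bar>a i\<bar> powr real_of_ereal p"
  note q = real_exponent[OF p False]
  have *: "(S powr (1 / ?q) \<le> c) = (S \<le> c powr ?q)" if "S \<ge> 0" for S
  proof
    assume "S powr (1 / ?q) \<le> c"
    then have "(S powr (1 / ?q)) powr ?q \<le> c powr ?q" using q by (intro powr_mono2) auto
    then show "S \<le> c powr ?q" using q that by (simp add: powr_powr)
  next
    assume "S \<le> c powr ?q"
    then have "S powr (1 / ?q) \<le> (c powr ?q) powr (1 / ?q)" using q that by (intro powr_mono2) auto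
    then show "S powr (1 / ?q) \<le> c" using q assms by (simp add: powr_powr)
  qed
  have "ell_le p \<Lambda> a c \<longleftrightarrow> ?f summable_on \<Lambda> \<and> infsum ?f \<Lambda> \<le> c powr ?q"
  proof
    assume "ell_le p \<Lambda> a c"
    then have le: "\<And>F. finite F \<Longrightarrow> F \<subseteq> \<Lambda> \<Longrightarrow> sum ?f F \<le> c powr ?q" using False by (simp add: ell_le_def)
    then have "?f summable_on \<Lambda>"
      by (intro nonneg_bdd_above_summable_on bdd_aboveI2[where M = "c powr ?q"]) auto
    then show "?f summable_on \<Lambda> \<and> infsum ?f \<Lambda> \<le> c powr ?q"
      using le infsum_le_finite_sums by blast
  next
    assume *: "?f summable_on \<Lambda> \<and> infsum ?f \<Lambda> \<le> c powr ?q"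
    have "sum ?f F \<le> c powr ?q" if "finite F" "F \<subseteq> \<Lambda>" for F
      by (rule order_trans[OF finite_sum_le_infsum conjunct2[OF *]]) (use * that in auto)
    then show "ell_le p \<Lambda> a c" using False by (simp add: ell_le_def)
  qed
  also have "\<dots> \<longleftrightarrow> a \<in> ell p \<Lambda> \<and> ell_norm p \<Lambda> a \<le> c"
    using False *[of "infsum ?f \<Lambda>"] by (simp add: ell_def ell_norm_def infsum_nonneg)
  finally show ?thesis .
qed

lemma ell_norm_nonneg:
  assumes "\<Lambda> \<noteq> {}" "a \<in> ell p \<Lambda>"
  shows "0 \<le> ell_norm p \<Lambda> a"
proof (cases "p = \<infinity>")
  case True
  obtain i where "i \<in> \<Lambda>" using assms by blast
  moreover have "bdd_above ((\<lambda>i. \<bar>a i\<bar>) ` \<Lambda>)" using assms(2) True by (simp add: ell_def)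
  ultimately have "\<bar>a i\<bar> \<le> ell_norm p \<Lambda> a"
    unfolding ell_norm_def if_P[OF True] by (rule cSUP_upper)
  then show ?thesis using abs_ge_zero[of "a i"] by linarith
qed (simp add: ell_norm_def)

lemma ell_le_ell_norm: "\<Lambda> \<noteq> {} \<Longrightarrow> a \<in> ell p \<Lambda> \<Longrightarrow> ell_le p \<Lambda> a (ell_norm p \<Lambda> a)"
  by (simp add: ell_le_iff ell_norm_nonneg)

end

section \<open>The direct sum as a normed space\<close>

locale space_family =
  fixes K :: "complex set" and \<Lambda> :: "'i set" and X :: "'i \<Rightarrow> 'a normed" and p :: ereal
  assumes K: "K = \<real> \<or> K = UNIV" and ne: "\<Lambda> \<noteq> {}"
    and spaces: "\<And>i. i \<in> \<Lambda> \<Longrightarrow> normed_space K (X i)" and p: "1 \<le> p"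
begin

abbreviation Z where "Z \<equiv> direct_sum p \<Lambda> X"

abbreviation nrms :: "('i \<Rightarrow> 'a) \<Rightarrow> 'i \<Rightarrow> real" where "nrms x \<equiv> \<lambda>i. nrm (X i) (x i)"

lemma sum_sel:
  "\<zero>\<^bsub>Z\<^esub> = (\<lambda>i\<in>\<Lambda>. \<zero>\<^bsub>X i\<^esub>)" "x \<oplus>\<^bsub>Z\<^esub> y = (\<lambda>i\<in>\<Lambda>. x i \<oplus>\<^bsub>X i\<^esub> y i)" "a \<odot>\<^bsub>Z\<^esub> x = (\<lambda>i\<in>\<Lambda>. a \<odot>\<^bsub>X i\<^esub> x i)"
  by (simp_all add: direct_sum_def)

lemma sum_carrierI:
  "x \<in> (\<Pi>\<^sub>E i\<in>\<Lambda>. carrier (X i)) \<Longrightarrow> ell_le p \<Lambda> (nrms x) c \<Longrightarrow> 0 \<le> c \<Longrightarrow> x \<in> carrier Z"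
  using ell_le_iff[OF p ne] by (auto simp: direct_sum_def)

lemma sum_carrier_PiE: "x \<in> carrier Z \<Longrightarrow> x \<in> (\<Pi>\<^sub>E i\<in>\<Lambda>. carrier (X i))"
  by (simp add: direct_sum_def)

lemma sum_carrier: "x \<in> carrier Z \<Longrightarrow> i \<in> \<Lambda> \<Longrightarrow> x i \<in> carrier (X i)"
  using sum_carrier_PiE by auto

lemma sum_nrm_le: "x \<in> carrier Z \<Longrightarrow> 0 \<le> c \<Longrightarrow> nrm Z x \<le> c \<longleftrightarrow> ell_le p \<Lambda> (nrms x) c"
  using ell_le_iff[OF p ne] by (auto simp: direct_sum_def)

lemma sum_nrm_nonneg: "x \<in> carrier Z \<Longrightarrow> 0 \<le> nrm Z x"
  using ell_norm_nonneg[OF p ne] by (auto simp: direct_sum_def)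

lemma sum_nrm_ell_le: "x \<in> carrier Z \<Longrightarrow> ell_le p \<Lambda> (nrms x) (nrm Z x)"
  using sum_nrm_le[of x "nrm Z x"] sum_nrm_nonneg by simp

lemma sum_nrm_coord:
  assumes "x \<in> carrier Z" "i \<in> \<Lambda>"
  shows "nrm (X i) (x i) \<le> nrm Z x"
  using ell_le_coord[OF p sum_nrm_ell_le[OF assms(1)] sum_nrm_nonneg[OF assms(1)] assms(2)] by simp

lemma sum_add:
  assumes x: "x \<in> carrier Z" and y: "y \<in> carrier Z"
  shows "x \<oplus>\<^bsub>Z\<^esub> y \<in> carrier Z \<and> nrm Z (x \<oplus>\<^bsub>Z\<^esub> y) \<le> nrm Z x + nrm Z y"
proof -
  have c: "x \<oplus>\<^bsub>Z\<^esub> y \<in> (\<Pi>\<^sub>E i\<in>\<Lambda>. carrier (X i))"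
  proof -
    have "x i \<oplus>\<^bsub>X i\<^esub> y i \<in> carrier (X i)" if i: "i \<in> \<Lambda>" for i
    proof -
      interpret normed_space K "X i" using spaces[OF i] .
      show ?thesis using sum_carrier[OF x i] sum_carrier[OF y i] by simp
    qed
    then show ?thesis by (simp add: sum_sel)
  qed
  have "ell_le p \<Lambda> (\<lambda>i. nrms x i + nrms y i) (nrm Z x + nrm Z y)"
    by (intro ell_le_add p sum_nrm_ell_le sum_nrm_nonneg x y)
  then have "ell_le p \<Lambda> (nrms (x \<oplus>\<^bsub>Z\<^esub> y)) (nrm Z x + nrm Z y)"
  proof (rule ell_le_mono[OF p])
    fix i assume i: "i \<in> \<Lambda>"
    interpret normed_space K "X i" using spaces[OF i] .
    show "i \<in> \<Lambda> \<and> \<bar>nrms (x \<oplus>\<^bsub>Z\<^esub> y) i\<bar> \<le> \<bar>nrms x i + nrms y i\<bar>"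
      using nrm_triangle[of "x i" "y i"] nrm_nonneg[of "x i \<oplus>\<^bsub>X i\<^esub> y i"] sum_carrier[OF x i] sum_carrier[OF y i] i
      by (simp add: sum_sel)
  qed (use sum_nrm_nonneg x y in auto)
  then show ?thesis
    using sum_carrierI[OF c] sum_nrm_le[of "x \<oplus>\<^bsub>Z\<^esub> y"] sum_nrm_nonneg[OF x] sum_nrm_nonneg[OF y] by auto
qed

lemma sum_smult:
  assumes x: "x \<in> carrier Z" and a: "a \<in> K"
  shows "a \<odot>\<^bsub>Z\<^esub> x \<in> carrier Z \<and> nrm Z (a \<odot>\<^bsub>Z\<^esub> x) \<le> cmod a * nrm Z x"
proof -
  have c: "a \<odot>\<^bsub>Z\<^esub> x \<in> (\<Pi>\<^sub>E i\<in>\<Lambda>. carrier (X i))"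
  proof -
    have "a \<odot>\<^bsub>X i\<^esub> x i \<in> carrier (X i)" if i: "i \<in> \<Lambda>" for i
    proof -
      interpret normed_space K "X i" using spaces[OF i] .
      show ?thesis using sum_carrier[OF x i] a by simp
    qed
    then show ?thesis by (simp add: sum_sel)
  qed
  have "ell_le p \<Lambda> (\<lambda>i. cmod a * nrms x i) (\<bar>cmod a\<bar> * nrm Z x)"
    by (intro ell_le_scale p sum_nrm_ell_le x)
  then have "ell_le p \<Lambda> (nrms (a \<odot>\<^bsub>Z\<^esub> x)) (cmod a * nrm Z x)"
  proof (rule ell_le_mono[OF p])
    fix i assume i: "i \<in> \<Lambda>"
    interpret normed_space K "X i" using spaces[OF i] .
    show "i \<in> \<Lambda> \<and> \<bar>nrms (a \<odot>\<^bsub>Z\<^esub> x) i\<bar> \<le> \<bar>cmod a * nrms x i\<bar>"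
      using nrm_smult[OF a, of "x i"] sum_carrier[OF x i] i by (simp add: sum_sel)
  qed (use sum_nrm_nonneg x in auto)
  then show ?thesis
    using sum_carrierI[OF c] sum_nrm_le[of "a \<odot>\<^bsub>Z\<^esub> x"] sum_nrm_nonneg[OF x] by auto
qed

lemma sum_zero_carrier: "\<zero>\<^bsub>Z\<^esub> \<in> carrier Z"
proof (rule sum_carrierI[of _ 0])
  have z: "\<zero>\<^bsub>X i\<^esub> \<in> carrier (X i)" "nrm (X i) \<zero>\<^bsub>X i\<^esub> = 0" if "i \<in> \<Lambda>" for i
  proof -
    interpret normed_space K "X i" using spaces[OF that] .
    show "\<zero>\<^bsub>X i\<^esub> \<in> carrier (X i)" "nrm (X i) \<zero>\<^bsub>X i\<^esub> = 0" by simp_all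
  qed
  show "\<zero>\<^bsub>Z\<^esub> \<in> (\<Pi>\<^sub>E i\<in>\<Lambda>. carrier (X i))" using z by (simp add: sum_sel)
  show "ell_le p \<Lambda> (nrms \<zero>\<^bsub>Z\<^esub>) 0"
  proof -
    obtain i where "i \<in> \<Lambda>" using ne by blast
    then show ?thesis using z by (intro ell_le_single[OF p, of _ i]) (auto simp: sum_sel)
  qed
qed simp

lemma abelian_group_sum: "abelian_group Z"
proof (rule abelian_groupI)
  fix x y z assume x: "x \<in> carrier Z" and y: "y \<in> carrier Z" and z: "z \<in> carrier Z"
  have G: "abelian_group (X i)" if "i \<in> \<Lambda>" for i
    using spaces[OF that] by (simp add: normed_space_def module_def)
  show "x \<oplus>\<^bsub>Z\<^esub> y \<in> carrier Z" using sum_add x y by blast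
  show "x \<oplus>\<^bsub>Z\<^esub> y \<oplus>\<^bsub>Z\<^esub> z = x \<oplus>\<^bsub>Z\<^esub> (y \<oplus>\<^bsub>Z\<^esub> z)"
    unfolding sum_sel
  proof (rule restrict_ext)
    fix i assume i: "i \<in> \<Lambda>"
    interpret abelian_group "X i" using G[OF i] .
    show "(\<lambda>i\<in>\<Lambda>. x i \<oplus>\<^bsub>X i\<^esub> y i) i \<oplus>\<^bsub>X i\<^esub> z i = x i \<oplus>\<^bsub>X i\<^esub> (\<lambda>i\<in>\<Lambda>. y i \<oplus>\<^bsub>X i\<^esub> z i) i"
      using i sum_carrier[OF x i] sum_carrier[OF y i] sum_carrier[OF z i] by (simp add: a_assoc)
  qed
  show "x \<oplus>\<^bsub>Z\<^esub> y = y \<oplus>\<^bsub>Z\<^esub> x"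
    unfolding sum_sel
  proof (rule restrict_ext)
    fix i assume i: "i \<in> \<Lambda>"
    interpret abelian_group "X i" using G[OF i] .
    show "x i \<oplus>\<^bsub>X i\<^esub> y i = y i \<oplus>\<^bsub>X i\<^esub> x i"
      using sum_carrier[OF x i] sum_carrier[OF y i] by (rule a_comm)
  qed
next
  fix x assume x: "x \<in> carrier Z"
  have ext: "x \<in> extensional \<Lambda>" using sum_carrier_PiE[OF x] by (simp add: PiE_def)
  have G: "abelian_group (X i)" if "i \<in> \<Lambda>" for i
    using spaces[OF that] by (simp add: normed_space_def module_def)
  have "(\<zero>\<^bsub>Z\<^esub> \<oplus>\<^bsub>Z\<^esub> x) i = x i" for i
  proof (cases "i \<in> \<Lambda>")
    case True
    interpret abelian_group "X i" using G[OF True] .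
    show ?thesis using True sum_carrier[OF x True] by (simp add: sum_sel)
  qed (use ext in \<open>auto simp: sum_sel extensional_def\<close>)
  then show "\<zero>\<^bsub>Z\<^esub> \<oplus>\<^bsub>Z\<^esub> x = x" by auto
  have K1: "- 1 \<in> K" using K by auto
  have "((-1) \<odot>\<^bsub>Z\<^esub> x \<oplus>\<^bsub>Z\<^esub> x) = \<zero>\<^bsub>Z\<^esub>"
    unfolding sum_sel
  proof (rule restrict_ext)
    fix i assume i: "i \<in> \<Lambda>"
    interpret normed_space K "X i" using spaces[OF i] .
    show "(\<lambda>i\<in>\<Lambda>. - 1 \<odot>\<^bsub>X i\<^esub> x i) i \<oplus>\<^bsub>X i\<^esub> x i = \<zero>\<^bsub>X i\<^esub>"
      using i sum_carrier[OF x i] by (simp add: M.l_neg flip: neg_eq_smult)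
  qed
  then show "\<exists>y\<in>carrier Z. y \<oplus>\<^bsub>Z\<^esub> x = \<zero>\<^bsub>Z\<^esub>"
    using sum_smult[OF x K1] by blast
qed (rule sum_zero_carrier)

lemma module_sum: "module (scalars K) Z"
proof (rule moduleI)
  have M: "module (scalars K) (X i)" if "i \<in> \<Lambda>" for i
    using spaces[OF that] by (simp add: normed_space_def)
  show "cring (scalars K)" by (rule cring_scalars[OF K])
  show "abelian_group Z" by (rule abelian_group_sum)
  fix a b x y assume *: "a \<in> carrier (scalars K)" "b \<in> carrier (scalars K)" "x \<in> carrier Z" "y \<in> carrier Z"
  show "a \<odot>\<^bsub>Z\<^esub> x \<in> carrier Z" using sum_smult * by simp
  show "(a \<oplus>\<^bsub>scalars K\<^esub> b) \<odot>\<^bsub>Z\<^esub> x = a \<odot>\<^bsub>Z\<^esub> x \<oplus>\<^bsub>Z\<^esub> b \<odot>\<^bsub>Z\<^esub> x"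
    unfolding sum_sel using * by (intro restrict_ext) (simp add: sum_carrier module.smult_l_distr[OF M, simplified])
  show "a \<odot>\<^bsub>Z\<^esub> (x \<oplus>\<^bsub>Z\<^esub> y) = a \<odot>\<^bsub>Z\<^esub> x \<oplus>\<^bsub>Z\<^esub> a \<odot>\<^bsub>Z\<^esub> y"
    unfolding sum_sel using * by (intro restrict_ext) (simp add: sum_carrier module.smult_r_distr[OF M, simplified])
  show "(a \<otimes>\<^bsub>scalars K\<^esub> b) \<odot>\<^bsub>Z\<^esub> x = a \<odot>\<^bsub>Z\<^esub> (b \<odot>\<^bsub>Z\<^esub> x)"
    unfolding sum_sel using * by (intro restrict_ext) (simp add: sum_carrier module.smult_assoc1[OF M, simplified])
next
  fix x assume x: "x \<in> carrier Z"
  have "(1 \<odot>\<^bsub>Z\<^esub> x) i = x i" for i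
  proof (cases "i \<in> \<Lambda>")
    case True
    interpret normed_space K "X i" using spaces[OF True] .
    show ?thesis using True smult_one[OF sum_carrier[OF x True]] by (simp add: sum_sel)
  qed (use sum_carrier_PiE[OF x] in \<open>auto simp: sum_sel PiE_def extensional_def\<close>)
  then show "\<one>\<^bsub>scalars K\<^esub> \<odot>\<^bsub>Z\<^esub> x = x" by auto
qed

lemma normed_space_sum: "normed_space K Z"
proof -
  interpret module "scalars K" Z by (rule module_sum)
  show ?thesis
  proof
    fix x y assume x: "x \<in> carrier Z" and y: "y \<in> carrier Z"
    show "nrm Z (x \<oplus>\<^bsub>Z\<^esub> y) \<le> nrm Z x + nrm Z y" using sum_add x y by blast
  next
    fix x assume x: "x \<in> carrier Z"
    show "0 \<le> nrm Z x" using sum_nrm_nonneg x .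
    show "nrm Z x = 0 \<longleftrightarrow> x = \<zero>\<^bsub>Z\<^esub>"
    proof
      assume 0: "nrm Z x = 0"
      have "x i = \<zero>\<^bsub>Z\<^esub> i" for i
      proof (cases "i \<in> \<Lambda>")
        case True
        interpret Xi: normed_space K "X i" using spaces[OF True] .
        show ?thesis
          using sum_nrm_coord[OF x True] 0 Xi.nrm_nonneg[OF sum_carrier[OF x True]]
            Xi.nrm_eq_0_iff[OF sum_carrier[OF x True]] True by (simp add: sum_sel)
      qed (use sum_carrier_PiE[OF x] in \<open>auto simp: sum_sel PiE_def extensional_def\<close>)
      then show "x = \<zero>\<^bsub>Z\<^esub>" by auto
    next
      assume 0: "x = \<zero>\<^bsub>Z\<^esub>"
      have "x = 0 \<odot>\<^bsub>Z\<^esub> x" using smult_l_null[OF x] 0 by simp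
      then have "nrm Z x \<le> 0" using sum_smult[OF x, of 0] K by auto
      then show "nrm Z x = 0" using sum_nrm_nonneg[OF x] by simp
    qed
    fix a assume a: "a \<in> K"
    show "nrm Z (a \<odot>\<^bsub>Z\<^esub> x) = cmod a * nrm Z x"
    proof (cases "a = 0")
      case True
      then show ?thesis using sum_smult[OF x a] sum_nrm_nonneg[of "a \<odot>\<^bsub>Z\<^esub> x"] by simp
    next
      case False
      \<comment> \<open>So far only one inequality is known for scalar multiples; applied to the
        inverse scalar it gives the other.\<close>
      have ia: "inverse a \<in> K" using a K by auto
      have "inverse a \<odot>\<^bsub>Z\<^esub> (a \<odot>\<^bsub>Z\<^esub> x) = x"
        using smult_assoc1[of "inverse a" a x] smult_one[OF x] ia a x False by simp
      then have "nrm Z x \<le> cmod (inverse a) * nrm Z (a \<odot>\<^bsub>Z\<^esub> x)"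
        using sum_smult[OF _ ia, of "a \<odot>\<^bsub>Z\<^esub> x"] sum_smult[OF x a] by simp
      then have "cmod a * nrm Z x \<le> nrm Z (a \<odot>\<^bsub>Z\<^esub> x)"
        using mult_left_mono[of "nrm Z x" "cmod (inverse a) * nrm Z (a \<odot>\<^bsub>Z\<^esub> x)" "cmod a"] False
        by (simp add: norm_inverse flip: mult.assoc)
      then show ?thesis using sum_smult[OF x a] by simp
    qed
  qed (rule K)
qed

sublocale Z: normed_space K Z by (rule normed_space_sum)

section \<open>Coordinate embeddings and projections\<close>

definition emb :: "'i \<Rightarrow> 'a \<Rightarrow> 'i \<Rightarrow> 'a" where
  "emb i y = (\<lambda>j\<in>\<Lambda>. if j = i then y else \<zero>\<^bsub>X j\<^esub>)"

lemma emb_carrier: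
  assumes i: "i \<in> \<Lambda>" and y: "y \<in> carrier (X i)"
  shows "emb i y \<in> carrier Z" and "nrm Z (emb i y) \<le> nrm (X i) y"
proof -
  have z: "\<zero>\<^bsub>X i\<^esub> \<in> carrier (X i)" "nrm (X i) \<zero>\<^bsub>X i\<^esub> = 0" if "i \<in> \<Lambda>" for i
  proof -
    interpret normed_space K "X i" using spaces[OF that] .
    show "\<zero>\<^bsub>X i\<^esub> \<in> carrier (X i)" "nrm (X i) \<zero>\<^bsub>X i\<^esub> = 0" by simp_all
  qed
  interpret Xi: normed_space K "X i" using spaces[OF i] .
  have nn: "0 \<le> nrm (X i) y" using Xi.nrm_nonneg y .
  have PiE: "emb i y \<in> (\<Pi>\<^sub>E i\<in>\<Lambda>. carrier (X i))" using y z by (auto simp: emb_def)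
  have le: "ell_le p \<Lambda> (nrms (emb i y)) (nrm (X i) y)"
    by (rule ell_le_single[OF p, of _ i]) (use z i nn in \<open>auto simp: emb_def\<close>)
  show c: "emb i y \<in> carrier Z" by (rule sum_carrierI[OF PiE le nn])
  show "nrm Z (emb i y) \<le> nrm (X i) y" using sum_nrm_le[OF c nn] le by simp
qed

lemma emb_unit_ball: "i \<in> \<Lambda> \<Longrightarrow> y \<in> unit_ball (X i) \<Longrightarrow> emb i y \<in> unit_ball Z"
  using emb_carrier by (fastforce simp: unit_ball_def)

lemma proj_unit_ball: "i \<in> \<Lambda> \<Longrightarrow> x \<in> unit_ball Z \<Longrightarrow> x i \<in> unit_ball (X i)"
  using sum_nrm_coord sum_carrier by (fastforce simp: unit_ball_def)

lemma bounded_op_emb: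
  assumes i: "i \<in> \<Lambda>"
  shows "bounded_op K (X i) Z (emb i)"
  unfolding bounded_op_def
proof (intro conjI ballI exI[of _ 1])
  show "emb i \<in> carrier (X i) \<rightarrow> carrier Z" using emb_carrier i by auto
  fix y assume y: "y \<in> carrier (X i)"
  show "nrm Z (emb i y) \<le> 1 * nrm (X i) y" using emb_carrier(2)[OF i y] by simp
  show "emb i (y \<oplus>\<^bsub>X i\<^esub> z) = emb i y \<oplus>\<^bsub>Z\<^esub> emb i z" if z: "z \<in> carrier (X i)" for z
    unfolding emb_def sum_sel
  proof (rule restrict_ext)
    fix j assume j: "j \<in> \<Lambda>"
    interpret normed_space K "X j" using spaces[OF j] .
    show "(if j = i then y \<oplus>\<^bsub>X i\<^esub> z else \<zero>\<^bsub>X j\<^esub>) =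
         (\<lambda>j\<in>\<Lambda>. if j = i then y else \<zero>\<^bsub>X j\<^esub>) j \<oplus>\<^bsub>X j\<^esub> (\<lambda>j\<in>\<Lambda>. if j = i then z else \<zero>\<^bsub>X j\<^esub>) j"
      using j by simp
  qed
  show "emb i (a \<odot>\<^bsub>X i\<^esub> y) = a \<odot>\<^bsub>Z\<^esub> emb i y" if a: "a \<in> K" for a
    unfolding emb_def sum_sel
  proof (rule restrict_ext)
    fix j assume j: "j \<in> \<Lambda>"
    interpret normed_space K "X j" using spaces[OF j] .
    show "(if j = i then a \<odot>\<^bsub>X i\<^esub> y else \<zero>\<^bsub>X j\<^esub>) = a \<odot>\<^bsub>X j\<^esub> (\<lambda>j\<in>\<Lambda>. if j = i then y else \<zero>\<^bsub>X j\<^esub>) j"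
      using j a smult_r_null[of a] by simp
  qed
qed

lemma bounded_op_proj:
  assumes i: "i \<in> \<Lambda>"
  shows "bounded_op K Z (X i) (\<lambda>x. x i)"
  unfolding bounded_op_def using i sum_carrier sum_nrm_coord
  by (auto simp: sum_sel intro!: exI[of _ 1])

end

text \<open>Composition with \<open>h\<close> sends functionals on \<open>Z\<close> to functionals
  on \<open>X\<close>; mapping ball to ball makes the images admissible moves.\<close>

lemma filterlim_wk_bounded_op:
  assumes X: "normed_space K X" and Z: "normed_space K Z" and h: "bounded_op K X Z h"
    and ball: "\<And>x. x \<in> unit_ball X \<Longrightarrow> h x \<in> unit_ball Z"
  shows "filterlim h (wk K Z) (wk K X)"
proof (rule filterlim_wk)
  show "\<forall>\<^sub>F x in wk K X. h x \<in> unit_ball Z"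
    using eventually_wk_unit_ball[of X K] by eventually_elim (rule ball)
  fix f assume f: "f \<in> carrier (dual K Z)"
  interpret X: normed_space K X by fact
  have g: "restrict (\<lambda>x. f (h x)) (carrier X) \<in> carrier (dual K X)"
    by (rule dual_compose[OF X Z h f])
  show "((\<lambda>x. f (h x)) \<longlongrightarrow> 0) (wk K X)"
  proof (rule tendstoI)
    fix e :: real assume "e > 0"
    from eventually_wk_unit_ball[of X K] eventually_wk_small[OF g this]
    show "\<forall>\<^sub>F x in wk K X. dist (f (h x)) 0 < e"
      by eventually_elim (use X.unit_ball_carrier in auto)
  qed
qed

section \<open>Diagonal operators\<close>

lemma opnorm:
  assumes X: "normed_space K X" and Y: "normed_space K Y" and T: "bounded_op K X Y T"
  shows opnorm_le: "x \<in> carrier X \<Longrightarrow> nrm Y (T x) \<le> opnorm X Y T * nrm X x"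
    and opnorm_nonneg: "0 \<le> opnorm X Y T"
    and less_opnorm: "r < opnorm X Y T \<Longrightarrow> \<exists>x\<in>unit_ball X. r < nrm Y (T x)"
proof -
  interpret X: normed_space K X by fact
  interpret Y: normed_space K Y by fact
  note TD = bounded_opD[OF T]
  obtain C where C: "\<forall>x\<in>carrier X. nrm Y (T x) \<le> C * nrm X x"
    using T unfolding bounded_op_def by blast
  have ne: "unit_ball X \<noteq> {}" using X.zero_unit_ball by blast
  have "nrm Y (T x) \<le> \<bar>C\<bar>" if "x \<in> unit_ball X" for x
  proof -
    have x: "x \<in> carrier X" "nrm X x \<le> 1" using that by (auto simp: unit_ball_def)
    have "nrm Y (T x) \<le> C * nrm X x" using C x by blast
    also have "\<dots> \<le> \<bar>C\<bar> * nrm X x" using X.nrm_nonneg[OF x(1)] by (intro mult_right_mono) auto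
    also have "\<dots> \<le> \<bar>C\<bar>" using x(2) by (simp add: mult_left_le)
    finally show ?thesis .
  qed
  then have bdd: "bdd_above ((\<lambda>x. nrm Y (T x)) ` unit_ball X)" by (intro bdd_aboveI2)
  have up: "nrm Y (T x) \<le> opnorm X Y T" if "x \<in> unit_ball X" for x
    unfolding opnorm_def by (rule cSUP_upper[OF that bdd])
  show "0 \<le> opnorm X Y T"
    using up[OF X.zero_unit_ball] Y.nrm_nonneg[OF TD(1)[OF X.M.zero_closed]] by linarith
  show "\<exists>x\<in>unit_ball X. r < nrm Y (T x)" if "r < opnorm X Y T"
    using that unfolding opnorm_def by (subst (asm) less_cSUP_iff[OF ne bdd])
  assume x: "x \<in> carrier X"
  show "nrm Y (T x) \<le> opnorm X Y T * nrm X x"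
  proof (cases "nrm X x = 0")
    case True
    then show ?thesis using C x by force
  next
    case False
    define r where "r = nrm X x"
    have r: "r > 0" using False X.nrm_nonneg[OF x] by (simp add: r_def)
    have k: "complex_of_real (1/r) \<in> K" by (rule X.K_simps)
    have "complex_of_real (1/r) \<odot>\<^bsub>X\<^esub> x \<in> unit_ball X"
      using X.nrm_smult[OF k x] k x r by (auto simp: unit_ball_def r_def norm_divide)
    from up[OF this] have "nrm Y (complex_of_real (1/r) \<odot>\<^bsub>Y\<^esub> T x) \<le> opnorm X Y T"
      using TD(3)[OF x k] by simp
    then have "nrm Y (T x) / r \<le> opnorm X Y T"
      using Y.nrm_smult[OF k TD(1)[OF x]] r by (simp add: norm_divide)
    then show ?thesis using r by (simp add: r_def field_simps)
  qed
qed

lemma bounded_op_zero: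
  assumes "normed_space K X" "normed_space K Y" "bounded_op K X Y T"
  shows "T \<zero>\<^bsub>X\<^esub> = \<zero>\<^bsub>Y\<^esub>" "nrm Y (T \<zero>\<^bsub>X\<^esub>) = 0"
proof -
  interpret X: normed_space K X by fact
  interpret Y: normed_space K Y by fact
  have "T \<zero>\<^bsub>X\<^esub> \<in> carrier Y" using bounded_opD(1)[OF assms(3)] by simp
  then show "T \<zero>\<^bsub>X\<^esub> = \<zero>\<^bsub>Y\<^esub>"
    using bounded_opD(3)[OF assms(3), of "\<zero>\<^bsub>X\<^esub>" 0] X.smult_l_null[of "\<zero>\<^bsub>X\<^esub>"] Y.smult_l_null by simp
  then show "nrm Y (T \<zero>\<^bsub>X\<^esub>) = 0" by simp
qed

text \<open>Pigeonhole: infinitely many vectors share the finitely many cells of a net, so two of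
  them nearly agree on the functionals of a given neighbourhood. The sequence itself need not be
  weakly null.\<close>

lemma (in normed_space) ev_half_difference:
  assumes u: "\<And>k::nat. u k \<in> unit_ball X" and P: "\<forall>\<^sub>F x in wk K X. P x"
  shows "\<exists>a b. a \<noteq> b \<and> P ((1/2) \<odot> (u a \<ominus> u b))"
proof -
  obtain F e where F: "finite F" "F \<subseteq> carrier (dual K X)" "e > 0"
    "\<forall>x\<in>unit_ball X. (\<forall>f\<in>F. cmod (f x) < e) \<longrightarrow> P x"
    using P unfolding eventually_wk by blast
  obtain V where V: "finite V" "V \<subseteq> unit_ball X" "\<forall>x\<in>unit_ball X. \<exists>v\<in>V. \<forall>f\<in>F. cmod (f x - f v) < e"
    using functionals_totally_bounded[OF F(1,2,3)] .
  have "\<forall>k. \<exists>v\<in>V. \<forall>f\<in>F. cmod (f (u k) - f v) < e" using V(3) u by blast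
  then obtain v where v: "\<And>k. v k \<in> V" "\<And>k f. f \<in> F \<Longrightarrow> cmod (f (u k) - f (v k)) < e" by metis
  have "finite (range v)" using v(1) V(1) by (meson finite_subset image_subsetI)
  then have "\<not> inj v" using finite_imageD infinite_UNIV_nat by blast
  then obtain a b where ab: "a \<noteq> b" "v a = v b" by (auto simp: inj_def)
  let ?x = "(1/2) \<odot> (u a \<ominus> u b)"
  have half: "1/2 \<in> K" using K_simps(4)[of "1/2"] by simp
  have c: "u a \<in> carrier X" "u b \<in> carrier X" using u unit_ball_carrier by auto
  have "cmod (f ?x) < e" if f: "f \<in> F" for f
  proof -
    have fd: "f \<in> carrier (dual K X)" using f F by blast
    have "f ?x = (f (u a) - f (u b)) / 2"
      using dual_smult[OF fd half, of "u a \<ominus> u b"] dual_minus[OF fd c] c by simp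
    moreover have "cmod (f (u a) - f (u b)) < e + e"
      using v(2)[OF f, of a] v(2)[OF f, of b] ab(2) norm_triangle_ineq4[of "f (u a) - f (v a)" "f (u b) - f (v a)"]
      by simp
    moreover have "cmod ((f (u a) - f (u b)) / 2) = cmod (f (u a) - f (u b)) / 2"
      by (simp only: norm_divide norm_numeral)
    ultimately show ?thesis by (simp only:)
  qed
  then have "P ?x" using F(4) half_difference_unit_ball[OF u u] by blast
  then show ?thesis using ab(1) by blast
qed

text \<open>Nonnegative numbers strictly below \<open>a i\<close> exist only where
  \<open>a i > 0\<close>, so a lower bound obtained from such numbers first reaches the positive
  part only.\<close>

lemma ell_le_positive_part:
  assumes p: "1 \<le> p" and a: "ell_le p {i \<in> \<Lambda>. a i > 0} a c" and "\<And>i. i \<in> \<Lambda> \<Longrightarrow> 0 \<le> a i" "0 \<le> c"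
  shows "ell_le p \<Lambda> a c"
proof (cases "p = \<infinity>")
  case True
  have "\<bar>a i\<bar> \<le> c" if "i \<in> \<Lambda>" for i
    using a True assms(3)[OF that] assms(4) that by (cases "a i = 0") (auto simp: ell_le_def)
  then show ?thesis using True by (simp add: ell_le_def)
next
  case False
  have "(\<Sum>i\<in>G. \<bar>a i\<bar> powr real_of_ereal p) \<le> c powr real_of_ereal p" if G: "finite G" "G \<subseteq> \<Lambda>" for G
  proof -
    have "(\<Sum>i\<in>G. \<bar>a i\<bar> powr real_of_ereal p) = (\<Sum>i\<in>{i \<in> G. a i > 0}. \<bar>a i\<bar> powr real_of_ereal p)"
    proof (rule sum.mono_neutral_right)
      show "\<forall>i\<in>G - {i \<in> G. a i > 0}. \<bar>a i\<bar> powr real_of_ereal p = 0"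
      proof
        fix i assume i: "i \<in> G - {i \<in> G. a i > 0}"
        then have "a i = 0" using assms(3)[of i] G by force
        then show "\<bar>a i\<bar> powr real_of_ereal p = 0" by simp
      qed
    qed (use G in auto)
    also have "\<dots> \<le> c powr real_of_ereal p"
    proof -
      have "finite {i \<in> G. a i > 0} \<and> {i \<in> G. a i > 0} \<subseteq> {i \<in> \<Lambda>. a i > 0}" using G by auto
      then show ?thesis by (rule a[unfolded ell_le_def if_not_P[OF False], THEN spec, THEN mp])
    qed
    finally show ?thesis .
  qed
  then show ?thesis using False by (simp add: ell_le_def)
qed

lemma ell_le_indicator:
  fixes \<delta> :: real
  assumes p: "1 \<le> p" and "finite F" "0 \<le> \<delta>"
  shows "ell_le p \<Lambda> (\<lambda>i. if i \<in> F then \<delta> else 0) (card F * \<delta>)"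
  using assms(2)
proof (induction F)
  case empty
  show ?case by (rule ell_le_single[OF p]) auto
next
  case (insert j F)
  have "ell_le p \<Lambda> (\<lambda>i. if i = j then \<delta> else 0) \<delta>"
    by (rule ell_le_single[OF p, of _ j]) (use assms in auto)
  from ell_le_add[OF p this insert.IH] assms(3)
  have "ell_le p \<Lambda> (\<lambda>i. (if i = j then \<delta> else 0) + (if i \<in> F then \<delta> else 0)) (\<delta> + card F * \<delta>)" by simp
  then show ?case
    by (rule ell_le_mono[OF p]) (use insert.hyps assms(3) in \<open>auto simp: algebra_simps\<close>)
qed

section \<open>The induced operator\<close>

locale op_family = X: space_family K \<Lambda> X p + Y: space_family K \<Lambda> Y p
  for K \<Lambda> and X :: "'i \<Rightarrow> 'a normed" and Y :: "'i \<Rightarrow> 'b normed" and p +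
  fixes A :: "'i \<Rightarrow> 'a \<Rightarrow> 'b"
  assumes ops: "\<And>i. i \<in> \<Lambda> \<Longrightarrow> bounded_op K (X i) (Y i) (A i)"
    and bdd: "bdd_above ((\<lambda>i. opnorm (X i) (Y i) (A i)) ` \<Lambda>)"
begin

abbreviation S where "S \<equiv> direct_sum p \<Lambda> X"

abbreviation T where "T \<equiv> induced_op \<Lambda> A"

abbreviation opn where "opn i \<equiv> opnorm (X i) (Y i) (A i)"

definition coord_nrm :: "('i \<Rightarrow> 'a) \<Rightarrow> 'i \<Rightarrow> real" where
  "coord_nrm z i = nrm (Y i) (A i (z i))"

lemma coord_nrm_le: "z \<in> carrier S \<Longrightarrow> i \<in> \<Lambda> \<Longrightarrow> coord_nrm z i \<le> opn i * nrm (X i) (z i)"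
  and coord_nrm_nonneg: "z \<in> carrier S \<Longrightarrow> i \<in> \<Lambda> \<Longrightarrow> 0 \<le> coord_nrm z i"
  and A_carrier: "z \<in> carrier S \<Longrightarrow> i \<in> \<Lambda> \<Longrightarrow> A i (z i) \<in> carrier (Y i)"
proof -
  assume z: "z \<in> carrier S" and i: "i \<in> \<Lambda>"
  show c: "A i (z i) \<in> carrier (Y i)" using bounded_opD(1)[OF ops[OF i]] X.sum_carrier[OF z i] .
  show "coord_nrm z i \<le> opn i * nrm (X i) (z i)"
    unfolding coord_nrm_def by (rule opnorm_le[OF X.spaces[OF i] Y.spaces[OF i] ops[OF i] X.sum_carrier[OF z i]])
  show "0 \<le> coord_nrm z i"
    unfolding coord_nrm_def using normed_space.nrm_nonneg[OF Y.spaces[OF i] c] .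
qed

lemma induced_carrier: "z \<in> carrier S \<Longrightarrow> T z \<in> carrier Y.Z"
  and induced_nrm_bound: "\<exists>C. \<forall>z\<in>carrier S. nrm Y.Z (T z) \<le> C * nrm S z"
proof -
  obtain C where C: "\<And>i. i \<in> \<Lambda> \<Longrightarrow> opn i \<le> C" using bdd unfolding bdd_above_def by auto
  obtain i where "i \<in> \<Lambda>" using X.ne by blast
  then have C0: "0 \<le> C"
    using C[of i] opnorm_nonneg[OF X.spaces Y.spaces ops, of i] by simp
  have *: "T z \<in> carrier Y.Z \<and> nrm Y.Z (T z) \<le> C * nrm S z" if z: "z \<in> carrier S" for z
  proof -
    have "ell_le p \<Lambda> (\<lambda>i. C * X.nrms z i) (\<bar>C\<bar> * nrm S z)"
      by (intro ell_le_scale X.p X.sum_nrm_ell_le z)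
    then have le: "ell_le p \<Lambda> (Y.nrms (T z)) (C * nrm S z)"
    proof (rule ell_le_mono[OF X.p])
      fix i assume i: "i \<in> \<Lambda>"
      have n: "0 \<le> X.nrms z i" using normed_space.nrm_nonneg[OF X.spaces[OF i] X.sum_carrier[OF z i]] .
      have "coord_nrm z i \<le> C * X.nrms z i"
        using coord_nrm_le[OF z i] mult_right_mono[OF C[OF i] n] by linarith
      then show "i \<in> \<Lambda> \<and> \<bar>Y.nrms (T z) i\<bar> \<le> \<bar>C * X.nrms z i\<bar>"
        using i coord_nrm_nonneg[OF z i] n C0 by (simp add: induced_op_def coord_nrm_def abs_mult)
    qed (use C0 X.sum_nrm_nonneg[OF z] in auto)
    have nn: "0 \<le> C * nrm S z" using C0 X.sum_nrm_nonneg[OF z] by simp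
    have "T z \<in> (\<Pi>\<^sub>E i\<in>\<Lambda>. carrier (Y i))" using A_carrier[OF z] by (auto simp: induced_op_def)
    then have c: "T z \<in> carrier Y.Z" using le nn by (rule Y.sum_carrierI)
    then show ?thesis using Y.sum_nrm_le[OF c nn] le by simp
  qed
  then show "\<exists>C. \<forall>z\<in>carrier S. nrm Y.Z (T z) \<le> C * nrm S z" by blast
  show "z \<in> carrier S \<Longrightarrow> T z \<in> carrier Y.Z" using * by blast
qed

lemma bounded_op_induced: "bounded_op K S Y.Z T"
  unfolding bounded_op_def
proof (intro conjI ballI induced_nrm_bound)
  show "T \<in> carrier S \<rightarrow> carrier Y.Z" using induced_carrier by blast
  fix x assume x: "x \<in> carrier S"
  show "T (x \<oplus>\<^bsub>S\<^esub> y) = T x \<oplus>\<^bsub>Y.Z\<^esub> T y" if y: "y \<in> carrier S" for y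
    unfolding X.sum_sel Y.sum_sel induced_op_def
  proof (rule restrict_ext)
    fix i assume i: "i \<in> \<Lambda>"
    show "A i ((\<lambda>i\<in>\<Lambda>. x i \<oplus>\<^bsub>X i\<^esub> y i) i) = (\<lambda>i\<in>\<Lambda>. A i (x i)) i \<oplus>\<^bsub>Y i\<^esub> (\<lambda>i\<in>\<Lambda>. A i (y i)) i"
      using i bounded_opD(2)[OF ops[OF i] X.sum_carrier[OF x i] X.sum_carrier[OF y i]] by simp
  qed
  show "T (a \<odot>\<^bsub>S\<^esub> x) = a \<odot>\<^bsub>Y.Z\<^esub> T x" if a: "a \<in> K" for a
    unfolding X.sum_sel Y.sum_sel induced_op_def
  proof (rule restrict_ext)
    fix i assume i: "i \<in> \<Lambda>"
    show "A i ((\<lambda>i\<in>\<Lambda>. a \<odot>\<^bsub>X i\<^esub> x i) i) = a \<odot>\<^bsub>Y i\<^esub> (\<lambda>i\<in>\<Lambda>. A i (x i)) i"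
      using i bounded_opD(3)[OF ops[OF i] X.sum_carrier[OF x i] a] by simp
  qed
qed

text \<open>The criterion for summable Szlenk index, written in coordinates. With
  \<open>0 \<le> s\<close>, the condition \<open>ell_le\<close> is equivalent to the norm
  bound.\<close>

definition ev_bound :: "real \<Rightarrow> bool" where
  "ev_bound s \<longleftrightarrow> 0 \<le> s \<and> (\<forall>n. ev_sum K S n (\<lambda>z. ell_le p \<Lambda> (coord_nrm z) s) \<zero>\<^bsub>S\<^esub>)"

lemma nrm_induced_le:
  assumes z: "z \<in> carrier S" and s: "0 \<le> s"
  shows "nrm Y.Z (T z) \<le> s \<longleftrightarrow> ell_le p \<Lambda> (coord_nrm z) s"
proof -
  have eq: "Y.nrms (T z) i = coord_nrm z i" if "i \<in> \<Lambda>" for i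
    using that by (simp add: induced_op_def coord_nrm_def)
  have "ell_le p \<Lambda> (Y.nrms (T z)) s \<longleftrightarrow> ell_le p \<Lambda> (coord_nrm z) s"
  proof
    show "ell_le p \<Lambda> (coord_nrm z) s" if "ell_le p \<Lambda> (Y.nrms (T z)) s"
      by (rule ell_le_mono[OF X.p that s]) (use eq in auto)
    show "ell_le p \<Lambda> (Y.nrms (T z)) s" if "ell_le p \<Lambda> (coord_nrm z) s"
      by (rule ell_le_mono[OF X.p that s]) (use eq in auto)
  qed
  then show ?thesis using Y.sum_nrm_le[OF induced_carrier[OF z] s] by simp
qed

lemma op_summable_iff_ev_bound: "op_summable_szlenk K S Y.Z T \<longleftrightarrow> (\<exists>s. ev_bound s)"
proof -
  have "op_summable_szlenk K S Y.Z T \<longleftrightarrow> (\<exists>s. \<forall>n. ev_sum K S n (\<lambda>z. nrm Y.Z (T z) \<le> s) \<zero>\<^bsub>S\<^esub>)"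
    by (rule op_summable_szlenk_iff_ev_sum[OF X.normed_space_sum Y.normed_space_sum bounded_op_induced])
  also have "\<dots> \<longleftrightarrow> (\<exists>s. ev_bound s)"
  proof (intro iffI; elim exE)
    fix s assume s: "\<forall>n. ev_sum K S n (\<lambda>z. nrm Y.Z (T z) \<le> s) \<zero>\<^bsub>S\<^esub>"
    from spec[OF this, of 0] have s0: "0 \<le> s"
      using bounded_op_zero(2)[OF X.normed_space_sum Y.normed_space_sum bounded_op_induced] by simp
    have "ev_sum K S n (\<lambda>z. ell_le p \<Lambda> (coord_nrm z) s) \<zero>\<^bsub>S\<^esub>" for n
      by (rule X.Z.ev_sum_mono[OF spec[OF s]]) (use nrm_induced_le s0 in auto)
    then show "\<exists>s. ev_bound s" using s0 unfolding ev_bound_def by blast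
  next
    fix s assume s: "ev_bound s"
    have "ev_sum K S n (\<lambda>z. nrm Y.Z (T z) \<le> s) \<zero>\<^bsub>S\<^esub>" for n
    proof (rule X.Z.ev_sum_mono)
      show "ev_sum K S n (\<lambda>z. ell_le p \<Lambda> (coord_nrm z) s) \<zero>\<^bsub>S\<^esub>" using s by (simp add: ev_bound_def)
    qed (use nrm_induced_le s in \<open>auto simp: ev_bound_def\<close>)
    then show "\<exists>s. \<forall>n. ev_sum K S n (\<lambda>z. nrm Y.Z (T z) \<le> s) \<zero>\<^bsub>S\<^esub>" by blast
  qed
  finally show ?thesis .
qed

section \<open>Sufficiency: the sum is controlled by its coordinates\<close>

abbreviation Sig where "Sig i \<equiv> Sigma_op K (X i) (Y i) (A i)"

text \<open>To the norm \<open>s\<close> of the family of \<open>Sig\<close> values 1 is added: one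
  half pays for the surplus \<open>\<delta>\<close> on the finite set \<open>F\<close> of large
  operators, the other for the remaining coordinates. \<open>F\<close> depends on \<open>n\<close>,
  but \<open>s + 1\<close> does not.\<close>

lemma ev_bound_if_Sigma:
  assumes c0: "opn \<in> c_zero \<Lambda>" and fin: "\<And>i. i \<in> \<Lambda> \<Longrightarrow> Sig i < \<infinity>"
    and ell: "(\<lambda>i. real_of_ereal (Sig i)) \<in> ell p \<Lambda>"
  shows "\<exists>s. ev_bound s"
proof -
  define R where "R i = real_of_ereal (Sig i)" for i
  define s where "s = ell_norm p \<Lambda> R"
  have R: "Sig i = ereal (R i)" "0 \<le> R i" if "i \<in> \<Lambda>" for i
    using fin[OF that] Sigma_op_nonneg[of K "X i" "Y i" "A i"] unfolding R_def
    by (cases "Sig i"; auto)+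
  have ellR: "ell_le p \<Lambda> R s" and s0: "0 \<le> s"
    using ell_le_ell_norm[OF X.p X.ne] ell_norm_nonneg[OF X.p X.ne] ell by (auto simp: s_def R_def[abs_def])
  have "ev_sum K S n (\<lambda>z. ell_le p \<Lambda> (coord_nrm z) (s + 1)) \<zero>\<^bsub>S\<^esub>" for n
  proof -
    \<comment> \<open>After \<open>n\<close> moves the sum has norm at most \<open>n\<close>, so the
      coordinates with operator norm below \<open>\<eta>\<close> contribute at most 1/2.\<close>
    define \<eta> :: real where "\<eta> = 1 / (2 * (real n + 1))"
    define F where "F = {i \<in> \<Lambda>. \<eta> \<le> \<bar>opn i\<bar>}"
    \<comment> \<open>Chosen after \<open>F\<close>: a strict excess over each \<open>Sig i\<close>
      is needed to get an eventual bound, and all of them together cost at most 1/2.\<close>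
    define \<delta> :: real where "\<delta> = 1 / (2 * (real (card F) + 1))"
    have \<eta>: "\<eta> > 0" "\<eta> * n \<le> 1/2" by (auto simp: \<eta>_def field_simps)
    have \<delta>: "\<delta> > 0" "card F * \<delta> \<le> 1/2" by (auto simp: \<delta>_def field_simps)
    have F: "finite F" "F \<subseteq> \<Lambda>" using c0 \<eta>(1) by (auto simp: c_zero_def F_def)
    have "ev_sum K S n (\<lambda>z. coord_nrm z i \<le> R i + \<delta>) \<zero>\<^bsub>S\<^esub>" if iF: "i \<in> F" for i
    proof -
      have i: "i \<in> \<Lambda>" using iF F by blast
      interpret Xi: normed_space K "X i" using X.spaces[OF i] .
      have ev: "ev_sum K (X i) n (\<lambda>z. nrm (Y i) (A i z) \<le> R i + \<delta>) \<zero>\<^bsub>X i\<^esub>"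
        by (rule ev_sum_if_Sigma_op[OF X.spaces[OF i]])
          (use R[OF i] \<delta>(1) bounded_op_zero(2)[OF X.spaces[OF i] Y.spaces[OF i] ops[OF i]] in auto)
      \<comment> \<open>Pulled back along the projections, the conditions of different coordinates
        concern the same moves and can be combined.\<close>
      have "ev_sum K S n (\<lambda>z. nrm (Y i) (A i (\<zero>\<^bsub>X i\<^esub> \<oplus>\<^bsub>X i\<^esub> z i)) \<le> R i + \<delta>) \<zero>\<^bsub>S\<^esub>"
      proof (rule ev_sum_push[OF X.normed_space_sum X.spaces[OF i]])
        show "filterlim (\<lambda>z. z i) (wk K (X i)) (wk K S)"
          by (intro filterlim_wk_bounded_op X.normed_space_sum X.spaces X.bounded_op_proj X.proj_unit_ball i)
        show "(\<lambda>z. z i) \<in> carrier S \<rightarrow> carrier (X i)" using X.sum_carrier i by auto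
        show "(x \<oplus>\<^bsub>S\<^esub> y) i = x i \<oplus>\<^bsub>X i\<^esub> y i" for x y using i by (simp add: X.sum_sel)
        show "ev_sum K (X i) n (\<lambda>z. nrm (Y i) (A i z) \<le> R i + \<delta>) (\<zero>\<^bsub>X i\<^esub> \<oplus>\<^bsub>X i\<^esub> \<zero>\<^bsub>S\<^esub> i)"
          using ev i by (simp add: X.sum_sel)
      qed (use X.sum_zero_carrier in auto)
      then show ?thesis
        by (rule X.Z.ev_sum_mono) (use X.sum_zero_carrier X.sum_carrier i in \<open>auto simp: coord_nrm_def\<close>)
    qed
    then have "ev_sum K S n (\<lambda>z. \<forall>i\<in>F. coord_nrm z i \<le> R i + \<delta>) \<zero>\<^bsub>S\<^esub>"
      by (intro X.Z.ev_sum_ball_finite F X.sum_zero_carrier)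
    from X.Z.ev_sum_conj[OF this X.Z.ev_sum_nrm[OF X.sum_zero_carrier]]
    show ?thesis
    proof (rule X.Z.ev_sum_mono[OF _ X.sum_zero_carrier], elim conjE)
      fix z assume z: "z \<in> carrier S" and le: "\<forall>i\<in>F. coord_nrm z i \<le> R i + \<delta>"
        and "nrm S z \<le> nrm S \<zero>\<^bsub>S\<^esub> + real n"
      then have zn: "nrm S z \<le> n" by simp
      have "ell_le p \<Lambda> (\<lambda>i. \<eta> * X.nrms z i) (\<bar>\<eta>\<bar> * nrm S z)"
        by (intro ell_le_scale X.p X.sum_nrm_ell_le z)
      then have small: "ell_le p \<Lambda> (\<lambda>i. \<eta> * X.nrms z i) (\<eta> * nrm S z)" using \<eta> by simp
      have sum: "ell_le p \<Lambda> (\<lambda>i. R i + (if i \<in> F then \<delta> else 0)) (s + card F * \<delta>)"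
        using ell_le_add[OF X.p ellR ell_le_indicator[OF X.p F(1), of \<delta>] s0] \<delta>(1) by simp
      have "ell_le p \<Lambda> (\<lambda>i. (R i + (if i \<in> F then \<delta> else 0)) + \<eta> * X.nrms z i) ((s + card F * \<delta>) + \<eta> * nrm S z)"
        using \<delta>(1) \<eta>(1) s0 X.sum_nrm_nonneg[OF z] by (intro ell_le_add[OF X.p sum small]) simp_all
      then show "ell_le p \<Lambda> (coord_nrm z) (s + 1)"
      proof (rule ell_le_mono[OF X.p])
        show "0 \<le> s + card F * \<delta> + \<eta> * nrm S z"
          using \<delta>(1) \<eta>(1) s0 X.sum_nrm_nonneg[OF z] by simp
        have "\<eta> * nrm S z \<le> \<eta> * n" using zn \<eta>(1) by (intro mult_left_mono) auto
        then show "s + card F * \<delta> + \<eta> * nrm S z \<le> s + 1" using \<eta>(2) \<delta>(2) by linarith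
        fix i assume i: "i \<in> \<Lambda>"
        have n: "0 \<le> X.nrms z i" using normed_space.nrm_nonneg[OF X.spaces[OF i] X.sum_carrier[OF z i]] .
        have "coord_nrm z i \<le> (R i + (if i \<in> F then \<delta> else 0)) + \<eta> * X.nrms z i"
        proof (cases "i \<in> F")
          case True
          moreover have "0 \<le> \<eta> * X.nrms z i" using n \<eta>(1) by simp
          ultimately show ?thesis using le by force
        next
          case False
          then have "opn i \<le> \<eta>" using i by (auto simp: F_def)
          then have "opn i * X.nrms z i \<le> \<eta> * X.nrms z i" using n by (rule mult_right_mono)
          then show ?thesis using coord_nrm_le[OF z i] False R(2)[OF i] by simp
        qed
        then show "i \<in> \<Lambda> \<and> \<bar>coord_nrm z i\<bar> \<le> \<bar>(R i + (if i \<in> F then \<delta> else 0)) + \<eta> * X.nrms z i\<bar>"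
          using i coord_nrm_nonneg[OF z i] by simp
      qed
    qed
  qed
  then have "ev_bound (s + 1)" using s0 by (simp add: ev_bound_def)
  then show ?thesis ..
qed

section \<open>Necessity: the values of \<open>Sig\<close> form a family in
  \<open>ell\<close>\<close>

lemma emb_add:
  assumes z: "z \<in> carrier S" and j: "j \<in> \<Lambda>" and y: "y \<in> carrier (X j)" and i: "i \<in> \<Lambda>"
  shows "(z \<oplus>\<^bsub>S\<^esub> X.emb j y) i = (if i = j then z j \<oplus>\<^bsub>X j\<^esub> y else z i)"
proof -
  interpret normed_space K "X i" using X.spaces[OF i] .
  show ?thesis using i X.sum_carrier[OF z i] by (simp add: X.sum_sel X.emb_def)
qed

text \<open>Levels devoted to one coordinate after the other make all coordinates large at once.\<close>

lemma ev_sum_large_coordinates: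
  assumes "finite F" "F \<subseteq> \<Lambda>" "\<And>i. i \<in> F \<Longrightarrow> \<not> ev_sum K (X i) (n i) (\<lambda>y. nrm (Y i) (A i y) \<le> r i) \<zero>\<^bsub>X i\<^esub>"
    and "ev_sum K S (sum n F) Q \<zero>\<^bsub>S\<^esub>"
  shows "\<exists>z\<in>carrier S. (\<forall>i\<in>\<Lambda> - F. z i = \<zero>\<^bsub>X i\<^esub>) \<and> (\<forall>i\<in>F. r i < coord_nrm z i) \<and> Q z"
  using assms
proof (induction F arbitrary: Q)
  case empty
  then show ?case using X.sum_zero_carrier by (intro bexI[of _ "\<zero>\<^bsub>S\<^esub>"]) (auto simp: X.sum_sel)
next
  case (insert j F)
  have j: "j \<in> \<Lambda>" using insert.prems by simp
  interpret Xj: normed_space K "X j" using X.spaces[OF j] .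
  \<comment> \<open>The levels of \<open>F\<close> are played before those of \<open>j\<close>, so
    the vector found for \<open>F\<close> still carries \<open>n j\<close> levels.\<close>
  have "ev_sum K S (sum n F) (ev_sum K S (n j) Q) \<zero>\<^bsub>S\<^esub>"
    using insert.prems(3) insert.hyps by (simp add: add.commute flip: ev_sum_add)
  from insert.IH[OF _ _ this] insert.prems obtain z where z: "z \<in> carrier S"
    "\<forall>i\<in>\<Lambda> - F. z i = \<zero>\<^bsub>X i\<^esub>" "\<forall>i\<in>F. r i < coord_nrm z i" and ev: "ev_sum K S (n j) Q z" by blast
  have emb0: "X.emb j \<zero>\<^bsub>X j\<^esub> = \<zero>\<^bsub>S\<^esub>"
    by (auto simp: X.emb_def X.sum_sel)
  have "ev_sum K (X j) (n j) (\<lambda>y. Q (z \<oplus>\<^bsub>S\<^esub> X.emb j y)) \<zero>\<^bsub>X j\<^esub>"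
  proof (rule ev_sum_push[OF X.spaces[OF j] X.normed_space_sum])
    show "filterlim (X.emb j) (wk K S) (wk K (X j))"
      by (rule filterlim_wk_bounded_op[OF X.spaces[OF j] X.normed_space_sum X.bounded_op_emb[OF j] X.emb_unit_ball[OF j]])
    show "X.emb j \<in> carrier (X j) \<rightarrow> carrier S" using X.emb_carrier(1)[OF j] by blast
    show "X.emb j (x \<oplus>\<^bsub>X j\<^esub> y) = X.emb j x \<oplus>\<^bsub>S\<^esub> X.emb j y" if "x \<in> carrier (X j)" "y \<in> carrier (X j)" for x y
      using bounded_opD(2)[OF X.bounded_op_emb[OF j] that] .
    show "ev_sum K S (n j) Q (z \<oplus>\<^bsub>S\<^esub> X.emb j \<zero>\<^bsub>X j\<^esub>)" using ev z(1) by (simp add: emb0)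
  qed (use z in auto)
  moreover have "\<not> ev_sum K (X j) (n j) (\<lambda>y. nrm (Y j) (A j y) \<le> r j) \<zero>\<^bsub>X j\<^esub>"
    using insert.prems(2) by simp
  \<comment> \<open>The inherited eventuality meets the failure of the bound \<open>r j\<close>. The
    move affects no other coordinate, so what was achieved on \<open>F\<close> persists.\<close>
  ultimately obtain y where y: "y \<in> carrier (X j)" "Q (z \<oplus>\<^bsub>S\<^esub> X.emb j y)" "\<not> nrm (Y j) (A j y) \<le> r j"
    by (rule Xj.ev_sum_witness) auto
  let ?z = "z \<oplus>\<^bsub>S\<^esub> X.emb j y"
  have zj: "z j = \<zero>\<^bsub>X j\<^esub>" using z(2) j insert.hyps by simp
  have coord: "?z i = (if i = j then y else z i)" if "i \<in> \<Lambda>" for i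
    using emb_add[OF z(1) j y(1) that] zj y(1) by simp
  have "\<forall>i\<in>\<Lambda> - insert j F. ?z i = \<zero>\<^bsub>X i\<^esub>" using coord z(2) by simp
  moreover have "\<forall>i\<in>insert j F. r i < coord_nrm ?z i"
    using coord j insert.prems(1) insert.hyps z(3) y(3) by (auto simp: coord_nrm_def)
  moreover have "?z \<in> carrier S" using X.sum_add[OF z(1) X.emb_carrier(1)[OF j y(1)]] by blast
  ultimately show ?case using y(2) by blast
qed

text \<open>For each \<open>i \<in> F\<close> some number of levels refutes the bound
  \<open>r i\<close>. Played in succession, they produce a single vector that exceeds every
  \<open>r i\<close> and yet obeys the bound \<open>s\<close> of the sum.\<close>

lemma ell_le_below_Sigma:
  assumes s: "ev_bound s" and F: "finite F" "F \<subseteq> \<Lambda>"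
    and r: "\<And>i. i \<in> F \<Longrightarrow> 0 \<le> r i" "\<And>i. i \<in> F \<Longrightarrow> ereal (r i) < Sig i"
  shows "ell_le p F r s"
proof -
  have "\<exists>n. \<not> ev_sum K (X i) n (\<lambda>y. nrm (Y i) (A i y) \<le> r i) \<zero>\<^bsub>X i\<^esub>" if i: "i \<in> F" for i
  proof (rule ccontr)
    have iL: "i \<in> \<Lambda>" using i F by blast
    interpret Xi: normed_space K "X i" using X.spaces[OF iL] .
    assume "\<not> ?thesis"
    then have ev: "ev_sum K (X i) n (\<lambda>y. nrm (Y i) (A i y) \<le> r i) \<zero>\<^bsub>X i\<^esub>" for n by blast
    \<comment> \<open>\<open>Sigma_op_leI\<close> asks for a positive bound, whereas
      \<open>r i\<close> may be zero.\<close>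
    obtain q where q: "ereal (r i) < ereal q" "ereal q < Sig i"
      using ereal_dense2[OF r(2)[OF i]] by blast
    have "ev_sum K (X i) n (\<lambda>y. nrm (Y i) (A i y) \<le> q) \<zero>\<^bsub>X i\<^esub>" for n
      by (rule Xi.ev_sum_mono[OF ev]) (use q in auto)
    then have "Sig i \<le> ereal q"
      using r(1)[OF i] q(1) by (intro Sigma_op_leI[OF X.spaces[OF iL]]) auto
    with q(2) show False by simp
  qed
  then obtain n where n: "\<And>i. i \<in> F \<Longrightarrow> \<not> ev_sum K (X i) (n i) (\<lambda>y. nrm (Y i) (A i y) \<le> r i) \<zero>\<^bsub>X i\<^esub>"
    by metis
  have "ev_sum K S (sum n F) (\<lambda>z. ell_le p \<Lambda> (coord_nrm z) s) \<zero>\<^bsub>S\<^esub>" using s by (simp add: ev_bound_def)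
  from ev_sum_large_coordinates[OF F n this] obtain z where
    z: "\<forall>i\<in>F. r i < coord_nrm z i" "ell_le p \<Lambda> (coord_nrm z) s" by auto
  show ?thesis
  proof (rule ell_le_mono[OF X.p z(2)])
    show "0 \<le> s" using s by (simp add: ev_bound_def)
    show "i \<in> \<Lambda> \<and> \<bar>r i\<bar> \<le> \<bar>coord_nrm z i\<bar>" if "i \<in> F" for i
      using r(1)[OF that] bspec[OF z(1) that] F(2) that by auto
  qed simp
qed

lemma Sigma_if_ev_bound:
  assumes s: "ev_bound s"
  shows "\<forall>i\<in>\<Lambda>. Sig i < \<infinity>" and "(\<lambda>i. real_of_ereal (Sig i)) \<in> ell p \<Lambda>"
proof -
  have s0: "0 \<le> s" using s by (simp add: ev_bound_def)
  show fin: "\<forall>i\<in>\<Lambda>. Sig i < \<infinity>"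
  proof
    fix i assume i: "i \<in> \<Lambda>"
    show "Sig i < \<infinity>"
    proof (rule ccontr)
      assume "\<not> Sig i < \<infinity>"
      \<comment> \<open>An infinite value lies above every real number, in particular above
        \<open>s + 1\<close>.\<close>
      then have "ell_le p {i} (\<lambda>_. s + 1) s"
        using i s0 by (intro ell_le_below_Sigma[OF s]) auto
      from ell_le_coord[OF X.p this s0, of i] show False using s0 by simp
    qed
  qed
  define R where "R i = real_of_ereal (Sig i)" for i
  have R: "Sig i = ereal (R i)" "0 \<le> R i" if "i \<in> \<Lambda>" for i
    using bspec[OF fin that] Sigma_op_nonneg[of K "X i" "Y i" "A i"] unfolding R_def
    by (cases "Sig i"; auto)+
  \<comment> \<open>Halving provides numbers strictly below \<open>R i\<close> wherever
    \<open>R i > 0\<close>, at the price of a factor 2 in the norm.\<close>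
  have "ell_le p \<Lambda> (\<lambda>i. R i / 2) s"
  proof (rule ell_le_finite_subsets[OF X.p])
    fix F assume F: "finite F" "F \<subseteq> \<Lambda>"
    have "ell_le p {i \<in> F. R i / 2 > 0} (\<lambda>i. R i / 2) s"
      using F R by (intro ell_le_below_Sigma[OF s]) auto
    then show "ell_le p F (\<lambda>i. R i / 2) s"
    proof (rule ell_le_positive_part[OF X.p])
      show "0 \<le> R i / 2" if "i \<in> F" for i using R(2)[of i] F that by auto
    qed (use s0 in auto)
  qed
  from ell_le_scale[OF X.p this, of 2] have "ell_le p \<Lambda> R (2 * s)" by simp
  then have "R \<in> ell p \<Lambda>" using ell_le_iff[OF X.p X.ne, of "2 * s" R] s0 by simp
  then show "(\<lambda>i. real_of_ereal (Sig i)) \<in> ell p \<Lambda>" by (simp add: R_def[abs_def])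
qed

section \<open>Necessity: the operator norms vanish at infinity\<close>

context
  fixes e :: "'i \<Rightarrow> 'a"
begin

definition block :: "'i set \<Rightarrow> 'i \<Rightarrow> 'a" where
  "block D = (\<lambda>i\<in>\<Lambda>. if i \<in> D then e i else \<zero>\<^bsub>X i\<^esub>)"

text \<open>The move is half the difference of two disjoint blocks. It adds half of \<open>e\<close>
  on \<open>D a\<close>; the coordinates in \<open>D b\<close>, where it subtracts, are given
  up.\<close>

lemma ev_block:
  assumes D: "\<And>k. block (D k) \<in> unit_ball S" "\<And>k. D k \<subseteq> \<Lambda>" "\<And>a b :: nat. a \<noteq> b \<Longrightarrow> D a \<inter> D b = {}"
    and z: "z \<in> carrier S" and Q: "\<forall>\<^sub>F x in wk K S. Q (z \<oplus>\<^bsub>S\<^esub> x)"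
  shows "\<exists>z'\<in>carrier S. \<exists>a b. a \<noteq> b \<and> Q z' \<and> (\<forall>i\<in>D a. z' i = z i \<oplus>\<^bsub>X i\<^esub> ((1/2) \<odot>\<^bsub>X i\<^esub> e i)) \<and>
    (\<forall>i\<in>\<Lambda> - (D a \<union> D b). z' i = z i)"
proof -
  obtain a b where ab: "a \<noteq> b" "Q (z \<oplus>\<^bsub>S\<^esub> (1/2) \<odot>\<^bsub>S\<^esub> (block (D a) \<ominus>\<^bsub>S\<^esub> block (D b)))"
    using X.Z.ev_half_difference[of "\<lambda>k. block (D k)", OF D(1) Q] by blast
  have c: "block (D k) \<in> carrier S" for k using D(1) X.Z.unit_ball_carrier by blast
  have K: "1/2 \<in> K" "- 1 \<in> K" using X.Z.K_simps(4)[of "1/2"] X.Z.K_simps by simp_all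
  let ?x = "(1/2) \<odot>\<^bsub>S\<^esub> (block (D a) \<ominus>\<^bsub>S\<^esub> block (D b))"
  have x: "?x \<in> carrier S" using c K by simp
  have coord: "?x i = (1/2) \<odot>\<^bsub>X i\<^esub> (block (D a) i \<ominus>\<^bsub>X i\<^esub> block (D b) i)" if i: "i \<in> \<Lambda>" for i
  proof -
    interpret Xi: normed_space K "X i" using X.spaces[OF i] .
    show ?thesis
      unfolding a_minus_def X.Z.neg_eq_smult[OF c] Xi.neg_eq_smult[OF X.sum_carrier[OF c i]] X.sum_sel
      using i by simp
  qed
  show ?thesis
  proof (intro bexI exI conjI ballI)
    show "z \<oplus>\<^bsub>S\<^esub> ?x \<in> carrier S" using z x by simp
    fix i
    show "(z \<oplus>\<^bsub>S\<^esub> ?x) i = z i \<oplus>\<^bsub>X i\<^esub> ((1/2) \<odot>\<^bsub>X i\<^esub> e i)" if iD: "i \<in> D a"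
    proof -
      have i: "i \<in> \<Lambda>" "i \<notin> D b" using iD D(2)[of a] D(3)[OF ab(1)] by auto
      interpret Xi: normed_space K "X i" using X.spaces[OF i(1)] .
      have "block (D a) i = e i" using i iD by (simp add: block_def)
      then have "e i \<in> carrier (X i)" using X.sum_carrier[OF c i(1), of a] by simp
      then have "?x i = (1/2) \<odot>\<^bsub>X i\<^esub> e i"
        using coord[OF i(1)] i iD by (simp add: block_def a_minus_def Xi.neg_zero)
      then show ?thesis using i by (simp add: X.sum_sel(2))
    qed
    show "(z \<oplus>\<^bsub>S\<^esub> ?x) i = z i" if "i \<in> \<Lambda> - (D a \<union> D b)"
    proof -
      have i: "i \<in> \<Lambda>" "i \<notin> D a" "i \<notin> D b" using that by auto
      interpret Xi: normed_space K "X i" using X.spaces[OF i(1)] .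
      have "?x i = \<zero>\<^bsub>X i\<^esub>"
        using coord[OF i(1)] i Xi.smult_r_null[of "1/2"] K by (simp add: block_def a_minus_def Xi.neg_zero)
      then show ?thesis using i X.sum_carrier[OF z i(1)] by (simp add: X.sum_sel(2))
    qed
  qed (rule ab)+
qed

text \<open>An infinite reserve \<open>E\<close> on which \<open>z\<close> still vanishes feeds the
  next move. Each move consumes two of its coordinates: one joins \<open>G\<close>, the other
  carries the unwanted negative part and is discarded.\<close>

lemma ev_sum_disjoint_singles:
  assumes E0: "E0 \<subseteq> \<Lambda>" "infinite E0" and e: "\<And>i. i \<in> E0 \<Longrightarrow> e i \<in> unit_ball (X i)"
    and Q: "ev_sum K S n Q \<zero>\<^bsub>S\<^esub>"
  shows "\<exists>z\<in>carrier S. \<exists>G E. finite G \<and> card G = n \<and> G \<subseteq> E0 \<and> E \<subseteq> E0 - G \<and> infinite E \<and>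
    (\<forall>i\<in>G. z i = (1/2) \<odot>\<^bsub>X i\<^esub> e i) \<and> (\<forall>i\<in>E. z i = \<zero>\<^bsub>X i\<^esub>) \<and> Q z"
  using Q
proof (induction n arbitrary: Q)
  case 0
  then show ?case
    using E0 X.sum_zero_carrier
    by (intro bexI[of _ "\<zero>\<^bsub>S\<^esub>"] exI[of _ "{}"] exI[of _ E0]) (auto simp: X.sum_sel)
next
  case (Suc n)
  from Suc.IH[OF Suc.prems[unfolded ev_sum_Suc]] obtain z G E where z: "z \<in> carrier S"
    and G: "finite G" "card G = n" "G \<subseteq> E0" and E: "E \<subseteq> E0 - G" "infinite E"
    and zG: "\<forall>i\<in>G. z i = (1/2) \<odot>\<^bsub>X i\<^esub> e i" and zE: "\<forall>i\<in>E. z i = \<zero>\<^bsub>X i\<^esub>"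
    and Q: "\<forall>\<^sub>F x in wk K S. Q (z \<oplus>\<^bsub>S\<^esub> x)" by auto
  obtain f :: "nat \<Rightarrow> 'i" where f: "inj f" "range f \<subseteq> E" using infinite_countable_subset[OF E(2)] by blast
  have fE: "f k \<in> E" "f k \<in> E0" "f k \<in> \<Lambda>" for k using f E E0 by auto
  have "block {f k} = X.emb (f k) (e (f k))" for k by (auto simp: block_def X.emb_def)
  then have "block {f k} \<in> unit_ball S" for k using X.emb_unit_ball[OF fE(3) e[OF fE(2)]] by simp
  then have "\<exists>z'\<in>carrier S. \<exists>a b. a \<noteq> b \<and> Q z' \<and> (\<forall>i\<in>{f a}. z' i = z i \<oplus>\<^bsub>X i\<^esub> ((1/2) \<odot>\<^bsub>X i\<^esub> e i)) \<and>
    (\<forall>i\<in>\<Lambda> - ({f a} \<union> {f b}). z' i = z i)"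
    by (rule ev_block[OF _ _ _ z Q]) (use fE f(1) in \<open>auto simp: inj_eq\<close>)
  then obtain z' a b where z': "a \<noteq> b" "z' \<in> carrier S" "Q z'"
    "z' (f a) = z (f a) \<oplus>\<^bsub>X (f a)\<^esub> ((1/2) \<odot>\<^bsub>X (f a)\<^esub> e (f a))"
    "\<And>i. i \<in> \<Lambda> \<Longrightarrow> i \<noteq> f a \<Longrightarrow> i \<noteq> f b \<Longrightarrow> z' i = z i"
    by auto
  have "z' (f a) = (1/2) \<odot>\<^bsub>X (f a)\<^esub> e (f a)"
  proof -
    interpret Xi: normed_space K "X (f a)" using X.spaces[OF fE(3)] .
    have "e (f a) \<in> carrier (X (f a))" using e[OF fE(2)] Xi.unit_ball_carrier by blast
    then show ?thesis using z'(4) zE fE(1)[of a] Xi.K_simps(4)[of "1/2"] by simp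
  qed
  moreover have ab: "f a \<notin> G" "f b \<notin> G" using fE E by auto
  moreover have "z' i = z i" if "i \<in> G \<or> i \<in> E - {f a, f b}" for i
    using that ab G(3) E(1) E0(1) by (intro z'(5)) blast+
  ultimately have "finite (insert (f a) G) \<and> card (insert (f a) G) = Suc n \<and> insert (f a) G \<subseteq> E0 \<and>
    E - {f a, f b} \<subseteq> E0 - insert (f a) G \<and> infinite (E - {f a, f b}) \<and>
    (\<forall>i\<in>insert (f a) G. z' i = (1/2) \<odot>\<^bsub>X i\<^esub> e i) \<and> (\<forall>i\<in>E - {f a, f b}. z' i = \<zero>\<^bsub>X i\<^esub>) \<and> Q z'"
    using G E fE(2) zG zE z'(3) by auto
  then show ?case using z'(2) by blast
qed

text \<open>In the supremum norm an infinite block of ball vectors is itself a ball vector. Each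
  move is made inside the infinite set \<open>E\<close> where \<open>z\<close> is a known multiple
  of \<open>e\<close>, and it leaves an infinite subset where that multiple has grown by
  1/2.\<close>

lemma ev_sum_blocks:
  assumes E0: "E0 \<subseteq> \<Lambda>" "infinite E0" and e: "\<And>i. i \<in> E0 \<Longrightarrow> e i \<in> unit_ball (X i)"
    and p: "p = \<infinity>" and Q: "ev_sum K S n Q \<zero>\<^bsub>S\<^esub>"
  shows "\<exists>z\<in>carrier S. \<exists>E. E \<subseteq> E0 \<and> infinite E \<and> (\<forall>i\<in>E. z i = complex_of_real (n / 2) \<odot>\<^bsub>X i\<^esub> e i) \<and> Q z"
  using Q
proof (induction n arbitrary: Q)
  case 0
  have "\<zero>\<^bsub>S\<^esub> i = complex_of_real (real 0 / 2) \<odot>\<^bsub>X i\<^esub> e i" if i: "i \<in> E0" for i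
  proof -
    have iL: "i \<in> \<Lambda>" using i E0 by blast
    interpret Xi: normed_space K "X i" using X.spaces[OF iL] .
    show ?thesis using e[OF i] Xi.unit_ball_carrier Xi.smult_l_null iL by (simp add: X.sum_sel)
  qed
  then show ?case
    using E0 X.sum_zero_carrier 0 by (intro bexI[of _ "\<zero>\<^bsub>S\<^esub>"] exI[of _ E0]) auto
next
  case (Suc n)
  from Suc.IH[OF Suc.prems[unfolded ev_sum_Suc]] obtain z E where z: "z \<in> carrier S"
    and E: "E \<subseteq> E0" "infinite E" and zE: "\<forall>i\<in>E. z i = complex_of_real (n / 2) \<odot>\<^bsub>X i\<^esub> e i"
    and Q: "\<forall>\<^sub>F x in wk K S. Q (z \<oplus>\<^bsub>S\<^esub> x)" by auto
  obtain f :: "nat \<Rightarrow> 'i" where f: "inj f" "range f \<subseteq> E" using infinite_countable_subset[OF E(2)] by blast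
  \<comment> \<open>Pairing of natural numbers splits a countable part of \<open>E\<close> into
    infinitely many disjoint blocks, each infinite so that the retained one can serve for the next
    move.\<close>
  define D where "D k = f ` range (\<lambda>m. prod_encode (k, m))" for k
  have DE: "D k \<subseteq> E" "D k \<subseteq> \<Lambda>" for k using f(2) E E0 by (auto simp: D_def)
  have disj: "D a \<inter> D b = {}" if "a \<noteq> b" for a b
    using that f(1) by (auto simp: D_def inj_eq prod_encode_eq)
  have inf: "infinite (D k)" for k
  proof -
    have "inj (\<lambda>m. f (prod_encode (k, m)))" by (auto intro!: injI dest!: injD[OF f(1)] simp: prod_encode_eq)
    then show ?thesis using finite_imageD[of "\<lambda>m. f (prod_encode (k, m))" UNIV] by (auto simp: D_def image_image)
  qed
  have "block (D k) \<in> unit_ball S" for k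
  proof -
    have b: "block (D k) i \<in> carrier (X i) \<and> \<bar>X.nrms (block (D k)) i\<bar> \<le> 1" if i: "i \<in> \<Lambda>" for i
    proof -
      interpret Xi: normed_space K "X i" using X.spaces[OF i] .
      have "e i \<in> unit_ball (X i)" if "i \<in> D k" using that DE(1)[of k] E e by blast
      then have "block (D k) i \<in> unit_ball (X i)" using i by (simp add: block_def)
      then show ?thesis using Xi.nrm_nonneg by (auto simp: unit_ball_def)
    qed
    have le: "ell_le p \<Lambda> (X.nrms (block (D k))) 1" using p b by (simp add: ell_le_def)
    have c: "block (D k) \<in> carrier S"
      by (rule X.sum_carrierI[OF _ le]) (use b in \<open>auto simp: block_def\<close>)
    then show ?thesis using X.sum_nrm_le[OF c, of 1] le by (simp add: unit_ball_def)
  qed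
  then have "\<exists>z'\<in>carrier S. \<exists>a b. a \<noteq> b \<and> Q z' \<and> (\<forall>i\<in>D a. z' i = z i \<oplus>\<^bsub>X i\<^esub> ((1/2) \<odot>\<^bsub>X i\<^esub> e i)) \<and>
    (\<forall>i\<in>\<Lambda> - (D a \<union> D b). z' i = z i)"
    using DE(2) disj by (intro ev_block z Q)
  then obtain z' a b where z': "z' \<in> carrier S" "Q z'"
    "\<forall>i\<in>D a. z' i = z i \<oplus>\<^bsub>X i\<^esub> ((1/2) \<odot>\<^bsub>X i\<^esub> e i)"
    by (elim bexE exE conjE)
  have "z' i = complex_of_real (real (Suc n) / 2) \<odot>\<^bsub>X i\<^esub> e i" if i: "i \<in> D a" for i
  proof -
    have iE: "i \<in> E" "i \<in> E0" "i \<in> \<Lambda>" using i DE[of a] E by auto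
    interpret Xi: normed_space K "X i" using X.spaces[OF iE(3)] .
    have ei: "e i \<in> carrier (X i)" using e[OF iE(2)] Xi.unit_ball_carrier by blast
    have half: "complex_of_real (1/2) \<in> K" "complex_of_real (real n / 2) \<in> K" by (rule Xi.K_simps)+
    have "z' i = (complex_of_real (real n / 2) + complex_of_real (1/2)) \<odot>\<^bsub>X i\<^esub> e i"
      using bspec[OF z'(3) i] zE iE(1) Xi.smult_l_distr[of "complex_of_real (real n / 2)" "complex_of_real (1/2)" "e i"] half ei
      by simp
    also have "complex_of_real (real n / 2) + complex_of_real (1/2) = complex_of_real (real (Suc n) / 2)"
      by (simp add: field_simps)
    finally show ?thesis .
  qed
  then show ?case using z' DE(1)[of a] E inf by (intro bexI[of _ z'] exI[of _ "D a"]) auto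
qed

end

lemma coord_nrm_smult:
  assumes "i \<in> \<Lambda>" "x \<in> carrier (X i)" "z i = complex_of_real r \<odot>\<^bsub>X i\<^esub> x"
  shows "coord_nrm z i = \<bar>r\<bar> * nrm (Y i) (A i x)"
proof -
  interpret Xi: normed_space K "X i" using X.spaces[OF assms(1)] .
  interpret Yi: normed_space K "Y i" using Y.spaces[OF assms(1)] .
  note b = bounded_opD[OF ops[OF assms(1)] assms(2)]
  show ?thesis
    unfolding coord_nrm_def assms(3) b(3)[OF Xi.K_simps(4)] using Yi.nrm_smult[OF Yi.K_simps(4) b(1)] by simp
qed

text \<open>Operators of norm at least \<open>\<epsilon>\<close> have ball vectors
  \<open>e i\<close> with images larger than \<open>\<epsilon> / 2\<close>, and a move contributes
  half of that. The resulting \<open>\<epsilon> / 4\<close> accumulates in a single coordinate if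
  \<open>p = \<infinity>\<close> and over \<open>n\<close> coordinates otherwise, until it
  contradicts \<open>s\<close>.\<close>

lemma c_zero_if_ev_bound:
  assumes s: "ev_bound s"
  shows "opn \<in> c_zero \<Lambda>"
proof (rule ccontr)
  have s0: "0 \<le> s" using s by (simp add: ev_bound_def)
  assume "opn \<notin> c_zero \<Lambda>"
  then obtain \<epsilon> where \<epsilon>: "\<epsilon> > 0" and inf: "infinite {i \<in> \<Lambda>. \<epsilon> \<le> \<bar>opn i\<bar>}" by (auto simp: c_zero_def)
  define E0 where "E0 = {i \<in> \<Lambda>. \<epsilon> \<le> \<bar>opn i\<bar>}"
  have E0: "E0 \<subseteq> \<Lambda>" "infinite E0" using inf by (auto simp: E0_def)
  have "\<exists>x\<in>unit_ball (X i). \<epsilon> / 2 < nrm (Y i) (A i x)" if "i \<in> E0" for i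
  proof -
    have i: "i \<in> \<Lambda>" "\<epsilon> \<le> \<bar>opn i\<bar>" using that by (auto simp: E0_def)
    then have "\<epsilon> / 2 < opn i"
      using opnorm_nonneg[OF X.spaces[OF i(1)] Y.spaces[OF i(1)] ops[OF i(1)]] \<epsilon> by simp
    then show ?thesis by (rule less_opnorm[OF X.spaces[OF i(1)] Y.spaces[OF i(1)] ops[OF i(1)]])
  qed
  then obtain e where e: "\<And>i. i \<in> E0 \<Longrightarrow> e i \<in> unit_ball (X i)" "\<And>i. i \<in> E0 \<Longrightarrow> \<epsilon> / 2 < nrm (Y i) (A i (e i))"
    by metis
  have ec: "e i \<in> carrier (X i)" if "i \<in> E0" for i
    using e(1)[OF that] by (simp add: unit_ball_def)
  have ev: "ev_sum K S n (\<lambda>z. ell_le p \<Lambda> (coord_nrm z) s) \<zero>\<^bsub>S\<^esub>" for n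
    using s by (simp add: ev_bound_def)
  show False
  proof (cases "p = \<infinity>")
    case True
    obtain n :: nat where n: "s < n * (\<epsilon> / 4)" using ex_less_of_nat_mult[of "\<epsilon> / 4" s] \<epsilon> by auto
    obtain z E where z: "z \<in> carrier S" "E \<subseteq> E0" "infinite E"
      "\<forall>i\<in>E. z i = complex_of_real (n / 2) \<odot>\<^bsub>X i\<^esub> e i" "ell_le p \<Lambda> (coord_nrm z) s"
      using ev_sum_blocks[OF E0 e(1) True ev[of n]] by blast
    obtain i where i: "i \<in> E" using infinite_imp_nonempty[OF z(3)] by blast
    then have iE: "i \<in> E0" "i \<in> \<Lambda>" using z(2) E0 by auto
    have "coord_nrm z i = \<bar>n / 2\<bar> * nrm (Y i) (A i (e i))"
      using z(4) i by (intro coord_nrm_smult[OF iE(2) ec[OF iE(1)]]) auto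
    moreover have "\<bar>n / 2\<bar> * (\<epsilon> / 2) \<le> \<bar>n / 2\<bar> * nrm (Y i) (A i (e i))"
      using e(2)[OF iE(1)] by (intro mult_left_mono) auto
    moreover have "\<bar>n / 2\<bar> * (\<epsilon> / 2) = n * (\<epsilon> / 4)" by simp
    ultimately have "s < coord_nrm z i" using n by linarith
    moreover have "\<bar>coord_nrm z i\<bar> \<le> s" by (rule ell_le_coord[OF X.p z(5) s0 iE(2)])
    ultimately show False by simp
  next
    case False
    let ?q = "real_of_ereal p"
    note q = real_exponent[OF X.p False]
    have pos: "(\<epsilon> / 4) powr ?q > 0" using \<epsilon> by simp
    obtain n :: nat where n: "s powr ?q < n * (\<epsilon> / 4) powr ?q" using ex_less_of_nat_mult[OF pos] by blast
    obtain z G E where z: "z \<in> carrier S" "finite G" "card G = n" "G \<subseteq> E0"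
      "\<forall>i\<in>G. z i = (1/2) \<odot>\<^bsub>X i\<^esub> e i" "ell_le p \<Lambda> (coord_nrm z) s"
      using ev_sum_disjoint_singles[OF E0 e(1) ev[of n]] by blast
    \<comment> \<open>The coordinates in \<open>G\<close> alone violate the bound; whatever the
      discarded ones carry could only add to the sum.\<close>
    have "n * (\<epsilon> / 4) powr ?q = (\<Sum>i\<in>G. (\<epsilon> / 4) powr ?q)" using z(3) by simp
    also have "\<dots> \<le> (\<Sum>i\<in>G. \<bar>coord_nrm z i\<bar> powr ?q)"
    proof (rule sum_mono)
      fix i assume i: "i \<in> G"
      then have iE: "i \<in> E0" "i \<in> \<Lambda>" using z(4) E0 by auto
      have "coord_nrm z i = \<bar>1/2\<bar> * nrm (Y i) (A i (e i))"
        using z(5) i by (intro coord_nrm_smult[OF iE(2) ec[OF iE(1)]]) auto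
      then have "\<epsilon> / 4 \<le> \<bar>coord_nrm z i\<bar>" using e(2)[OF iE(1)] by simp
      then show "(\<epsilon> / 4) powr ?q \<le> \<bar>coord_nrm z i\<bar> powr ?q" using \<epsilon> q by (intro powr_mono2) auto
    qed
    also have "\<dots> \<le> s powr ?q"
    proof -
      have "finite G \<and> G \<subseteq> \<Lambda>" using z(2,4) E0 by blast
      then show ?thesis by (rule z(6)[unfolded ell_le_def if_not_P[OF False], THEN spec, THEN mp])
    qed
    finally show False using n by simp
  qed
qed

end

theorem theorem1p6:
  fixes K :: "complex set"
    and \<Lambda> :: "'i set"
    and X :: "'i \<Rightarrow> 'a normed"
    and Y :: "'i \<Rightarrow> 'b normed"
    and A :: "'i \<Rightarrow> 'a \<Rightarrow> 'b"
    and p :: ereal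
  assumes "K = \<real> \<or> K = UNIV"
    and "\<Lambda> \<noteq> {}"
    and "\<And>i. i \<in> \<Lambda> \<Longrightarrow> banach_space K (X i)"
    and "\<And>i. i \<in> \<Lambda> \<Longrightarrow> banach_space K (Y i)"
    and "\<And>i. i \<in> \<Lambda> \<Longrightarrow> bounded_op K (X i) (Y i) (A i)"
    and "bdd_above ((\<lambda>i. opnorm (X i) (Y i) (A i)) ` \<Lambda>)"
    and "1 \<le> p"
  shows "op_summable_szlenk K (direct_sum p \<Lambda> X) (direct_sum p \<Lambda> Y) (induced_op \<Lambda> A) \<longleftrightarrow>
      (\<lambda>i. opnorm (X i) (Y i) (A i)) \<in> c_zero \<Lambda> \<and>
      (\<forall>i\<in>\<Lambda>. Sigma_op K (X i) (Y i) (A i) < \<infinity>) \<and>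
      (\<lambda>i. real_of_ereal (Sigma_op K (X i) (Y i) (A i))) \<in> ell p \<Lambda>"
proof -
  interpret op_family K \<Lambda> X Y p A
    by (intro op_family.intro op_family_axioms.intro space_family.intro assms banach_space.axioms(1))
  show ?thesis
    unfolding op_summable_iff_ev_bound
  proof (intro iffI conjI; (elim exE conjE)?)
    fix s assume s: "ev_bound s"
    show "opn \<in> c_zero \<Lambda>" by (rule c_zero_if_ev_bound[OF s])
    show "\<forall>i\<in>\<Lambda>. Sig i < \<infinity>" "(\<lambda>i. real_of_ereal (Sig i)) \<in> ell p \<Lambda>"
      by (rule Sigma_if_ev_bound[OF s])+
  next
    assume "opn \<in> c_zero \<Lambda>" "\<forall>i\<in>\<Lambda>. Sig i < \<infinity>" "(\<lambda>i. real_of_ereal (Sig i)) \<in> ell p \<Lambda>"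
    then show "\<exists>s. ev_bound s" by (intro ev_bound_if_Sigma) simp_all
  qed
qed

end
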